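(* Let $G$ be a non-abelian, torsion-free, finitely-generated nilpotent group which is metabelian, and let $A$ be a maximal abelian subgroup of $G$ containing $[G,G]$. Let $k=\operatorname{rank}(G/A)$. Then $G$ embeds (as an abstract group) into $\mathrm{Diff}_+^{1+\alpha}([0,1])$ for all $\alpha\in[0,1)$ with $\alpha<1/k$. In particular, $1+\frac1k\le \mathrm{Crit}_{[0,1]}(G)$.
   Context: For an integer $n\ge 0$ and a real $\alpha\in[0,1)$, $\mathrm{Diff}_+^{n+\alpha}([0,1])$ denotes the group of all orientation preserving $C^n$-diffeomorphisms of $[0,1]$ whose $n$-th derivative is $\alpha$-H\"older continuous (for $n=0,\alpha=0$: the orientation preserving homeomorphisms of $[0,1]$). The critical regularity of a group $G$ on $[0,1]$ is $$\mathrm{Crit}_{[0,1]}(G)=\sup\{n+\alpha \mid n\ge 0,\ \alpha\in[0,1),\ G \text{ embeds into } \mathrm{Diff}_+^{n+\alpha}([0,1])\},$$ with $\mathrm{Crit}_{[0,1]}(G)=-\infty$ if $G$ does not embed into $\mathrm{Diff}_+^{0}([0,1])$. A group is metabelian if its commutator subgroup $[G,G]$ is abelian. For an abelian group $H$, $\operatorname{rank}(H)$ is its torsion-free rank, i.e. the dimension of the $\mathbb{Q}$-vector space $H\otimes\mathbb{Q}$. A maximal abelian subgroup is an abelian subgroup not properly contained in any other abelian subgroup. *)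

theory Defs
  imports
    Complex_Main
    "HOL-Library.Extended_Real"
    "HOL-Algebra.Bij"
    "HOL-Algebra.Module"
    "HOL-Algebra.Generated_Groups"
    "HOL-Algebra.Free_Abelian_Groups"
begin

section \<open>Group-theoretic notions\<close>

definition torsion_free :: "('a, 'b) monoid_scheme \<Rightarrow> bool" where
  "torsion_free G \<longleftrightarrow>
     (\<forall>x\<in>carrier G. \<forall>n::nat. n > 0 \<longrightarrow> x [^]\<^bsub>G\<^esub> n = \<one>\<^bsub>G\<^esub> \<longrightarrow> x = \<one>\<^bsub>G\<^esub>)"

definition finitely_generated :: "('a, 'b) monoid_scheme \<Rightarrow> bool" where
  "finitely_generated G \<longleftrightarrow>
     (\<exists>S. finite S \<and> S \<subseteq> carrier G \<and> generate G S = carrier G)"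

primrec lower_central :: "('a, 'b) monoid_scheme \<Rightarrow> nat \<Rightarrow> 'a set" where
  "lower_central G 0 = carrier G"
| "lower_central G (Suc n) =
     generate G (\<Union>x\<in>lower_central G n. \<Union>y\<in>carrier G.
       {x \<otimes>\<^bsub>G\<^esub> y \<otimes>\<^bsub>G\<^esub> inv\<^bsub>G\<^esub> x \<otimes>\<^bsub>G\<^esub> inv\<^bsub>G\<^esub> y})"

definition nilpotent :: "('a, 'b) monoid_scheme \<Rightarrow> bool" where
  "nilpotent G \<longleftrightarrow> (\<exists>n. lower_central G n = {\<one>\<^bsub>G\<^esub>})"

definition abelian_subgroup :: "'a set \<Rightarrow> ('a, 'b) monoid_scheme \<Rightarrow> bool" where
  "abelian_subgroup A G \<longleftrightarrow> subgroup A G \<and> comm_group (G\<lparr>carrier := A\<rparr>)"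

definition metabelian :: "('a, 'b) monoid_scheme \<Rightarrow> bool" where
  "metabelian G \<longleftrightarrow> abelian_subgroup (derived G (carrier G)) G"

definition maximal_abelian_subgroup :: "'a set \<Rightarrow> ('a, 'b) monoid_scheme \<Rightarrow> bool" where
  "maximal_abelian_subgroup A G \<longleftrightarrow>
     abelian_subgroup A G \<and> (\<forall>B. abelian_subgroup B G \<longrightarrow> A \<subseteq> B \<longrightarrow> B = A)"

section \<open>Torsion-free rank\<close>

text \<open>
  For an abelian group \<open>H\<close> (written multiplicatively), \<open>H \<otimes> \<rat>\<close> is the quotient of the free
  abelian group on \<open>H \<times> \<rat>\<close> by the subgroup generated by the bilinearity relations.
\<close>

abbreviation tensor_rat_free ::
    "('a, 'b) monoid_scheme \<Rightarrow> (('a \<times> rat) \<Rightarrow>\<^sub>0 int) monoid" where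
  "tensor_rat_free H \<equiv> free_Abelian_group (carrier H \<times> UNIV)"

definition tensor_rat_relations ::
    "('a, 'b) monoid_scheme \<Rightarrow> (('a \<times> rat) \<Rightarrow>\<^sub>0 int) set" where
  "tensor_rat_relations H = generate (tensor_rat_free H)
     ({frag_of (a \<otimes>\<^bsub>H\<^esub> b, q) - frag_of (a, q) - frag_of (b, q) | a b q.
         a \<in> carrier H \<and> b \<in> carrier H} \<union>
      {frag_of (a, q + r) - frag_of (a, q) - frag_of (a, r) | a q r. a \<in> carrier H})"

text \<open>
  The scalar \<open>q\<close> acts by \<open>a \<otimes> r \<mapsto> a \<otimes> (q * r)\<close>. The image of a coset of the relation subgroup
  under this map lies in a single coset, and is completed to that coset by the product with the
  relation subgroup. The fields \<open>mult\<close> and \<open>one\<close>, which the record type inherits from rings,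
  play no role in a vector space.
\<close>

definition tensor_rat ::
    "('a, 'b) monoid_scheme \<Rightarrow> (rat, (('a \<times> rat) \<Rightarrow>\<^sub>0 int) set) module" where
  "tensor_rat H =
    (let F = tensor_rat_free H; K = tensor_rat_relations H; Q = F Mod K in
     \<lparr>carrier = carrier Q,
      monoid.mult = (\<lambda>_ _. undefined),
      one = undefined,
      ring.zero = \<one>\<^bsub>Q\<^esub>,
      add = (\<lambda>C D. C \<otimes>\<^bsub>Q\<^esub> D),
      smult = (\<lambda>q C. K <#>\<^bsub>F\<^esub> (frag_extend (\<lambda>(a, r). frag_of (a, q * r)) ` C))\<rparr>)"

definition rat_independent :: "(rat, 'v, 'm) module_scheme \<Rightarrow> 'v set \<Rightarrow> bool" where
  "rat_independent V B \<longleftrightarrow> B \<subseteq> carrier V \<and>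
     (\<forall>S c. finite S \<longrightarrow> S \<subseteq> B \<longrightarrow> (\<Oplus>\<^bsub>V\<^esub>v\<in>S. c v \<odot>\<^bsub>V\<^esub> v) = \<zero>\<^bsub>V\<^esub> \<longrightarrow> (\<forall>v\<in>S. c v = 0))"

definition rat_spanning :: "(rat, 'v, 'm) module_scheme \<Rightarrow> 'v set \<Rightarrow> bool" where
  "rat_spanning V B \<longleftrightarrow> B \<subseteq> carrier V \<and>
     (\<forall>x\<in>carrier V. \<exists>S c. finite S \<and> S \<subseteq> B \<and> x = (\<Oplus>\<^bsub>V\<^esub>v\<in>S. c v \<odot>\<^bsub>V\<^esub> v))"

text \<open>As for \<open>dim\<close> in the library, infinite-dimensional spaces get the value \<open>0\<close>.\<close>

definition rat_dim :: "(rat, 'v, 'm) module_scheme \<Rightarrow> nat" where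
  "rat_dim V = card (SOME B. rat_independent V B \<and> rat_spanning V B)"

definition torsion_free_rank :: "('a, 'b) monoid_scheme \<Rightarrow> nat" where
  "torsion_free_rank H = rat_dim (tensor_rat H)"

section \<open>Diffeomorphisms of the unit interval and critical regularity\<close>

definition has_nth_derivative_on ::
    "(real \<Rightarrow> real) \<Rightarrow> nat \<Rightarrow> (real \<Rightarrow> real) \<Rightarrow> real set \<Rightarrow> bool" where
  "has_nth_derivative_on f n g S \<longleftrightarrow>
     (\<exists>D. D 0 = f \<and> D n = g \<and>
       (\<forall>i<n. \<forall>x\<in>S. (D i has_real_derivative D (Suc i) x) (at x within S)))"

definition C_on :: "nat \<Rightarrow> (real \<Rightarrow> real) \<Rightarrow> real set \<Rightarrow> bool" where
  "C_on n f S \<longleftrightarrow> (\<exists>g. has_nth_derivative_on f n g S \<and> continuous_on S g)"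

definition Holder_on :: "real \<Rightarrow> (real \<Rightarrow> real) \<Rightarrow> real set \<Rightarrow> bool" where
  "Holder_on \<alpha> g S \<longleftrightarrow>
     (\<exists>C. \<forall>x\<in>S. \<forall>y\<in>S. \<bar>g x - g y\<bar> \<le> C * \<bar>x - y\<bar> powr \<alpha>)"

text \<open>
  For \<open>\<alpha> = 0\<close> the Hoelder condition is boundedness, which continuity on \<open>[0, 1]\<close> implies. Elements
  are functions that are \<open>undefined\<close> outside \<open>[0, 1]\<close>, and multiplication is composition.
  For \<open>n = 0\<close> and \<open>0 < \<alpha> < 1\<close> the carrier is not closed under composition; an embedding into
  it is then an embedding into the homeomorphism group whose image lies in the carrier.
\<close>

definition Diff_plus :: "nat \<Rightarrow> real \<Rightarrow> (real \<Rightarrow> real) monoid" where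
  "Diff_plus n \<alpha> = (BijGroup {0..1})
     \<lparr>carrier := {f \<in> Bij {0..1}. strict_mono_on {0..1} f \<and>
        C_on n f {0..1} \<and> C_on n (inv_into {0..1} f) {0..1} \<and>
        (\<exists>g. has_nth_derivative_on f n g {0..1} \<and> Holder_on \<alpha> g {0..1})}\<rparr>"

definition embeds_into :: "('a, 'b) monoid_scheme \<Rightarrow> ('c, 'd) monoid_scheme \<Rightarrow> bool" where
  "embeds_into G H \<longleftrightarrow> mon G H \<noteq> {}"

definition Crit :: "('a, 'b) monoid_scheme \<Rightarrow> ereal" where
  "Crit G = (if embeds_into G (Diff_plus 0 0)
     then Sup {ereal (real n + \<alpha>) | n \<alpha>. 0 \<le> \<alpha> \<and> \<alpha> < 1 \<and> embeds_into G (Diff_plus n \<alpha>)}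
     else -\<infinity>)"

end

theory Submission
  imports
    Defs
    "HOL-Analysis.Analysis"
    "HOL-Real_Asymp.Real_Asymp"
    "HOL-Library.Function_Algebras"
begin

text \<open>
The quotient \<open>G / A\<close> is torsion-free: if a power of \<open>g\<close> lies in \<open>A\<close>, nilpotency and
torsion-freeness force \<open>g\<close> to centralize \<open>A\<close>, and \<open>A\<close> is its own centralizer by maximality. So
\<open>G / A\<close> is a free abelian group whose rank is the torsion-free rank \<open>k\<close>; let \<open>\<pi>\<close> be the
projection to \<open>\<int>\<^sup>k\<close>. Choose an injective homomorphism \<open>\<phi>\<close> from \<open>A\<close> to the reals. Inducing the
action of \<open>A\<close> by translations through \<open>\<phi>\<close> gives a faithful action of \<open>G\<close> on \<open>\<int>\<^sup>k \<times> \<real>\<close>,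
\<open>g (n, t) = (\<pi> g + n, t + c g n)\<close>, where the cocycle \<open>c\<close> measures how \<open>g\<close> moves a section of \<open>\<pi>\<close>.
This action preserves the lexicographic order. Since \<open>G\<close> is nilpotent, conjugation acts
unipotently on \<open>A\<close>, and therefore \<open>c g n\<close> grows at most polynomially in \<open>n\<close> (\<open>shift_tempered\<close>).

Fix \<open>\<alpha>\<close> with \<open>0 < \<alpha> < 1 / k\<close> and let \<open>\<bar>n\<bar>\<close> be the sum of the absolute values of the coordinates
of \<open>n\<close>. Replace the fibre over \<open>n\<close> by an interval \<open>I n\<close> of length proportional to
\<open>(1 + \<bar>n\<bar>) powr (- 1 / \<alpha>)\<close>. These lengths have a finite sum because \<open>\<alpha> < 1 / k\<close>, so the
intervals, placed in lexicographic order, fill \<open>[0, 1]\<close> up to a null set. The chart from the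
reals to \<open>I n\<close> has derivative proportional to \<open>(\<lambda>\<^sup>2 + t\<^sup>2) powr (- \<gamma>)\<close> with \<open>\<lambda> = (1 + \<bar>n\<bar>) ^ M\<close>.
Its tails do not depend on \<open>n\<close>, so that in these charts every map \<open>t \<mapsto> t + c\<close> from one interval to
another has derivative \<open>1\<close> at the end points, and the pieces fit together to a \<open>C\<^sup>1\<close> map.

The exponents \<open>\<gamma>\<close> and \<open>M\<close> decouple two requirements. The length of \<open>I n\<close> depends only on
\<open>M * (2 * \<gamma> - 1) = 1 / \<alpha>\<close>, whereas \<open>M\<close> itself may exceed the degree of the cocycle. Then both
\<open>c g n\<close> and the change of \<open>\<lambda>\<close> from \<open>n\<close> to \<open>\<pi> g + n\<close> are of order \<open>\<lambda> / (1 + \<bar>n\<bar>)\<close>, and the derivative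
of \<open>g\<close> varies on \<open>I n\<close> by at most a constant times \<open>1 / (1 + \<bar>n\<bar>)\<close>, which is the \<open>\<alpha>\<close>-th power of the
length of \<open>I n\<close> up to a constant factor. This is what the Hoelder condition of exponent \<open>\<alpha>\<close> asks for
(\<open>slide_deriv_lipschitz\<close>, \<open>lipschitz_to_holder\<close>, \<open>glue_has_derivative\<close>).
\<close>

section \<open>Abelian normal subgroups that equal their centralizer\<close>

context group
begin

lemma lower_central_carrier: "lower_central G n \<subseteq> carrier G"
proof (induction n)
  case (Suc n)
  have "(\<Union>x\<in>lower_central G n. \<Union>y\<in>carrier G. {x \<otimes> y \<otimes> inv x \<otimes> inv y}) \<subseteq> carrier G"
    using Suc by auto
  then show ?case using generate_incl by simp
qed simp

lemma commutator_lower_central: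
  assumes "x \<in> lower_central G n" "y \<in> carrier G"
  shows "x \<otimes> y \<otimes> inv x \<otimes> inv y \<in> lower_central G (Suc n)"
  using assms by (auto intro!: generate.incl)

lemma conj_pow:
  assumes "x \<in> carrier G" "y \<in> carrier G"
  shows "(x \<otimes> y \<otimes> inv x) [^] (n::nat) = x \<otimes> y [^] n \<otimes> inv x"
proof (induction n)
  case (Suc n)
  have "(x \<otimes> y \<otimes> inv x) [^] Suc n = x \<otimes> y [^] n \<otimes> inv x \<otimes> (x \<otimes> y \<otimes> inv x)"
    using Suc by simp
  also have "\<dots> = x \<otimes> y [^] n \<otimes> (inv x \<otimes> x) \<otimes> y \<otimes> inv x"
    using assms by (simp only: m_assoc m_closed inv_closed nat_pow_closed)
  also have "\<dots> = x \<otimes> y [^] Suc n \<otimes> inv x" using assms by (simp add: m_assoc)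
  finally show ?case .
qed (use assms in simp)

text \<open>
The centralizer of an element is a subgroup, so it contains everything generated by the elements
of \<open>S\<close>.
\<close>

lemma generate_commute:
  assumes S: "S \<subseteq> carrier G" and x: "x \<in> carrier G" and comm: "\<And>s. s \<in> S \<Longrightarrow> x \<otimes> s = s \<otimes> x"
    and y: "y \<in> generate G S"
  shows "x \<otimes> y = y \<otimes> x"
  using y
proof (induction rule: generate.induct)
  case (inv s)
  then have s: "s \<in> carrier G" using S by auto
  have "inv s \<otimes> (x \<otimes> s) \<otimes> inv s = inv s \<otimes> (s \<otimes> x) \<otimes> inv s" using comm[OF inv] by simp
  moreover have "inv s \<otimes> (x \<otimes> s) \<otimes> inv s = inv s \<otimes> x" using s x by (simp add: m_assoc)
  moreover have "inv s \<otimes> (s \<otimes> x) \<otimes> inv s = x \<otimes> inv s" using s x by (simp add: m_assoc[symmetric])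
  ultimately show ?case by simp
next
  case (eng h1 h2)
  then have "h1 \<in> carrier G" "h2 \<in> carrier G" using S generate_in_carrier by auto
  then show ?case using eng x by (metis m_assoc)
qed (use x comm in auto)

lemma abelian_subgroupI:
  assumes "subgroup B G" "\<And>x y. x \<in> B \<Longrightarrow> y \<in> B \<Longrightarrow> x \<otimes> y = y \<otimes> x"
  shows "abelian_subgroup B G"
  unfolding abelian_subgroup_def
proof
  interpret B: group "G\<lparr>carrier := B\<rparr>" using assms(1) subgroup_imp_group by blast
  show "comm_group (G\<lparr>carrier := B\<rparr>)" by (rule B.group_comm_groupI) (use assms in auto)
qed (rule assms)

end

locale abelian_normal_data = group G for G :: "('a, 'b) monoid_scheme" (structure) +
  fixes A :: "'a set"
  assumes tf: "torsion_free G" and nilp: "nilpotent G"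
    and max: "maximal_abelian_subgroup A G" and der: "derived G (carrier G) \<subseteq> A"
begin

lemma subA: "subgroup A G" and comm_groupA: "comm_group (G\<lparr>carrier := A\<rparr>)"
  using max by (auto simp: maximal_abelian_subgroup_def abelian_subgroup_def)

lemma A_carrier: "a \<in> A \<Longrightarrow> a \<in> carrier G"
  using subgroup.mem_carrier[OF subA] .

lemma A_comm: "a \<in> A \<Longrightarrow> b \<in> A \<Longrightarrow> a \<otimes> b = b \<otimes> a"
  using comm_monoid.m_comm[OF comm_group.axioms(1)[OF comm_groupA], of a b] by simp

lemma commutator_A: "x \<in> carrier G \<Longrightarrow> y \<in> carrier G \<Longrightarrow> x \<otimes> y \<otimes> inv x \<otimes> inv y \<in> A"
  using der by (auto simp: derived_def intro!: generate.incl)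

lemma conj_A:
  assumes "x \<in> carrier G" "a \<in> A" shows "x \<otimes> a \<otimes> inv x \<in> A"
proof -
  have a: "a \<in> carrier G" using assms A_carrier by blast
  have "x \<otimes> a \<otimes> inv x = (x \<otimes> a \<otimes> inv x \<otimes> inv a) \<otimes> a" using a assms by (simp add: m_assoc)
  then show ?thesis
    using subgroup.m_closed[OF subA commutator_A[OF assms(1) a] assms(2)] by simp
qed

lemma normalA: "A \<lhd> G"
  using subA conj_A by (simp add: normal_inv_iff)

lemma conj_A': "x \<in> carrier G \<Longrightarrow> a \<in> A \<Longrightarrow> inv x \<otimes> a \<otimes> x \<in> A"
  using conj_A[of "inv x" a] by simp

text \<open>
Downward induction along the lower central series, starting from a trivial term. For \<open>a\<close> in one
term, the commutator \<open>b = a g a\<^sup>-\<^sup>1 g\<^sup>-\<^sup>1\<close> lies in the next one and hence commutes with \<open>g\<close>. Conjugating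
\<open>g ^ n\<close> by \<open>a\<close>, which commutes with it, gives \<open>g ^ n = (b g) ^ n = b ^ n g ^ n\<close>; so \<open>b ^ n\<close> is
trivial and torsion-freeness kills \<open>b\<close>.
\<close>

lemma power_in_A_commutes:
  assumes g: "g \<in> carrier G" "0 < n" "g [^] (n::nat) \<in> A" and a: "a \<in> A"
  shows "a \<otimes> g = g \<otimes> a"
proof -
  obtain d where d: "lower_central G d = {\<one>}" using nilp by (auto simp: nilpotent_def)
  have "j \<le> d \<Longrightarrow> \<forall>a \<in> A \<inter> lower_central G (d - j). a \<otimes> g = g \<otimes> a" for j
  proof (induction j)
    case 0
    then show ?case using d g by simp
  next
    case (Suc j)
    show ?case
    proof
      fix a assume a: "a \<in> A \<inter> lower_central G (d - Suc j)"
      have ac: "a \<in> carrier G" using a A_carrier by blast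
      let ?b = "a \<otimes> g \<otimes> inv a \<otimes> inv g"
      have "?b \<in> lower_central G (Suc (d - Suc j))" using a g by (intro commutator_lower_central) auto
      moreover have "Suc (d - Suc j) = d - j" using Suc.prems by simp
      ultimately have bl: "?b \<in> lower_central G (d - j)" by metis
      have bA: "?b \<in> A" using commutator_A[OF ac g(1)] .
      have bc: "?b \<in> carrier G" using ac g by simp
      have comm: "?b \<otimes> g = g \<otimes> ?b" using Suc bl bA by auto
      \<comment> \<open>The powers of both sides of \<open>b g = a g a\<^sup>-\<^sup>1\<close> are compared.\<close>
      have bg: "?b \<otimes> g = a \<otimes> g \<otimes> inv a" using ac g by (simp add: m_assoc)
      have "(?b \<otimes> g) [^] n = a \<otimes> g [^] n \<otimes> inv a" unfolding bg using ac g by (intro conj_pow) auto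
      also have "\<dots> = g [^] n \<otimes> a \<otimes> inv a" using A_comm[of a "g [^] n"] a g by simp
      also have "\<dots> = g [^] n" using ac g by (simp add: m_assoc)
      finally have "?b [^] n \<otimes> g [^] n = g [^] n" using pow_mult_distrib[OF comm bc g(1)] by simp
      then have "?b [^] n = \<one>" using bc g by (simp add: r_cancel_one)
      then have "?b = \<one>" using tf bc g by (auto simp: torsion_free_def)
      then show "a \<otimes> g = g \<otimes> a" using bg ac g by (metis inv_solve_right l_one m_closed)
    qed
  qed
  from this[of d] show ?thesis using a A_carrier by simp
qed

text \<open>
Otherwise \<open>A\<close> and \<open>g\<close> would generate a larger abelian subgroup.
\<close>

lemma centralizer_A:
  assumes g: "g \<in> carrier G" and comm: "\<And>a. a \<in> A \<Longrightarrow> a \<otimes> g = g \<otimes> a"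
  shows "g \<in> A"
proof -
  let ?S = "insert g A"
  have S: "?S \<subseteq> carrier G" using g A_carrier by auto
  have SS: "x \<otimes> y = y \<otimes> x" if "x \<in> ?S" "y \<in> ?S" for x y
    using that comm A_comm by auto
  have "x \<otimes> y = y \<otimes> x" if x: "x \<in> generate G ?S" and y: "y \<in> ?S" for x y
    using generate_commute[OF S, of y x] S SS x y by auto
  then have "x \<otimes> y = y \<otimes> x" if "x \<in> generate G ?S" "y \<in> generate G ?S" for x y
    using generate_commute[OF S, of x y] S that generate_in_carrier by blast
  then have "abelian_subgroup (generate G ?S) G"
    using generate_is_subgroup[OF S] by (intro abelian_subgroupI) auto
  moreover have "A \<subseteq> generate G ?S" by (auto intro: generate.incl)
  ultimately have "generate G ?S = A" using max by (auto simp: maximal_abelian_subgroup_def)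
  then show ?thesis by (metis generate.incl insertI1)
qed

lemma root_closed: "g \<in> carrier G \<Longrightarrow> 0 < n \<Longrightarrow> g [^] (n::nat) \<in> A \<Longrightarrow> g \<in> A"
  using centralizer_A power_in_A_commutes by blast

lemma quotient_comm_group: "comm_group (G Mod A)"
proof -
  interpret N: normal A G using normalA .
  interpret Q: group "G Mod A" using N.factorgroup_is_group .
  show ?thesis
  proof (rule Q.group_comm_groupI)
    fix X Y assume "X \<in> carrier (G Mod A)" "Y \<in> carrier (G Mod A)"
    then obtain x y where xy: "x \<in> carrier G" "X = A #> x" "y \<in> carrier G" "Y = A #> y"
      by (auto simp: FactGroup_def RCOSETS_def)
    have "A #> (x \<otimes> y) = A #> (y \<otimes> x)"
    proof (rule repr_independence[OF _ _ subA, symmetric])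
      have "x \<otimes> y = (x \<otimes> y \<otimes> inv x \<otimes> inv y) \<otimes> (y \<otimes> x)"
        using xy by (simp add: m_assoc) (simp add: m_assoc[symmetric])
      then show "x \<otimes> y \<in> A #> (y \<otimes> x)" using commutator_A[OF xy(1,3)] by (auto simp: r_coset_def)
    qed (use xy in simp)
    then show "X \<otimes>\<^bsub>G Mod A\<^esub> Y = Y \<otimes>\<^bsub>G Mod A\<^esub> X"
      using xy by (simp add: FactGroup_def N.rcos_sum)
  qed
qed

lemma quotient_torsion_free: "torsion_free (G Mod A)"
  unfolding torsion_free_def
proof (intro ballI allI impI)
  interpret N: normal A G using normalA .
  fix X and n :: nat
  assume X: "X \<in> carrier (G Mod A)" and n: "0 < n" and e: "X [^]\<^bsub>G Mod A\<^esub> n = \<one>\<^bsub>G Mod A\<^esub>"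
  then obtain x where x: "x \<in> carrier G" "X = A #> x" by (auto simp: FactGroup_def RCOSETS_def)
  have "A #> (x [^] n) = A" using e x N.FactGroup_pow[of x n] by (simp add: FactGroup_def)
  then have "x [^] n \<in> A" using x by (metis nat_pow_closed rcos_self subA)
  then have "x \<in> A" using root_closed x n by blast
  then show "X = \<one>\<^bsub>G Mod A\<^esub>" using x by (simp add: FactGroup_def subgroup.rcos_const[OF subA is_group])
qed

end

section \<open>Embedding countable torsion-free abelian groups into the reals\<close>

text \<open>
Every element of the generated subgroup is the value of a word, and there are only countably many
words.
\<close>

lemma (in group) countable_generate:
  assumes S: "countable S" "S \<subseteq> carrier G" shows "countable (generate G S)"
proof -
  let ?T = "S \<union> (\<lambda>s. inv s) ` S"
  let ?p = "\<lambda>w. foldr (\<otimes>) w \<one>"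
  have closed: "?p w \<in> carrier G" if "w \<in> lists ?T" for w
    using that S by (induction w) auto
  have app: "?p (v @ w) = ?p v \<otimes> ?p w" if "v \<in> lists ?T" "w \<in> lists ?T" for v w
    using that
  proof (induction v)
    case (Cons s v)
    have "s \<in> carrier G" using Cons S by auto
    then show ?case using Cons closed[of v] closed[of w] by (simp add: m_assoc)
  qed (use closed in simp)
  have "generate G S \<subseteq> ?p ` lists ?T"
  proof
    fix x assume "x \<in> generate G S"
    then show "x \<in> ?p ` lists ?T"
    proof (induction rule: generate.induct)
      case one
      show ?case by (rule image_eqI[of _ _ "[]"]) auto
    next
      case (incl s)
      then show ?case using S by (intro image_eqI[of _ _ "[s]"]) auto
    next
      case (inv s)
      then show ?case using S by (intro image_eqI[of _ _ "[inv s]"]) auto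
    next
      case (eng x y)
      then obtain v w where "v \<in> lists ?T" "w \<in> lists ?T" "x = ?p v" "y = ?p w" by blast
      then show ?case using app by (intro image_eqI[of _ _ "v @ w"]) auto
    qed
  qed
  moreover have "countable (?p ` lists ?T)" using S by auto
  ultimately show ?thesis using countable_subset by blast
qed

text \<open>
The graph of an injective homomorphism to the reals that is defined on a subgroup, encoded as a set
of pairs so that Zorn's lemma applies to inclusion. Injectivity and single-valuedness are both
contained in the last clause.
\<close>

definition (in group) partial_embedding :: "('a \<times> real) set \<Rightarrow> bool" where
  "partial_embedding \<Gamma> \<longleftrightarrow> \<Gamma> \<subseteq> carrier G \<times> UNIV \<and> (\<one>, 0) \<in> \<Gamma> \<and>
     (\<forall>x s y t. (x, s) \<in> \<Gamma> \<longrightarrow> (y, t) \<in> \<Gamma> \<longrightarrow> (x \<otimes> y, s + t) \<in> \<Gamma>) \<and>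
     (\<forall>x s. (x, s) \<in> \<Gamma> \<longrightarrow> (inv x, - s) \<in> \<Gamma>) \<and>
     (\<forall>x s. (x, s) \<in> \<Gamma> \<longrightarrow> (x = \<one> \<longleftrightarrow> s = 0))"

context comm_group
begin

lemma partial_embeddingD:
  assumes "partial_embedding \<Gamma>"
  shows "(x, s) \<in> \<Gamma> \<Longrightarrow> x \<in> carrier G" and "(\<one>, 0) \<in> \<Gamma>"
    and "(x, s) \<in> \<Gamma> \<Longrightarrow> (y, t) \<in> \<Gamma> \<Longrightarrow> (x \<otimes> y, s + t) \<in> \<Gamma>"
    and "(x, s) \<in> \<Gamma> \<Longrightarrow> (inv x, - s) \<in> \<Gamma>"
    and "(x, s) \<in> \<Gamma> \<Longrightarrow> x = \<one> \<longleftrightarrow> s = 0"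
  using assms unfolding partial_embedding_def by blast+

lemma partial_embedding_unique:
  assumes "partial_embedding \<Gamma>" "(x, s) \<in> \<Gamma>" "(x, t) \<in> \<Gamma>" shows "s = t"
proof -
  have "(x \<otimes> inv x, s + - t) \<in> \<Gamma>" using partial_embeddingD[OF assms(1)] assms(2,3) by blast
  then show ?thesis using partial_embeddingD(1,5)[OF assms(1)] assms(2) by fastforce
qed

lemma partial_embedding_int_pow:
  assumes "partial_embedding \<Gamma>" "(x, s) \<in> \<Gamma>" shows "(x [^] (m::int), of_int m * s) \<in> \<Gamma>"
proof -
  note D = partial_embeddingD[OF assms(1)]
  have x: "x \<in> carrier G" using D(1) assms(2) .
  have nat: "(x [^] (n::nat), of_nat n * s) \<in> \<Gamma>" for n
  proof (induction n)
    case (Suc n)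
    then show ?case using D(3)[OF Suc assms(2)] by (simp add: algebra_simps)
  qed (use D(2) in simp)
  show ?thesis
  proof (cases m)
    case (nonneg n)
    then show ?thesis using nat[of n] by (simp add: int_pow_int)
  next
    case (neg n)
    have "(inv (x [^] Suc n), - (of_nat (Suc n) * s)) \<in> \<Gamma>" using D(4)[OF nat] .
    moreover have "x [^] m = inv (x [^] Suc n)" using x neg by (metis int_pow_neg_int)
    moreover have "real_of_int m = - real (Suc n)" using neg by simp
    then have "of_int m * s = - (of_nat (Suc n) * s)" by (simp only: mult_minus_left)
    ultimately show ?thesis by (simp only:)
  qed
qed

text \<open>
The condition on \<open>r\<close> says exactly that the value \<open>r\<close> for \<open>a\<close> keeps the extended homomorphism
well defined and injective.
\<close>

lemma partial_embedding_extend: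
  assumes pe: "partial_embedding \<Gamma>" and a: "a \<in> carrier G"
    and r: "\<And>m b t. (b, t) \<in> \<Gamma> \<Longrightarrow> a [^] (m::int) \<otimes> b = \<one> \<longleftrightarrow> of_int m * r + t = 0"
  shows "\<exists>\<Gamma>'. partial_embedding \<Gamma>' \<and> \<Gamma> \<subseteq> \<Gamma>' \<and> (a, r) \<in> \<Gamma>'"
proof -
  note D = partial_embeddingD[OF pe]
  define \<Gamma>' where "\<Gamma>' = {(a [^] (m::int) \<otimes> b, of_int m * r + t) | m b t. (b, t) \<in> \<Gamma>}"
  have mem: "(a [^] m \<otimes> b, of_int m * r + t) \<in> \<Gamma>'" if "(b, t) \<in> \<Gamma>" for m b t
    using that unfolding \<Gamma>'_def by blast
  have "partial_embedding \<Gamma>'"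
    unfolding partial_embedding_def
  proof (intro conjI allI impI)
    show "\<Gamma>' \<subseteq> carrier G \<times> UNIV" using a D(1) by (auto simp: \<Gamma>'_def)
    show "(\<one>, 0) \<in> \<Gamma>'"
      using mem[OF D(2), of 0] by simp
  next
    fix x s y t assume "(x, s) \<in> \<Gamma>'" "(y, t) \<in> \<Gamma>'"
    then obtain m b u n c v where e: "x = a [^] (m::int) \<otimes> b" "s = of_int m * r + u" "(b, u) \<in> \<Gamma>"
        "y = a [^] (n::int) \<otimes> c" "t = of_int n * r + v" "(c, v) \<in> \<Gamma>"
      by (auto simp: \<Gamma>'_def)
    have bc: "b \<in> carrier G" "c \<in> carrier G" using e D(1) by auto
    have "x \<otimes> y = a [^] (m + n) \<otimes> (b \<otimes> c)"
      using a bc by (simp add: e int_pow_mult m_ac)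
    moreover have "s + t = of_int (m + n) * r + (u + v)" by (simp add: e algebra_simps)
    ultimately show "(x \<otimes> y, s + t) \<in> \<Gamma>'" using mem[OF D(3)[OF e(3,6)], of "m + n"] by simp
  next
    fix x s assume "(x, s) \<in> \<Gamma>'"
    then obtain m b u where e: "x = a [^] (m::int) \<otimes> b" "s = of_int m * r + u" "(b, u) \<in> \<Gamma>"
      by (auto simp: \<Gamma>'_def)
    have b: "b \<in> carrier G" using e D(1) by auto
    have "inv x = a [^] (- m) \<otimes> inv b" using a b by (simp add: e inv_mult int_pow_neg)
    moreover have "- s = of_int (- m) * r + - u" by (simp add: e)
    ultimately show "(inv x, - s) \<in> \<Gamma>'" using mem[OF D(4)[OF e(3)], of "- m"] by simp
  next
    fix x s assume "(x, s) \<in> \<Gamma>'"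
    then show "x = \<one> \<longleftrightarrow> s = 0" using r by (auto simp: \<Gamma>'_def)
  qed
  moreover have "\<Gamma> \<subseteq> \<Gamma>'"
  proof
    fix p assume p: "p \<in> \<Gamma>"
    obtain b t where bt: "p = (b, t)" by (cases p)
    then have "b \<in> carrier G" using D(1) p by auto
    then show "p \<in> \<Gamma>'" using p bt mem[of b t 0] by simp
  qed
  moreover have "(a, r) \<in> \<Gamma>'"
    using mem[OF D(2), of 1] a by simp
  ultimately show ?thesis by blast
qed

lemma torsion_free_int_pow_eq_one:
  assumes "torsion_free G" "x \<in> carrier G" "n \<noteq> 0" "x [^] (n::int) = \<one>" shows "x = \<one>"
proof -
  have "\<exists>k::nat. 0 < k \<and> x [^] k = \<one>"
  proof (cases n)
    case (nonneg k)
    then show ?thesis using assms(3,4) by (metis int_pow_int of_nat_0 gr0I)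
  next
    case (neg k)
    have "x [^] n = inv (x [^] Suc k)" using assms(2) neg by (metis int_pow_neg_int)
    then have "inv (x [^] Suc k) = \<one>" using assms(4) by metis
    then have "x [^] Suc k = \<one>" using assms(2) by (metis inv_eq_1_iff nat_pow_closed)
    then show ?thesis by blast
  qed
  then show ?thesis using assms by (auto simp: torsion_free_def)
qed

text \<open>
A maximal partial embedding is defined everywhere. If a power \<open>a ^ n\<close> is already in its domain,
then the value of \<open>a\<close> must be the \<open>n\<close>-th part of the value of \<open>a ^ n\<close>, and torsion-freeness makes
this choice injective. If no power is in the domain, it suffices to avoid the countably many
rational multiples of values already taken.
\<close>

lemma torsion_free_embeds_in_reals:
  assumes tf: "torsion_free G" and ct: "countable (carrier G)"
  shows "\<exists>\<phi>. (\<forall>x\<in>carrier G. \<forall>y\<in>carrier G. \<phi> (x \<otimes> y) = \<phi> x + (\<phi> y :: real)) \<and>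
             (\<forall>x\<in>carrier G. \<phi> x = 0 \<longrightarrow> x = \<one>)"
proof -
  have "\<exists>M\<in>Collect partial_embedding. \<forall>X\<in>Collect partial_embedding. M \<subseteq> X \<longrightarrow> X = M"
  proof (rule subset_Zorn_nonempty)
    have "partial_embedding {(\<one>, 0)}" by (auto simp: partial_embedding_def)
    then show "Collect partial_embedding \<noteq> {}" by blast
    fix \<C> assume ne: "\<C> \<noteq> {}" and ch: "subset.chain (Collect partial_embedding) \<C>"
    have pe: "partial_embedding \<Gamma>" if "\<Gamma> \<in> \<C>" for \<Gamma> using ch that by (auto simp: subset_chain_def)
    have two: "\<exists>\<Gamma>\<in>\<C>. p \<in> \<Gamma> \<and> q \<in> \<Gamma>" if "p \<in> \<Union>\<C>" "q \<in> \<Union>\<C>" for p q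
    proof -
      obtain X Y where "X \<in> \<C>" "p \<in> X" "Y \<in> \<C>" "q \<in> Y" using \<open>p \<in> \<Union>\<C>\<close> \<open>q \<in> \<Union>\<C>\<close> by blast
      moreover from this have "X \<subseteq> Y \<or> Y \<subseteq> X" using ch unfolding subset_chain_def by blast
      ultimately show ?thesis by blast
    qed
    have "partial_embedding (\<Union>\<C>)"
      unfolding partial_embedding_def
    proof (intro conjI allI impI)
      show "\<Union>\<C> \<subseteq> carrier G \<times> UNIV" using partial_embeddingD(1)[OF pe] by auto
      show "(\<one>, 0) \<in> \<Union>\<C>" using partial_embeddingD(2)[OF pe] ne by blast
    next
      fix x s y t assume "(x, s) \<in> \<Union>\<C>" "(y, t) \<in> \<Union>\<C>"
      then show "(x \<otimes> y, s + t) \<in> \<Union>\<C>" using two partial_embeddingD(3)[OF pe] by blast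
    next
      fix x s assume "(x, s) \<in> \<Union>\<C>"
      then show "(inv x, - s) \<in> \<Union>\<C>" "x = \<one> \<longleftrightarrow> s = 0"
        using partial_embeddingD(4,5)[OF pe] by blast+
    qed
    then show "\<Union>\<C> \<in> Collect partial_embedding" by simp
  qed
  then obtain \<Gamma> where pe: "partial_embedding \<Gamma>"
    and mx: "\<And>\<Gamma>'. partial_embedding \<Gamma>' \<Longrightarrow> \<Gamma> \<subseteq> \<Gamma>' \<Longrightarrow> \<Gamma>' = \<Gamma>" by blast
  note D = partial_embeddingD[OF pe]
  have total: "\<exists>r. (a, r) \<in> \<Gamma>" if a: "a \<in> carrier G" for a
  proof -
    have "\<exists>r. \<forall>m b t. (b, t) \<in> \<Gamma> \<longrightarrow> (a [^] (m::int) \<otimes> b = \<one> \<longleftrightarrow> of_int m * r + t = 0)"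
    proof (cases "\<exists>n s. n \<noteq> 0 \<and> (a [^] (n::int), s) \<in> \<Gamma>")
      case True
      then obtain n s where n: "n \<noteq> 0" "(a [^] (n::int), s) \<in> \<Gamma>" by blast
      show ?thesis
      proof (intro exI[of _ "s / of_int n"] allI impI)
        fix m :: int and b t assume b: "(b, t) \<in> \<Gamma>"
        have bc: "b \<in> carrier G" using D(1) b by blast
        have "((a [^] n) [^] m \<otimes> b [^] n, of_int m * s + of_int n * t) \<in> \<Gamma>"
          by (intro D(3) partial_embedding_int_pow[OF pe] n b)
        moreover have "(a [^] n) [^] m \<otimes> b [^] n = (a [^] m \<otimes> b) [^] n"
          using a bc by (simp add: int_pow_distrib int_pow_pow mult.commute)
        ultimately have "(a [^] m \<otimes> b) [^] n = \<one> \<longleftrightarrow> of_int m * s + of_int n * t = 0"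
          using D(5) by metis
        moreover have "(a [^] m \<otimes> b) [^] n = \<one> \<longleftrightarrow> a [^] m \<otimes> b = \<one>"
          using torsion_free_int_pow_eq_one[OF tf _ n(1), of "a [^] m \<otimes> b"] a bc by auto
        moreover have "of_int m * s + of_int n * t = 0 \<longleftrightarrow> of_int m * (s / of_int n) + t = 0"
          using n(1) by (simp add: field_simps)
        ultimately show "a [^] m \<otimes> b = \<one> \<longleftrightarrow> of_int m * (s / of_int n) + t = 0" by simp
      qed
    next
      case False
      have "inj_on fst \<Gamma>" using partial_embedding_unique[OF pe] by (auto simp: inj_on_def)
      moreover have "countable (fst ` \<Gamma>)" using D(1) by (intro countable_subset[OF _ ct]) auto
      ultimately have "countable \<Gamma>" using countable_image_inj_on by blast
      then have "countable ((\<lambda>(p, m). - snd p / of_int m) ` (\<Gamma> \<times> (UNIV :: int set)))" by auto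
      then have "(\<lambda>(p, m). - snd p / of_int m) ` (\<Gamma> \<times> (UNIV :: int set)) \<noteq> (UNIV :: real set)"
        using uncountable_UNIV_real by metis
      then obtain r :: real where r: "r \<notin> (\<lambda>(p, m). - snd p / of_int m) ` (\<Gamma> \<times> (UNIV :: int set))"
        by blast
      show ?thesis
      proof (intro exI[of _ r] allI impI)
        fix m :: int and b t assume b: "(b, t) \<in> \<Gamma>"
        have bc: "b \<in> carrier G" using D(1) b by blast
        show "a [^] m \<otimes> b = \<one> \<longleftrightarrow> of_int m * r + t = 0"
        proof (cases "m = 0")
          case True
          then show ?thesis using D(5)[OF b] bc by simp
        next
          case m: False
          have "a [^] m \<otimes> b \<noteq> \<one>"
          proof
            assume "a [^] m \<otimes> b = \<one>"
            then have "a [^] m = inv b" using a bc by (metis int_pow_closed inv_equality)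
            then show False using D(4)[OF b] m False by metis
          qed
          moreover have "of_int m * r + t \<noteq> 0"
          proof
            assume "of_int m * r + t = 0"
            then have "r = (\<lambda>(p, m). - snd p / of_int m) ((b, t), m)" using m by (simp add: field_simps)
            then show False using r b by blast
          qed
          ultimately show ?thesis by blast
        qed
      qed
    qed
    then obtain r where r: "\<And>m b t. (b, t) \<in> \<Gamma> \<Longrightarrow> a [^] (m::int) \<otimes> b = \<one> \<longleftrightarrow> of_int m * r + t = 0" by blast
    then obtain \<Gamma>' where "partial_embedding \<Gamma>'" "\<Gamma> \<subseteq> \<Gamma>'" "(a, r) \<in> \<Gamma>'"
      using partial_embedding_extend[OF pe a] by blast
    then show ?thesis using mx by blast
  qed
  define \<phi> where "\<phi> x = (THE s. (x, s) \<in> \<Gamma>)" for x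
  have \<phi>: "(x, s) \<in> \<Gamma> \<Longrightarrow> \<phi> x = s" for x s
    unfolding \<phi>_def using partial_embedding_unique[OF pe] by blast
  have in\<Gamma>: "(x, \<phi> x) \<in> \<Gamma>" if "x \<in> carrier G" for x using total[OF that] \<phi> by blast
  show ?thesis
  proof (intro exI[of _ \<phi>] conjI ballI impI)
    fix x y assume "x \<in> carrier G" "y \<in> carrier G"
    then show "\<phi> (x \<otimes> y) = \<phi> x + \<phi> y" using D(3) in\<Gamma> \<phi> by blast
  next
    fix x assume "x \<in> carrier G" "\<phi> x = 0"
    then show "x = \<one>" using D(5) in\<Gamma> by metis
  qed
qed

end

section \<open>Bases of finitely generated torsion-free abelian groups\<close>

context comm_group
begin

definition lincomb :: "nat \<Rightarrow> (nat \<Rightarrow> 'a) \<Rightarrow> (nat \<Rightarrow> int) \<Rightarrow> 'a" where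
  "lincomb r e n = (\<Otimes>i\<in>{..<r}. e i [^] n i)"

lemma lincomb_closed [simp]: "e ` {..<r} \<subseteq> carrier G \<Longrightarrow> lincomb r e n \<in> carrier G"
  unfolding lincomb_def by (intro finprod_closed) auto

lemma lincomb_add:
  assumes "e ` {..<r} \<subseteq> carrier G"
  shows "lincomb r e (\<lambda>i. m i + n i) = lincomb r e m \<otimes> lincomb r e n"
proof -
  have "lincomb r e (\<lambda>i. m i + n i) = (\<Otimes>i\<in>{..<r}. e i [^] m i \<otimes> e i [^] n i)"
    unfolding lincomb_def using assms by (intro finprod_cong') (auto simp: int_pow_mult)
  then show ?thesis unfolding lincomb_def using assms by (subst (asm) finprod_multf) auto
qed

lemma lincomb_zero: "lincomb r e (\<lambda>_. 0) = \<one>"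
  unfolding lincomb_def by (simp add: finprod_one_eqI)

lemma lincomb_neg:
  assumes "e ` {..<r} \<subseteq> carrier G" shows "lincomb r e (\<lambda>i. - n i) = inv (lincomb r e n)"
proof -
  have "lincomb r e (\<lambda>i. - n i) \<otimes> lincomb r e n = \<one>"
    using lincomb_add[OF assms, of "\<lambda>i. - n i" n] by (simp add: lincomb_zero)
  then show ?thesis using assms by (intro inv_equality[symmetric]) auto
qed

lemma lincomb_unit:
  assumes "e ` {..<r} \<subseteq> carrier G" "i < r"
  shows "lincomb r e (\<lambda>j. if j = i then 1 else 0) = e i"
proof -
  have i: "e i \<in> carrier G" using assms by auto
  have "lincomb r e (\<lambda>j. if j = i then 1 else 0) = (\<Otimes>j\<in>{..<r}. if i = j then e j else \<one>)"
    unfolding lincomb_def using assms by (intro finprod_cong') auto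
  also have "\<dots> = e i" using assms by (intro finprod_singleton) auto
  finally show ?thesis .
qed

lemma lincomb_cong:
  assumes "e ` {..<r} \<subseteq> carrier G" "\<And>i. i < r \<Longrightarrow> m i = n i"
  shows "lincomb r e m = lincomb r e n"
  unfolding lincomb_def using assms by (intro finprod_cong') auto

lemma lincomb_unique:
  assumes e: "e ` {..<r} \<subseteq> carrier G" and indep: "\<forall>n. lincomb r e n = \<one> \<longrightarrow> (\<forall>i<r. n i = 0)"
    and eq: "lincomb r e m = lincomb r e n" and i: "i < r"
  shows "m i = n i"
proof -
  have "lincomb r e (\<lambda>i. m i + - n i) = \<one>"
    using eq lincomb_add[OF e, of m "\<lambda>i. - n i"] lincomb_neg[OF e, of n] e by simp
  then show ?thesis using indep i by fastforce
qed

lemma generate_lincomb: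
  assumes e: "e ` {..<r} \<subseteq> carrier G" and x: "x \<in> generate G (e ` {..<r})"
  shows "\<exists>n. x = lincomb r e n"
  using x
proof (induction rule: generate.induct)
  case one
  then show ?case using lincomb_zero by metis
next
  case (incl h)
  then show ?case using lincomb_unit[OF e] by (metis imageE lessThan_iff)
next
  case (inv h)
  then show ?case using lincomb_unit[OF e] lincomb_neg[OF e] by (metis imageE lessThan_iff)
next
  case (eng x y)
  then show ?case using lincomb_add[OF e] by metis
qed

text \<open>
Multiplying one generator by a power of another one is invertible, as for elementary row
operations.
\<close>

lemma generate_replace:
  assumes S: "S \<subseteq> carrier G" and x: "x \<in> S" and y: "y \<in> S" "x \<noteq> y"
  shows "generate G (insert (x \<otimes> y [^] (m::int)) (S - {x})) = generate G S"
proof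
  let ?T = "insert (x \<otimes> y [^] m) (S - {x})"
  have xc: "x \<in> carrier G" and yc: "y \<in> carrier G" using S x y by auto
  have T: "?T \<subseteq> carrier G" using S xc yc by auto
  have sS: "subgroup (generate G S) G" and sT: "subgroup (generate G ?T) G"
    using generate_is_subgroup S T by blast+
  have "y [^] m \<in> generate G S" using y subgroup_int_pow_closed[OF sS] by (simp add: generate.incl)
  then have "x \<otimes> y [^] m \<in> generate G S" using x subgroup.m_closed[OF sS] by (simp add: generate.incl)
  then show "generate G ?T \<subseteq> generate G S"
    by (intro generate_subgroup_incl[OF _ sS]) (auto intro: generate.incl)
  have "y [^] m \<in> generate G ?T" using y subgroup_int_pow_closed[OF sT] by (simp add: generate.incl)
  then have "inv (y [^] m) \<in> generate G ?T" using subgroup.m_inv_closed[OF sT] by blast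
  moreover have "x \<otimes> y [^] m \<in> generate G ?T" by (simp add: generate.incl)
  ultimately have "(x \<otimes> y [^] m) \<otimes> inv (y [^] m) \<in> generate G ?T" using subgroup.m_closed[OF sT] by blast
  then have "x \<in> generate G ?T" using xc yc by (simp add: m_assoc)
  then show "generate G S \<subseteq> generate G ?T"
    by (intro generate_subgroup_incl[OF _ sT]) (auto intro: generate.incl)
qed

lemma finprod_pow_insert2:
  assumes "finite R" "R \<subseteq> carrier G" "x \<in> carrier G" "y \<in> carrier G" "x \<notin> insert y R" "y \<notin> R"
  shows "(\<Otimes>t\<in>insert x (insert y R). t [^] (n t :: int)) = x [^] n x \<otimes> (y [^] n y \<otimes> (\<Otimes>t\<in>R. t [^] n t))"
proof -
  have "(\<Otimes>t\<in>insert x (insert y R). t [^] n t) = x [^] n x \<otimes> (\<Otimes>t\<in>insert y R. t [^] n t)"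
    by (rule finprod_insert) (use assms in auto)
  moreover have "(\<Otimes>t\<in>insert y R. t [^] n t) = y [^] n y \<otimes> (\<Otimes>t\<in>R. t [^] n t)"
    by (rule finprod_insert) (use assms in auto)
  ultimately show ?thesis by simp
qed

text \<open>
The Euclidean algorithm on the exponents of a nontrivial relation. As long as two exponents are
nonzero, replacing a generator \<open>x\<close> by \<open>x\<close> times \<open>y\<close> or its inverse turns the relation into one whose
exponents have a smaller absolute sum. When a single exponent is left, the generator that carries
it has finite order, hence is trivial and can be omitted.
\<close>

lemma relation_reduces_generators:
  assumes tf: "torsion_free G"
  shows "\<lbrakk>finite S; S \<subseteq> carrier G; generate G S = carrier G; (\<Otimes>s\<in>S. s [^] (n s :: int)) = \<one>;
      s \<in> S; n s \<noteq> 0; (\<Sum>s\<in>S. nat \<bar>n s\<bar>) = M\<rbrakk>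
    \<Longrightarrow> \<exists>T. finite T \<and> T \<subseteq> carrier G \<and> generate G T = carrier G \<and> card T < card S"
proof (induction M arbitrary: S n s rule: less_induct)
  case (less M S n s)
  note S = less.prems(1,2) and gen = less.prems(3) and rel = less.prems(4)
  show ?case
  proof (cases "\<exists>x\<in>S. \<exists>y\<in>S. x \<noteq> y \<and> n x \<noteq> 0 \<and> n y \<noteq> 0")
    case False
    then have zero: "n t = 0" if "t \<in> S - {s}" for t using that less.prems(5,6) by blast
    have sc: "s \<in> carrier G" using S less.prems(5) by auto
    have "(\<Otimes>t\<in>S. t [^] n t) = (\<Otimes>t\<in>insert s (S - {s}). t [^] n t)"
      using less.prems(5) by (simp add: insert_absorb)
    also have "\<dots> = s [^] n s \<otimes> (\<Otimes>t\<in>S - {s}. t [^] n t)"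
      using S sc by (intro finprod_insert) auto
    also have "(\<Otimes>t\<in>S - {s}. t [^] n t) = \<one>" using zero by (intro finprod_one_eqI) auto
    finally have "s [^] n s = \<one>" using rel sc by simp
    then have s1: "s = \<one>" using torsion_free_int_pow_eq_one[OF tf sc less.prems(6)] by blast
    have sub: "subgroup (generate G (S - {s})) G" using S by (intro generate_is_subgroup) auto
    have "s \<in> generate G (S - {s})" using s1 generate.one by metis
    then have "generate G S \<subseteq> generate G (S - {s})"
      by (intro generate_subgroup_incl[OF _ sub]) (auto intro: generate.incl)
    moreover have "generate G (S - {s}) \<subseteq> carrier G" using S by (intro generate_incl) auto
    ultimately have "generate G (S - {s}) = carrier G" using gen by blast
    moreover have "card (S - {s}) < card S" using S less.prems(5) by (intro psubset_card_mono) auto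
    ultimately show ?thesis using S by (intro exI[of _ "S - {s}"]) auto
  next
    case True
    then obtain x y where xy: "x \<in> S" "y \<in> S" "x \<noteq> y" "n x \<noteq> 0" "n y \<noteq> 0" "\<bar>n x\<bar> \<le> \<bar>n y\<bar>"
      by (metis linear)
    \<comment> \<open>The sign for which \<open>y\<close> loses exponent: \<open>\<bar>n y - \<epsilon> * n x\<bar> = \<bar>n y\<bar> - \<bar>n x\<bar>\<close>.\<close>
    define \<epsilon> where "\<epsilon> = sgn (n x) * sgn (n y)"
    define z where "z = x \<otimes> y [^] \<epsilon>"
    define R where "R = S - {x, y}"
    have c: "x \<in> carrier G" "y \<in> carrier G" "z \<in> carrier G" and R: "R \<subseteq> carrier G" "finite R"
      using S xy by (auto simp: z_def R_def)
    have SR: "S = insert x (insert y R)" "x \<notin> insert y R" "y \<notin> R" using xy by (auto simp: R_def)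
    have gT: "generate G (insert z (S - {x})) = carrier G"
      using generate_replace[OF S(2) xy(1,2,3), of \<epsilon>] gen by (simp add: z_def)
    have SxR: "S - {x} = insert y R" using SR by auto
    show ?thesis
    proof (cases "z \<in> S - {x}")
      case True
      then have "insert z (S - {x}) = S - {x}" by auto
      moreover have "card (S - {x}) < card S" using S xy by (intro psubset_card_mono) auto
      ultimately show ?thesis using gT S by (intro exI[of _ "S - {x}"]) auto
    next
      case False
      let ?T = "insert z (insert y R)"
      have zn: "z \<notin> insert y R" using False SxR by simp
      define n' where "n' = (\<lambda>t. if t = z then n x else if t = y then n y - \<epsilon> * n x else n t)"
      have zy: "z \<noteq> y" using zn by auto
      have nR: "n' t = n t" if "t \<in> R" for t using that zn SR by (auto simp: n'_def)
      have "(\<Otimes>t\<in>?T. t [^] n' t) = z [^] n' z \<otimes> (y [^] n' y \<otimes> (\<Otimes>t\<in>R. t [^] n' t))"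
        using finprod_pow_insert2[OF R(2,1) c(3,2) zn SR(3)] .
      also have "(\<Otimes>t\<in>R. t [^] n' t) = (\<Otimes>t\<in>R. t [^] n t)"
        using R nR by (intro finprod_cong') auto
      also have "z [^] n' z \<otimes> (y [^] n' y \<otimes> (\<Otimes>t\<in>R. t [^] n t)) = x [^] n x \<otimes> (y [^] n y \<otimes> (\<Otimes>t\<in>R. t [^] n t))"
      proof -
        have P: "(\<Otimes>t\<in>R. t [^] n t) \<in> carrier G" using R by (intro finprod_closed) auto
        have "z [^] n' z \<otimes> y [^] n' y = x [^] n x \<otimes> (y [^] (\<epsilon> * n x) \<otimes> y [^] (n y - \<epsilon> * n x))"
          using c zy by (simp add: n'_def z_def int_pow_distrib int_pow_pow m_assoc)
        also have "\<dots> = x [^] n x \<otimes> y [^] n y" using c by (simp flip: int_pow_mult)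
        finally show ?thesis using P c by (simp flip: m_assoc)
      qed
      also have "\<dots> = (\<Otimes>t\<in>S. t [^] n t)"
        unfolding SR(1) using finprod_pow_insert2[OF R(2,1) c(1,2) SR(2,3)] by (rule sym)
      finally have rel': "(\<Otimes>t\<in>?T. t [^] n' t) = \<one>" using rel by simp
      have dec: "nat \<bar>n y - \<epsilon> * n x\<bar> < nat \<bar>n y\<bar>"
        using xy(4-6) by (auto simp: \<epsilon>_def sgn_if split: if_splits)
      have "(\<Sum>t\<in>?T. nat \<bar>n' t\<bar>) = nat \<bar>n x\<bar> + (nat \<bar>n y - \<epsilon> * n x\<bar> + (\<Sum>t\<in>R. nat \<bar>n t\<bar>))"
        using zn SR R zy nR by (simp add: n'_def[of] cong: sum.cong)
      also have "\<dots> < nat \<bar>n x\<bar> + (nat \<bar>n y\<bar> + (\<Sum>t\<in>R. nat \<bar>n t\<bar>))" using dec by simp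
      also have "\<dots> = (\<Sum>t\<in>S. nat \<bar>n t\<bar>)" unfolding SR(1) using SR R by simp
      finally have lt: "(\<Sum>t\<in>?T. nat \<bar>n' t\<bar>) < M" using less.prems(7) by simp
      have "\<exists>U. finite U \<and> U \<subseteq> carrier G \<and> generate G U = carrier G \<and> card U < card ?T"
        using c R gT SxR xy(4) by (intro less.IH[OF lt _ _ _ rel', of z]) (auto simp: n'_def)
      moreover have "card ?T = card S" unfolding SR(1) using zn SR R by simp
      ultimately show ?thesis by metis
    qed
  qed
qed

text \<open>
A generating set of minimal size satisfies no nontrivial relation, since a relation would allow
for a smaller generating set.
\<close>

theorem finitely_generated_torsion_free_basis:
  assumes tf: "torsion_free G" and fg: "finitely_generated G"
  shows "\<exists>r e. e ` {..<r} \<subseteq> carrier G \<and> (\<forall>x\<in>carrier G. \<exists>n. x = lincomb r e n) \<and>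
    (\<forall>n. lincomb r e n = \<one> \<longrightarrow> (\<forall>i<r. n i = 0))"
proof -
  let ?P = "\<lambda>S. finite S \<and> S \<subseteq> carrier G \<and> generate G S = carrier G"
  obtain S where S: "?P S" "\<And>T. ?P T \<Longrightarrow> card S \<le> card T"
    using fg ex_has_least_nat[of ?P _ card] unfolding finitely_generated_def by metis
  then obtain e where e: "bij_betw e {..<card S} S"
    using ex_bij_betw_nat_finite by (metis atLeast0LessThan)
  have img: "e ` {..<card S} = S" using e by (simp add: bij_betw_def)
  have "n i = 0" if rel: "lincomb (card S) e n = \<one>" and i: "i < card S" for n i
  proof (rule ccontr)
    assume ni: "n i \<noteq> 0"
    define m where "m = (\<lambda>s. n (the_inv_into {..<card S} e s))"
    have inj: "inj_on e {..<card S}" using e by (simp add: bij_betw_def)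
    have me: "m (e j) = n j" if "j < card S" for j
      using that inj by (simp add: m_def the_inv_into_f_f)
    have "(\<Otimes>s\<in>S. s [^] m s) = (\<Otimes>s\<in>e ` {..<card S}. s [^] m s)" by (simp only: img)
    also have "\<dots> = (\<Otimes>j\<in>{..<card S}. e j [^] m (e j))"
      using S(1) img inj by (intro finprod_reindex) auto
    also have "\<dots> = lincomb (card S) e n"
      unfolding lincomb_def using S(1) img by (intro finprod_cong') (auto simp: me)
    finally have "(\<Otimes>s\<in>S. s [^] m s) = \<one>" using rel by simp
    moreover have "e i \<in> S" "m (e i) \<noteq> 0" using i img me ni by auto
    ultimately have "\<exists>T. finite T \<and> T \<subseteq> carrier G \<and> generate G T = carrier G \<and> card T < card S"
      using S(1) relation_reduces_generators[OF tf _ _ _ _ _ _ refl] by simp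
    then obtain T where "?P T" "card T < card S" by blast
    then show False using S(2)[of T] by simp
  qed
  moreover have "\<exists>n. x = lincomb (card S) e n" if "x \<in> carrier G" for x
    using generate_lincomb[of e "card S" x] S(1) img that by simp
  ultimately show ?thesis using S(1) img by (intro exI[of _ "card S"] exI[of _ e]) auto
qed

end

section \<open>Torsion-free rank and the size of a basis\<close>

definition rscale :: "rat \<Rightarrow> (nat \<Rightarrow> rat) \<Rightarrow> nat \<Rightarrow> rat" where
  "rscale q v = (\<lambda>i. q * v i)"

interpretation rat_vectors: vector_space rscale
  by unfold_locales (auto simp: rscale_def algebra_simps fun_eq_iff)

text \<open>
The vector space \<open>\<rat> ^ r\<close>, realized inside all rational sequences so that \<open>r\<close> can vary within one
type.
\<close>

definition rat_vecs :: "nat \<Rightarrow> (nat \<Rightarrow> rat) set" where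
  "rat_vecs r = {v. \<forall>i\<ge>r. v i = 0}"

definition rat_unit :: "nat \<Rightarrow> nat \<Rightarrow> rat" where
  "rat_unit i = (\<lambda>j. if j = i then 1 else 0)"

lemma sum_fun_eval: "(\<Sum>x\<in>S. f x) i = (\<Sum>x\<in>S. f x i :: rat)" for f :: "'x \<Rightarrow> nat \<Rightarrow> rat"
  by (induction S rule: infinite_finite_induct) auto

lemma rat_vecs_subspace: "rat_vectors.subspace (rat_vecs r)"
  by (auto simp: rat_vectors.subspace_def rat_vecs_def rscale_def)

lemma rat_unit_independent: "rat_vectors.independent (rat_unit ` I)"
  unfolding rat_vectors.independent_explicit_finite_subsets
proof (intro allI impI ballI)
  fix S u v assume S: "S \<subseteq> rat_unit ` I" "finite S" and z: "(\<Sum>v\<in>S. rscale (u v) v) = 0" and v: "v \<in> S"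
  obtain i where i: "v = rat_unit i" using S v by blast
  have "w i = 0" if w: "w \<in> S - {v}" for w
  proof -
    obtain j where "w = rat_unit j" using S w by blast
    then show ?thesis using w i by (auto simp: rat_unit_def)
  qed
  then have "(\<Sum>w\<in>S - {v}. u w * w i) = 0" by (intro sum.neutral) auto
  moreover have "(\<Sum>w\<in>S. u w * w i) = (\<Sum>w\<in>S. rscale (u w) w) i"
    by (simp add: sum_fun_eval rscale_def)
  then have "(\<Sum>w\<in>S. u w * w i) = 0" using z by simp
  ultimately have "u v * v i = 0" using S v by (simp add: sum.remove)
  then show "u v = 0" by (simp add: i rat_unit_def)
qed

lemma rat_unit_span: "rat_vectors.span (rat_unit ` {..<r}) = rat_vecs r"
proof
  show "rat_vectors.span (rat_unit ` {..<r}) \<subseteq> rat_vecs r"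
    by (intro rat_vectors.span_minimal rat_vecs_subspace) (auto simp: rat_vecs_def rat_unit_def)
  show "rat_vecs r \<subseteq> rat_vectors.span (rat_unit ` {..<r})"
  proof
    fix v assume v: "v \<in> rat_vecs r"
    have "v = (\<Sum>i<r. rscale (v i) (rat_unit i))"
    proof
      fix j
      have "(\<Sum>i<r. v i * rat_unit i j) = (\<Sum>i<r. if i = j then v i else 0)"
        by (intro sum.cong) (auto simp: rat_unit_def)
      also have "\<dots> = v j" using v by (auto simp: rat_vecs_def)
      finally show "v j = (\<Sum>i<r. rscale (v i) (rat_unit i)) j"
        by (simp add: sum_fun_eval rscale_def)
    qed
    moreover have "(\<Sum>i<r. rscale (v i) (rat_unit i)) \<in> rat_vectors.span (rat_unit ` {..<r})"
      by (intro rat_vectors.span_sum rat_vectors.span_scale rat_vectors.span_base) auto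
    ultimately show "v \<in> rat_vectors.span (rat_unit ` {..<r})" by metis
  qed
qed

lemma rat_unit_in: "rat_unit ` {..<r} \<subseteq> rat_vecs r"
  by (auto simp: rat_unit_def rat_vecs_def)

lemma card_rat_unit: "card (rat_unit ` {..<r}) = r"
proof -
  have "inj_on rat_unit {..<r}" by (auto simp: inj_on_def rat_unit_def fun_eq_iff split: if_splits)
  then show ?thesis by (simp add: card_image)
qed

text \<open>
Both the given basis and the standard basis have as many elements as the dimension.
\<close>

lemma rat_vecs_basis_card:
  assumes "rat_vectors.independent B" "rat_vectors.span B = rat_vecs r" shows "card B = r"
proof -
  have "card B = rat_vectors.dim (rat_vecs r)"
    using assms rat_vectors.span_superset[of B] by (intro rat_vectors.basis_card_eq_dim) auto
  moreover have "card (rat_unit ` {..<r}) = rat_vectors.dim (rat_vecs r)"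
    by (intro rat_vectors.basis_card_eq_dim rat_unit_in rat_unit_independent) (simp add: rat_unit_span)
  ultimately show ?thesis by (simp add: card_rat_unit)
qed

text \<open>
A linear bijection from \<open>\<rat> ^ r\<close> transports independent and spanning sets in both directions. The
image of the standard basis shows that the choice in \<open>rat_dim\<close> is made among actual bases, and each
of these pulls back to a basis of \<open>\<rat> ^ r\<close>.
\<close>

lemma rat_dim_eqI:
  fixes V :: "(rat, 'v, 'm) module_scheme" and F :: "(nat \<Rightarrow> rat) \<Rightarrow> 'v"
  assumes bij: "bij_betw F (rat_vecs r) (carrier V)"
    and add: "\<And>v w. v \<in> rat_vecs r \<Longrightarrow> w \<in> rat_vecs r \<Longrightarrow> F v \<oplus>\<^bsub>V\<^esub> F w = F (v + w)"
    and zero: "\<zero>\<^bsub>V\<^esub> = F 0"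
    and scale: "\<And>q v. v \<in> rat_vecs r \<Longrightarrow> q \<odot>\<^bsub>V\<^esub> F v = F (rscale q v)"
  shows "rat_dim V = r"
proof -
  note sub = rat_vecs_subspace[of r]
  have Q0: "0 \<in> rat_vecs r" and Qadd: "\<And>v w. v \<in> rat_vecs r \<Longrightarrow> w \<in> rat_vecs r \<Longrightarrow> v + w \<in> rat_vecs r"
    and Qscale: "\<And>q v. v \<in> rat_vecs r \<Longrightarrow> rscale q v \<in> rat_vecs r"
    using sub by (auto simp: rat_vectors.subspace_def)
  have inj: "F v = F w \<longleftrightarrow> v = w" if "v \<in> rat_vecs r" "w \<in> rat_vecs r" for v w
    using bij that by (auto simp: bij_betw_def inj_on_def)
  have Fc: "F v \<in> carrier V" if "v \<in> rat_vecs r" for v using bij that bij_betwE by blast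
  have Fs: "\<exists>v\<in>rat_vecs r. x = F v" if "x \<in> carrier V" for x
    using bij that by (auto simp: bij_betw_def)
  interpret V: abelian_monoid V
  proof (rule abelian_monoidI)
    show "\<zero>\<^bsub>V\<^esub> \<in> carrier V" using zero Fc Q0 by simp
    fix x y z assume "x \<in> carrier V" "y \<in> carrier V" "z \<in> carrier V"
    then obtain u v w where *: "u \<in> rat_vecs r" "v \<in> rat_vecs r" "w \<in> rat_vecs r" "x = F u" "y = F v" "z = F w"
      using Fs by meson
    show "x \<oplus>\<^bsub>V\<^esub> y \<oplus>\<^bsub>V\<^esub> z = x \<oplus>\<^bsub>V\<^esub> (y \<oplus>\<^bsub>V\<^esub> z)" using * by (simp add: add Qadd add.assoc)
  next
    fix x y assume "x \<in> carrier V" "y \<in> carrier V"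
    then obtain u v where *: "u \<in> rat_vecs r" "v \<in> rat_vecs r" "x = F u" "y = F v"
      using Fs by meson
    show "x \<oplus>\<^bsub>V\<^esub> y \<in> carrier V" using * by (simp add: add Qadd Fc)
    show "x \<oplus>\<^bsub>V\<^esub> y = y \<oplus>\<^bsub>V\<^esub> x" using * by (simp add: add add.commute)
  next
    fix x assume "x \<in> carrier V"
    then obtain v where "v \<in> rat_vecs r" "x = F v" using Fs by blast
    then show "\<zero>\<^bsub>V\<^esub> \<oplus>\<^bsub>V\<^esub> x = x" using add[OF Q0, of v] by (simp add: zero)
  qed
  define \<beta> where "\<beta> x = (THE v. v \<in> rat_vecs r \<and> F v = x)" for x
  have \<beta>F: "\<beta> (F v) = v" if "v \<in> rat_vecs r" for v
    unfolding \<beta>_def using that inj by (intro the_equality) auto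
  have \<beta>Q: "\<beta> x \<in> rat_vecs r" and F\<beta>: "F (\<beta> x) = x" if "x \<in> carrier V" for x
    using Fs[OF that] \<beta>F by auto
  have \<beta>inj: "inj_on \<beta> (carrier V)" using F\<beta> by (metis inj_onI)
  have fs: "(\<Oplus>\<^bsub>V\<^esub>x\<in>S. c x \<odot>\<^bsub>V\<^esub> x) = F (\<Sum>x\<in>S. rscale (c x) (\<beta> x)) \<and> (\<Sum>x\<in>S. rscale (c x) (\<beta> x)) \<in> rat_vecs r"
    if "finite S" "S \<subseteq> carrier V" for S c
    using that
  proof (induction S rule: finite_induct)
    case empty
    then show ?case using Q0 by (simp add: zero zero_fun_def)
  next
    case (insert x S)
    have sm: "c y \<odot>\<^bsub>V\<^esub> y = F (rscale (c y) (\<beta> y))" if "y \<in> insert x S" for y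
      using that insert.prems scale[OF \<beta>Q, of y "c y"] F\<beta>[of y] by (metis subsetD)
    have "(\<Oplus>\<^bsub>V\<^esub>y\<in>insert x S. c y \<odot>\<^bsub>V\<^esub> y) = c x \<odot>\<^bsub>V\<^esub> x \<oplus>\<^bsub>V\<^esub> (\<Oplus>\<^bsub>V\<^esub>y\<in>S. c y \<odot>\<^bsub>V\<^esub> y)"
      using insert.hyps insert.prems sm Fc Qscale \<beta>Q by (intro V.finsum_insert) auto
    also have "\<dots> = F (rscale (c x) (\<beta> x) + (\<Sum>x\<in>S. rscale (c x) (\<beta> x)))"
      using insert sm[of x] add Qscale \<beta>Q by auto
    finally have 1: "(\<Oplus>\<^bsub>V\<^esub>y\<in>insert x S. c y \<odot>\<^bsub>V\<^esub> y) = F (rscale (c x) (\<beta> x) + (\<Sum>x\<in>S. rscale (c x) (\<beta> x)))" .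
    have 2: "rscale (c x) (\<beta> x) + (\<Sum>x\<in>S. rscale (c x) (\<beta> x)) \<in> rat_vecs r"
      using insert by (intro Qadd Qscale \<beta>Q) auto
    show ?case unfolding sum.insert[OF insert.hyps] using 1 2 by blast
  qed
  have reindex: "(\<Sum>x\<in>S. rscale (c x) (\<beta> x)) = (\<Sum>v\<in>\<beta> ` S. rscale (c (F v)) v)"
    if "S \<subseteq> carrier V" for S c
  proof -
    have "inj_on \<beta> S" using \<beta>inj that inj_on_subset by blast
    then have "(\<Sum>v\<in>\<beta> ` S. rscale (c (F v)) v) = (\<Sum>x\<in>S. rscale (c (F (\<beta> x))) (\<beta> x))"
      by (simp add: sum.reindex)
    also have "\<dots> = (\<Sum>x\<in>S. rscale (c x) (\<beta> x))" using that F\<beta> by (intro sum.cong) auto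
    finally show ?thesis by simp
  qed
  have ind: "rat_vectors.independent (\<beta> ` B)" if B: "rat_independent V B" for B
    unfolding rat_vectors.independent_explicit_finite_subsets
  proof (intro allI impI ballI)
    fix T u w assume T: "T \<subseteq> \<beta> ` B" "finite T" and z: "(\<Sum>v\<in>T. rscale (u v) v) = 0" and w: "w \<in> T"
    have Bc: "B \<subseteq> carrier V" using B by (simp add: rat_independent_def)
    define S where "S = F ` T"
    have TQ: "T \<subseteq> rat_vecs r" using T Bc \<beta>Q by auto
    have S: "finite S" "S \<subseteq> B" "\<beta> ` S = T"
      using T Bc F\<beta> TQ \<beta>F by (auto simp: S_def image_image subset_eq)
    have "(\<Sum>x\<in>S. rscale (u (\<beta> x)) (\<beta> x)) = (\<Sum>v\<in>T. rscale (u (\<beta> (F v))) v)"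
      using reindex[of S "\<lambda>x. u (\<beta> x)"] S Bc by auto
    also have "\<dots> = (\<Sum>v\<in>T. rscale (u v) v)" using TQ \<beta>F by (intro sum.cong) auto
    finally have "(\<Oplus>\<^bsub>V\<^esub>x\<in>S. u (\<beta> x) \<odot>\<^bsub>V\<^esub> x) = \<zero>\<^bsub>V\<^esub>"
      using fs[of S "\<lambda>x. u (\<beta> x)"] S Bc z zero by auto
    moreover have "\<forall>S c. finite S \<longrightarrow> S \<subseteq> B \<longrightarrow> (\<Oplus>\<^bsub>V\<^esub>v\<in>S. c v \<odot>\<^bsub>V\<^esub> v) = \<zero>\<^bsub>V\<^esub> \<longrightarrow> (\<forall>v\<in>S. c v = 0)"
      using B unfolding rat_independent_def by (rule conjunct2)
    from spec[OF spec[OF this, of S], of "\<lambda>x. u (\<beta> x)"] S(1,2)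
    have "(\<Oplus>\<^bsub>V\<^esub>x\<in>S. u (\<beta> x) \<odot>\<^bsub>V\<^esub> x) = \<zero>\<^bsub>V\<^esub> \<longrightarrow> (\<forall>x\<in>S. u (\<beta> x) = 0)" by (simp only: simp_thms)
    ultimately have "\<forall>x\<in>S. u (\<beta> x) = 0" by (simp only: simp_thms)
    then have "u (\<beta> (F w)) = 0" using w by (simp add: S_def)
    then show "u w = 0" using w TQ \<beta>F[of w] by auto
  qed
  have spn: "rat_vectors.span (\<beta> ` B) = rat_vecs r" if B: "rat_spanning V B" for B
  proof
    have Bc: "B \<subseteq> carrier V" using B by (simp add: rat_spanning_def)
    show "rat_vectors.span (\<beta> ` B) \<subseteq> rat_vecs r"
      using Bc \<beta>Q by (intro rat_vectors.span_minimal sub) auto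
    show "rat_vecs r \<subseteq> rat_vectors.span (\<beta> ` B)"
    proof
      fix v assume v: "v \<in> rat_vecs r"
      obtain S c where S: "finite S" "S \<subseteq> B" "F v = (\<Oplus>\<^bsub>V\<^esub>x\<in>S. c x \<odot>\<^bsub>V\<^esub> x)"
        using B Fc[OF v] unfolding rat_spanning_def by meson
      then have "v = (\<Sum>x\<in>S. rscale (c x) (\<beta> x))" using fs[of S c] Bc inj v by auto
      moreover have "(\<Sum>x\<in>S. rscale (c x) (\<beta> x)) \<in> rat_vectors.span (\<beta> ` B)"
        using S by (intro rat_vectors.span_sum rat_vectors.span_scale rat_vectors.span_base) auto
      ultimately show "v \<in> rat_vectors.span (\<beta> ` B)" by simp
    qed
  qed
  define E where "E = F ` rat_unit ` {..<r}"
  note UQ = rat_unit_in[of r]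
  have Ec: "E \<subseteq> carrier V" using UQ Fc by (auto simp: E_def)
  have \<beta>E: "\<beta> ` S \<subseteq> rat_unit ` {..<r}" if "S \<subseteq> E" for S
    using that UQ \<beta>F by (auto simp: E_def subset_eq)
  have "rat_independent V E"
    unfolding rat_independent_def
  proof (intro conjI allI impI Ec)
    fix S c assume S: "finite S" "S \<subseteq> E" and z: "(\<Oplus>\<^bsub>V\<^esub>v\<in>S. c v \<odot>\<^bsub>V\<^esub> v) = \<zero>\<^bsub>V\<^esub>"
    have Sc: "S \<subseteq> carrier V" using S Ec by auto
    have "(\<Sum>v\<in>\<beta> ` S. rscale (c (F v)) v) = 0"
      using fs[OF S(1) Sc, of c] z zero inj Q0 reindex[OF Sc, of c] by auto
    then have "c (F v) = 0" if "v \<in> \<beta> ` S" for v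
      by (rule rat_vectors.independentD[OF rat_unit_independent finite_imageI[OF S(1)] \<beta>E[OF S(2)] _ that])
    then have "c (F (\<beta> x)) = 0" if "x \<in> S" for x using that by blast
    then show "\<forall>v\<in>S. c v = 0" using F\<beta> Sc by (metis subsetD)
  qed
  moreover have "rat_spanning V E"
    unfolding rat_spanning_def
  proof (intro conjI ballI Ec)
    fix x assume x: "x \<in> carrier V"
    then have "\<beta> x \<in> rat_vectors.span (rat_unit ` {..<r})" using \<beta>Q rat_unit_span by simp
    then obtain T u where T: "finite T" "T \<subseteq> rat_unit ` {..<r}" "\<beta> x = (\<Sum>v\<in>T. rscale (u v) v)"
      unfolding rat_vectors.span_explicit by auto
    define S where "S = F ` T"
    have TQ: "T \<subseteq> rat_vecs r" using T UQ by auto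
    have S: "finite S" "S \<subseteq> E" "\<beta> ` S = T"
      using T TQ \<beta>F by (auto simp: S_def E_def image_image subset_eq)
    have Sc: "S \<subseteq> carrier V" using S Ec by auto
    have "(\<Sum>x\<in>S. rscale (u (\<beta> x)) (\<beta> x)) = (\<Sum>v\<in>T. rscale (u (\<beta> (F v))) v)"
      using reindex[OF Sc, of "\<lambda>x. u (\<beta> x)"] S by auto
    also have "\<dots> = (\<Sum>v\<in>T. rscale (u v) v)" using TQ \<beta>F by (intro sum.cong) auto
    finally have "(\<Oplus>\<^bsub>V\<^esub>x\<in>S. u (\<beta> x) \<odot>\<^bsub>V\<^esub> x) = F (\<beta> x)"
      using fs[OF S(1) Sc, of "\<lambda>x. u (\<beta> x)"] T by auto
    then show "\<exists>S c. finite S \<and> S \<subseteq> E \<and> x = (\<Oplus>\<^bsub>V\<^esub>v\<in>S. c v \<odot>\<^bsub>V\<^esub> v)"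
      using S F\<beta>[OF x] by metis
  qed
  ultimately have ex: "\<exists>B. rat_independent V B \<and> rat_spanning V B" by blast
  define B where "B = (SOME B. rat_independent V B \<and> rat_spanning V B)"
  have B: "rat_independent V B" "rat_spanning V B" using someI_ex[OF ex] by (auto simp: B_def)
  then have "inj_on \<beta> B" using \<beta>inj by (auto simp: rat_independent_def intro: inj_on_subset)
  then have "card B = card (\<beta> ` B)" by (simp add: card_image)
  also have "\<dots> = r" using B ind spn by (intro rat_vecs_basis_card) auto
  finally show ?thesis by (simp add: rat_dim_def B_def)
qed

context comm_group
begin

lemma relations_subgroup:
  shows "subgroup (tensor_rat_relations G) (tensor_rat_free G)"
    and relations_mult: "\<lbrakk>a \<in> carrier G; b \<in> carrier G\<rbrakk> \<Longrightarrow>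
      frag_of (a \<otimes> b, q) - frag_of (a, q) - frag_of (b, q) \<in> tensor_rat_relations G"
    and relations_add: "a \<in> carrier G \<Longrightarrow>
      frag_of (a, q + s) - frag_of (a, q) - frag_of (a, s) \<in> tensor_rat_relations G"
proof -
  interpret F: group "tensor_rat_free G" by simp
  show "subgroup (tensor_rat_relations G) (tensor_rat_free G)"
    unfolding tensor_rat_relations_def
    by (rule F.generate_is_subgroup) (auto dest!: keys_diff[THEN subsetD])
  show "frag_of (a \<otimes> b, q) - frag_of (a, q) - frag_of (b, q) \<in> tensor_rat_relations G"
    if "a \<in> carrier G" "b \<in> carrier G"
    unfolding tensor_rat_relations_def using that by (intro generate.incl UnI1) blast
  show "frag_of (a, q + s) - frag_of (a, q) - frag_of (a, s) \<in> tensor_rat_relations G" if "a \<in> carrier G"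
    unfolding tensor_rat_relations_def using that by (intro generate.incl UnI2) blast
qed

lemma relations_carrier: "c \<in> tensor_rat_relations G \<Longrightarrow> c \<in> carrier (tensor_rat_free G)"
  using subgroup.mem_carrier[OF relations_subgroup(1)] .

text \<open>
The free abelian group is written multiplicatively in its record but additively on its type; these
rules translate the subgroup laws into the additive notation.
\<close>

lemma relations_0: "0 \<in> tensor_rat_relations G"
  and relations_plus: "\<lbrakk>c \<in> tensor_rat_relations G; d \<in> tensor_rat_relations G\<rbrakk> \<Longrightarrow> c + d \<in> tensor_rat_relations G"
  and relations_uminus: "c \<in> tensor_rat_relations G \<Longrightarrow> - c \<in> tensor_rat_relations G"
  and relations_minus: "\<lbrakk>c \<in> tensor_rat_relations G; d \<in> tensor_rat_relations G\<rbrakk> \<Longrightarrow> c - d \<in> tensor_rat_relations G"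
proof -
  note s = relations_subgroup(1)
  show "0 \<in> tensor_rat_relations G" using subgroup.one_closed[OF s] by simp
  show p: "c + d \<in> tensor_rat_relations G" if "c \<in> tensor_rat_relations G" "d \<in> tensor_rat_relations G" for c d
    using subgroup.m_closed[OF s that] by simp
  show m: "- c \<in> tensor_rat_relations G" if "c \<in> tensor_rat_relations G" for c
    using subgroup.m_inv_closed[OF s that] relations_carrier[OF that] by simp
  show "c - d \<in> tensor_rat_relations G" if "c \<in> tensor_rat_relations G" "d \<in> tensor_rat_relations G" for c d
    using p[OF that(1) m[OF that(2)]] by simp
qed

lemma tensor_zero_right: assumes "a \<in> carrier G" shows "frag_of (a, 0) \<in> tensor_rat_relations G"
  using relations_uminus[OF relations_add[OF assms, of 0 0]] by simp

lemma tensor_one_left: "frag_of (\<one>, q) \<in> tensor_rat_relations G"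
  using relations_uminus[OF relations_mult[of \<one> \<one> q]] by simp

lemma tensor_nat_pow:
  assumes a: "a \<in> carrier G"
  shows "frag_of (a [^] (n::nat), q) - frag_of (a, of_nat n * q) \<in> tensor_rat_relations G"
proof (induction n)
  case 0
  then show ?case using relations_minus[OF tensor_one_left tensor_zero_right[OF a]] by simp
next
  case (Suc n)
  have 1: "frag_of (a [^] n \<otimes> a, q) - frag_of (a [^] n, q) - frag_of (a, q) \<in> tensor_rat_relations G"
    using a by (intro relations_mult) auto
  have 2: "frag_of (a, of_nat n * q + q) - frag_of (a, of_nat n * q) - frag_of (a, q) \<in> tensor_rat_relations G"
    using a by (rule relations_add)
  have "frag_of (a [^] n \<otimes> a, q) - frag_of (a, of_nat n * q + q) \<in> tensor_rat_relations G"
    using relations_plus[OF relations_minus[OF 1 2] Suc] by simp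
  then show ?case by (simp add: algebra_simps)
qed

lemma tensor_inv:
  assumes a: "a \<in> carrier G"
  shows "frag_of (inv a, q) - frag_of (a, - q) \<in> tensor_rat_relations G"
proof -
  have 1: "frag_of (inv a \<otimes> a, q) - frag_of (inv a, q) - frag_of (a, q) \<in> tensor_rat_relations G"
    using a by (intro relations_mult) auto
  have 2: "frag_of (a, - q + q) - frag_of (a, - q) - frag_of (a, q) \<in> tensor_rat_relations G"
    using a by (rule relations_add)
  have 3: "frag_of (\<one>, q) - frag_of (a, 0) \<in> tensor_rat_relations G"
    using relations_minus[OF tensor_one_left tensor_zero_right[OF a]] .
  show ?thesis using relations_minus[OF 3 relations_minus[OF 1 2]] a by simp
qed

lemma tensor_int_pow:
  assumes a: "a \<in> carrier G"
  shows "frag_of (a [^] (m::int), q) - frag_of (a, of_int m * q) \<in> tensor_rat_relations G"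
proof (cases m)
  case (nonneg n)
  then show ?thesis using tensor_nat_pow[OF a, of n q] by (simp add: int_pow_int)
next
  case (neg n)
  have e: "a [^] m = inv (a [^] Suc n)" using a neg by (metis int_pow_neg_int)
  have "frag_of (inv (a [^] Suc n), q) - frag_of (a [^] Suc n, - q) \<in> tensor_rat_relations G"
    by (rule tensor_inv[OF nat_pow_closed[OF a]])
  from relations_plus[OF this tensor_nat_pow[OF a, of "Suc n" "- q"]]
  have "frag_of (inv (a [^] Suc n), q) - frag_of (a, of_nat (Suc n) * - q) \<in> tensor_rat_relations G" by simp
  moreover have "rat_of_int m = - of_nat (Suc n)" using neg by simp
  then have "of_nat (Suc n) * - q = of_int m * q" by (simp only: mult_minus_left mult_minus_right)
  ultimately show ?thesis unfolding e by metis
qed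

lemma tensor_lincomb:
  assumes e: "e ` {..<r} \<subseteq> carrier G"
  shows "frag_of (lincomb r e n, q) - (\<Sum>i<r. frag_of (e i, of_int (n i) * q)) \<in> tensor_rat_relations G"
  using e
proof (induction r)
  case 0
  then show ?case using tensor_one_left by (simp add: lincomb_def)
next
  case (Suc r)
  have er: "e ` {..<r} \<subseteq> carrier G" "e r \<in> carrier G" using Suc.prems by auto
  have l: "lincomb (Suc r) e n = e r [^] n r \<otimes> lincomb r e n"
    unfolding lincomb_def lessThan_Suc using er by (intro finprod_insert) auto
  have 1: "frag_of (e r [^] n r \<otimes> lincomb r e n, q) - frag_of (e r [^] n r, q) - frag_of (lincomb r e n, q)
      \<in> tensor_rat_relations G" using er by (intro relations_mult) auto
  from relations_plus[OF relations_plus[OF 1 Suc.IH[OF er(1)]] tensor_int_pow[OF er(2), of "n r" q]]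
  show ?case unfolding l by (simp add: algebra_simps)
qed

text \<open>
Coordinates with respect to the basis \<open>e\<close> extend to an additive map \<open>\<Psi>\<close> from the free abelian group
on pairs \<open>(x, q)\<close> to \<open>\<rat> ^ r\<close>. Modulo the bilinearity relations every element reduces to the normal
form \<open>std v\<close>, the sum of the \<open>(e i, v i)\<close>, where \<open>v\<close> is its image under \<open>\<Psi>\<close>. Hence the relations are
exactly the kernel of \<open>\<Psi>\<close>, the cosets are its fibres, and the tensor product is \<open>\<rat> ^ r\<close>.
\<close>

theorem torsion_free_rank_eq_basis_size:
  assumes e: "e ` {..<r} \<subseteq> carrier G" and span: "\<forall>x\<in>carrier G. \<exists>n. x = lincomb r e n"
    and indep: "\<forall>n. lincomb r e n = \<one> \<longrightarrow> (\<forall>i<r. n i = 0)"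
  shows "torsion_free_rank G = r"
proof -
  let ?F = "tensor_rat_free G" and ?K = "tensor_rat_relations G"
  interpret F: comm_group ?F by (rule abelian_free_Abelian_group)
  have F_add: "c + d \<in> carrier ?F" and F_diff: "c - d \<in> carrier ?F"
    if "c \<in> carrier ?F" "d \<in> carrier ?F" for c d
    using that subset_trans[OF keys_add, of c d] subset_trans[OF keys_diff, of c d] by simp_all
  have "\<forall>x. \<exists>n. x \<in> carrier G \<longrightarrow> x = lincomb r e n" using span by blast
  then obtain co where co: "\<And>x. x \<in> carrier G \<Longrightarrow> x = lincomb r e (co x)" by metis
  note uniq = lincomb_unique[OF e indep]
  have co_mult: "co (x \<otimes> y) i = co x i + co y i" if "x \<in> carrier G" "y \<in> carrier G" "i < r" for x y i
    using that co[of "x \<otimes> y"] co[of x] co[of y] lincomb_add[OF e, of "co x" "co y"]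
    by (intro uniq) (auto simp del: lincomb_closed)
  have co_e: "co (e i) j = (if j = i then 1 else 0)" if "i < r" "j < r" for i j
    using that co[of "e i"] lincomb_unit[OF e that(1)] e by (intro uniq) auto
  define \<Psi> :: "('a \<times> rat \<Rightarrow>\<^sub>0 int) \<Rightarrow> nat \<Rightarrow> rat" where
    "\<Psi> c i = (if i < r then \<Sum>p\<in>Poly_Mapping.keys c. of_int (Poly_Mapping.lookup c p) * (snd p * of_int (co (fst p) i)) else 0)" for c i
  have \<Psi>_super: "\<Psi> c i = (\<Sum>p\<in>S. of_int (Poly_Mapping.lookup c p) * (snd p * of_int (co (fst p) i)))"
    if "finite S" "Poly_Mapping.keys c \<subseteq> S" "i < r" for c S i
    unfolding \<Psi>_def using that by (auto intro!: sum.mono_neutral_left simp: in_keys_iff)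
  have \<Psi>_Q: "\<Psi> c \<in> rat_vecs r" for c by (simp add: \<Psi>_def rat_vecs_def)
  have \<Psi>_diff: "\<Psi> (c - d) = \<Psi> c - \<Psi> d" for c d
  proof
    fix i
    let ?S = "Poly_Mapping.keys c \<union> Poly_Mapping.keys d"
    show "\<Psi> (c - d) i = (\<Psi> c - \<Psi> d) i"
    proof (cases "i < r")
      case True
      have "Poly_Mapping.keys (c - d) \<subseteq> ?S" by (rule keys_diff)
      then show ?thesis using True
        by (simp add: \<Psi>_super[of ?S] lookup_minus left_diff_distrib sum_subtractf)
    qed (simp add: \<Psi>_def)
  qed
  have \<Psi>_0: "\<Psi> 0 = 0" by (auto simp: \<Psi>_def)
  have \<Psi>_minus: "\<Psi> (- c) = - \<Psi> c" for c using \<Psi>_diff[of 0 c] \<Psi>_0 by simp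
  have \<Psi>_add: "\<Psi> (c + d) = \<Psi> c + \<Psi> d" for c d using \<Psi>_diff[of c "- d"] \<Psi>_minus by simp
  have \<Psi>_sum: "\<Psi> (\<Sum>x\<in>S. f x) = (\<Sum>x\<in>S. \<Psi> (f x))" for f and S :: "nat set"
    by (induction S rule: infinite_finite_induct) (simp_all add: \<Psi>_0 \<Psi>_add)
  have \<Psi>_of: "\<Psi> (frag_of (x, q)) = (\<lambda>i. if i < r then q * of_int (co x i) else 0)" for x q
    by (auto simp: \<Psi>_def fun_eq_iff)
  define std where "std v = (\<Sum>i<r. frag_of (e i, v i))" for v :: "nat \<Rightarrow> rat"
  have std_c: "std v \<in> carrier ?F" for v
    unfolding std_def using e by (intro sum_closed_free_Abelian_group) auto
  have \<Psi>_std: "\<Psi> (std v) = v" if "v \<in> rat_vecs r" for v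
  proof
    fix j
    have "\<Psi> (std v) j = (\<Sum>i<r. \<Psi> (frag_of (e i, v i)) j)"
      by (simp add: std_def \<Psi>_sum sum_fun_eval)
    also have "\<dots> = (\<Sum>i<r. if i = j then v i else 0)"
      by (intro sum.cong) (auto simp: \<Psi>_of co_e)
    also have "\<dots> = v j" using that by (auto simp: rat_vecs_def)
    finally show "\<Psi> (std v) j = v j" .
  qed
  have K_\<Psi>: "\<Psi> c = 0" if "c \<in> ?K" for c
  proof -
    have "subgroup {c \<in> carrier ?F. \<Psi> c = 0} ?F"
    proof (rule F.subgroupI)
      show "{c \<in> carrier ?F. \<Psi> c = 0} \<noteq> {}" using \<Psi>_0 by (auto intro!: exI[of _ 0])
      show "inv\<^bsub>?F\<^esub> c \<in> {c \<in> carrier ?F. \<Psi> c = 0}" if "c \<in> {c \<in> carrier ?F. \<Psi> c = 0}" for c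
        using that by (simp add: \<Psi>_minus)
      show "c \<otimes>\<^bsub>?F\<^esub> d \<in> {c \<in> carrier ?F. \<Psi> c = 0}"
        if "c \<in> {c \<in> carrier ?F. \<Psi> c = 0}" "d \<in> {c \<in> carrier ?F. \<Psi> c = 0}" for c d
        using that F_add[of c d] by (simp add: \<Psi>_add)
    qed auto
    moreover have "{frag_of (a \<otimes> b, q) - frag_of (a, q) - frag_of (b, q) | a b q. a \<in> carrier G \<and> b \<in> carrier G} \<union>
        {frag_of (a, q + s) - frag_of (a, q) - frag_of (a, s) | a q s. a \<in> carrier G} \<subseteq> {c \<in> carrier ?F. \<Psi> c = 0}"
    proof -
      have "\<Psi> (frag_of (a \<otimes> b, q) - frag_of (a, q) - frag_of (b, q)) = 0"
        if "a \<in> carrier G" "b \<in> carrier G" for a b q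
        by (rule ext) (simp add: \<Psi>_diff \<Psi>_add \<Psi>_of co_mult[OF that] algebra_simps)
      moreover have "\<Psi> (frag_of (a, q + s) - frag_of (a, q) - frag_of (a, s)) = 0" for a q s
        by (rule ext) (simp add: \<Psi>_diff \<Psi>_add \<Psi>_of algebra_simps)
      ultimately show ?thesis
        using relations_carrier[OF relations_mult] relations_carrier[OF relations_add]
        by (intro Un_least subsetI; elim CollectE exE conjE; simp only: mem_Collect_eq; metis)
    qed
    ultimately have "?K \<subseteq> {c \<in> carrier ?F. \<Psi> c = 0}"
      unfolding tensor_rat_relations_def by (intro F.generate_subgroup_incl)
    then show ?thesis using that by blast
  qed
  have std_diff: "std (v - w) - (std v - std w) \<in> ?K" for v w
  proof -
    have t: "frag_of (e i, v i - w i) - (frag_of (e i, v i) - frag_of (e i, w i)) \<in> ?K" if "i < r" for i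
    proof -
      have "e i \<in> carrier G" using e that by auto
      from relations_uminus[OF relations_add[OF this, of "v i - w i" "w i"]] show ?thesis
        by (simp add: algebra_simps)
    qed
    have "(\<Sum>i<m. frag_of (e i, v i - w i) - (frag_of (e i, v i) - frag_of (e i, w i))) \<in> ?K" if "m \<le> r" for m
      using that by (induction m) (auto intro!: relations_0 relations_plus t)
    from this[of r] show ?thesis by (simp add: std_def sum_subtractf)
  qed
  have reduce: "c - std (\<Psi> c) \<in> ?K" if "c \<in> carrier ?F" for c
  proof -
    have "Poly_Mapping.keys c \<subseteq> carrier G \<times> UNIV" using that by simp
    then show ?thesis
    proof (induction c rule: frag_induction)
      case zero
      have "std 0 \<in> ?K"
      proof -
        have "(\<Sum>i<m. frag_of (e i, 0::rat)) \<in> ?K" if "m \<le> r" for m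
          using that e by (induction m) (auto intro!: relations_0 relations_plus tensor_zero_right)
        from this[of r] show ?thesis by (simp add: std_def)
      qed
      from relations_minus[OF relations_0 this] show ?case unfolding \<Psi>_0 .
    next
      case (one p)
      obtain x q where p: "p = (x, q)" "x \<in> carrier G" using one by auto
      have "std (\<Psi> (frag_of p)) = (\<Sum>i<r. frag_of (e i, of_int (co x i) * q))"
        unfolding std_def p by (intro sum.cong) (auto simp: \<Psi>_of mult.commute)
      then show ?case using tensor_lincomb[OF e, of "co x" q] co[OF p(2)] p by simp
    next
      case (diff c d)
      have alg: "(x - y) - (z - w) - (u - (y - w)) = x - z - u" for x y z w u :: "'a \<times> rat \<Rightarrow>\<^sub>0 int"
        by simp
      show ?case
        using relations_minus[OF relations_minus[OF diff] std_diff[of "\<Psi> c" "\<Psi> d"]]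
        unfolding \<Psi>_diff alg .
    qed
  qed
  have ker: "c - d \<in> ?K \<longleftrightarrow> \<Psi> c = \<Psi> d" if "c \<in> carrier ?F" "d \<in> carrier ?F" for c d
  proof
    assume "c - d \<in> ?K"
    then show "\<Psi> c = \<Psi> d" using K_\<Psi>[of "c - d"] \<Psi>_diff by simp
  next
    assume "\<Psi> c = \<Psi> d"
    then have "(c - std (\<Psi> c)) - (d - std (\<Psi> d)) = c - d" by simp
    then show "c - d \<in> ?K" using relations_minus[OF reduce[OF that(1)] reduce[OF that(2)]] by metis
  qed
  \<comment> \<open>The cosets of the relations, described as fibres of \<open>\<Psi>\<close>.\<close>
  define fib where "fib v = {c \<in> carrier ?F. \<Psi> c = v}" for v
  have K_fib: "?K = fib 0"
    using ker[of _ 0] relations_carrier by (auto simp: fib_def \<Psi>_0)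
  have coset: "?K #>\<^bsub>?F\<^esub> c = fib (\<Psi> c)" if c: "c \<in> carrier ?F" for c
  proof
    show "?K #>\<^bsub>?F\<^esub> c \<subseteq> fib (\<Psi> c)"
    proof
      fix d assume "d \<in> ?K #>\<^bsub>?F\<^esub> c"
      then obtain x where x: "x \<in> ?K" "d = x + c" by (auto simp: r_coset_def)
      have "\<Psi> d = \<Psi> c" unfolding x(2) \<Psi>_add K_\<Psi>[OF x(1)] by (rule add_0)
      then show "d \<in> fib (\<Psi> c)"
        unfolding fib_def using F_add[OF relations_carrier[OF x(1)] c] x(2) by blast
    qed
    show "fib (\<Psi> c) \<subseteq> ?K #>\<^bsub>?F\<^esub> c"
    proof
      fix d assume "d \<in> fib (\<Psi> c)"
      then have "d - c \<in> ?K" using ker c by (auto simp: fib_def)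
      then show "d \<in> ?K #>\<^bsub>?F\<^esub> c" by (auto simp: r_coset_def intro!: bexI[of _ "d - c"])
    qed
  qed
  have carrier_eq: "carrier (tensor_rat G) = fib ` rat_vecs r"
  proof -
    have "carrier (tensor_rat G) = (\<lambda>c. ?K #>\<^bsub>?F\<^esub> c) ` carrier ?F"
      by (auto simp: tensor_rat_def Let_def FactGroup_def RCOSETS_def)
    also have "\<dots> = (\<lambda>c. fib (\<Psi> c)) ` carrier ?F" using coset by (intro image_cong) auto
    also have "\<dots> = fib ` rat_vecs r"
    proof
      show "(\<lambda>c. fib (\<Psi> c)) ` carrier ?F \<subseteq> fib ` rat_vecs r" using \<Psi>_Q by auto
      show "fib ` rat_vecs r \<subseteq> (\<lambda>c. fib (\<Psi> c)) ` carrier ?F"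
      proof (rule image_subsetI)
        fix v assume "v \<in> rat_vecs r"
        then show "fib v \<in> (\<lambda>c. fib (\<Psi> c)) ` carrier ?F"
          by (intro image_eqI[OF _ std_c[of v]]) (simp add: \<Psi>_std)
      qed
    qed
    finally show ?thesis .
  qed
  have std_fib: "std v \<in> fib v" if "v \<in> rat_vecs r" for v
    using that \<Psi>_std std_c unfolding fib_def by blast
  define S where "S = (\<lambda>q::rat. frag_extend (\<lambda>(a::'a, s). frag_of (a, q * s)))"
  have S: "S q c \<in> carrier ?F \<and> \<Psi> (S q c) = rscale q (\<Psi> c)" if "c \<in> carrier ?F" for q c
  proof -
    have "Poly_Mapping.keys c \<subseteq> carrier G \<times> UNIV" using that by simp
    then show ?thesis
    proof (induction c rule: frag_induction)
      case zero
      then show ?case by (auto simp: S_def \<Psi>_0 rscale_def fun_eq_iff)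
    next
      case (one p)
      then show ?case by (cases p) (auto simp: S_def \<Psi>_of rscale_def fun_eq_iff)
    next
      case (diff c d)
      then show ?case
        using F_diff[of "S q c" "S q d"]
        by (auto simp: S_def frag_extend_diff \<Psi>_diff rscale_def fun_eq_iff algebra_simps)
    qed
  qed
  have set_mult: "fib v <#>\<^bsub>?F\<^esub> T = fib (v + w)"
    if T: "T \<subseteq> fib w" "T \<noteq> {}" for v w T
  proof
    show "fib v <#>\<^bsub>?F\<^esub> T \<subseteq> fib (v + w)"
    proof
      fix d assume "d \<in> fib v <#>\<^bsub>?F\<^esub> T"
      then obtain x t where x: "x \<in> fib v" "t \<in> fib w" "d = x + t"
        using T(1) by (auto simp: set_mult_def)
      then have "x \<in> carrier ?F" "t \<in> carrier ?F" "\<Psi> x = v" "\<Psi> t = w" by (simp_all add: fib_def)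
      then show "d \<in> fib (v + w)" unfolding fib_def x(3) using F_add \<Psi>_add by blast
    qed
    show "fib (v + w) \<subseteq> fib v <#>\<^bsub>?F\<^esub> T"
    proof
      fix d assume d: "d \<in> fib (v + w)"
      obtain t where t: "t \<in> T" "t \<in> fib w" using T by blast
      have "\<Psi> (d - t) = v" using d t(2) by (simp add: fib_def \<Psi>_diff)
      moreover have "d - t \<in> carrier ?F" using d t(2) F_diff by (simp add: fib_def)
      ultimately have "d - t \<in> fib v" by (simp add: fib_def)
      moreover have "d = (d - t) + t" by simp
      ultimately show "d \<in> fib v <#>\<^bsub>?F\<^esub> T" using t(1) unfolding set_mult_def by force
    qed
  qed
  show ?thesis
  proof (unfold torsion_free_rank_def, rule rat_dim_eqI[where F = fib])
    have "inj_on fib (rat_vecs r)"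
    proof (rule inj_onI)
      fix v w assume "v \<in> rat_vecs r" "w \<in> rat_vecs r" "fib v = fib w"
      then have "std v \<in> fib w" using std_fib by blast
      then show "v = w" using \<Psi>_std \<open>v \<in> rat_vecs r\<close> by (simp add: fib_def)
    qed
    then show "bij_betw fib (rat_vecs r) (carrier (tensor_rat G))"
      by (simp add: bij_betw_def carrier_eq)
  next
    fix v w assume "v \<in> rat_vecs r" "w \<in> rat_vecs r"
    have "fib v \<oplus>\<^bsub>tensor_rat G\<^esub> fib w = fib v <#>\<^bsub>?F\<^esub> fib w"
      by (simp add: tensor_rat_def Let_def FactGroup_def)
    also have "\<dots> = fib (v + w)" using std_fib[OF \<open>w \<in> rat_vecs r\<close>] by (intro set_mult) auto
    finally show "fib v \<oplus>\<^bsub>tensor_rat G\<^esub> fib w = fib (v + w)" .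
  next
    show "\<zero>\<^bsub>tensor_rat G\<^esub> = fib 0"
      by (simp add: tensor_rat_def Let_def FactGroup_def K_fib)
  next
    fix q v assume v: "v \<in> rat_vecs r"
    have "q \<odot>\<^bsub>tensor_rat G\<^esub> fib v = fib 0 <#>\<^bsub>?F\<^esub> (S q ` fib v)"
      by (simp add: tensor_rat_def Let_def S_def K_fib)
    also have "\<dots> = fib (0 + rscale q v)"
      using std_fib[OF v] S by (intro set_mult) (auto simp: fib_def)
    finally show "q \<odot>\<^bsub>tensor_rat G\<^esub> fib v = fib (rscale q v)" by simp
  qed
qed

end

section \<open>Polynomial growth of the translation cocycle\<close>

definition taxicab :: "nat \<Rightarrow> (nat \<Rightarrow> int) \<Rightarrow> nat" where
  "taxicab k n = (\<Sum>i<k. nat \<bar>n i\<bar>)"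

definition int_lattice :: "nat \<Rightarrow> (nat \<Rightarrow> int) set" where
  "int_lattice k = {n. \<forall>l\<ge>k. n l = 0}"

lemma taxicab_add_le: "taxicab k (\<lambda>i. m i + n i) \<le> taxicab k m + taxicab k n"
  unfolding taxicab_def sum.distrib[symmetric] by (intro sum_mono) auto

lemma taxicab_neg: "taxicab k (\<lambda>i. - n i) = taxicab k n"
  by (simp add: taxicab_def)

lemma taxicab_upd:
  assumes "l < k" shows "taxicab k (n(l := z)) + nat \<bar>n l\<bar> = taxicab k n + nat \<bar>z\<bar>"
proof -
  have "(\<Sum>i\<in>{..<k} - {l}. nat \<bar>(n(l := z)) i\<bar>) = (\<Sum>i\<in>{..<k} - {l}. nat \<bar>n i\<bar>)"
    by (intro sum.cong) auto
  then show ?thesis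
    unfolding taxicab_def using assms by (simp add: sum.remove[of "{..<k}" l])
qed

text \<open>
A discrete mean value estimate. A lattice point is connected to the set where \<open>u\<close> vanishes by a
path that restores its coordinates one unit at a time, the last nonzero coordinate below \<open>i\<close> first
and the first one last. The path has at most \<open>taxicab k n\<close> steps, its points do not exceed \<open>n\<close> in
size, and each step changes a coordinate all of whose predecessors vanish. This is why the step
condition speaks of such points.
\<close>

lemma walk_bound:
  fixes u :: "(nat \<Rightarrow> int) \<Rightarrow> real" and b :: "nat \<Rightarrow> real"
  assumes ik: "i \<le> k" and mono: "mono b" and b0: "0 \<le> b 0"
    and start: "\<And>n. \<lbrakk>\<And>l. k \<le> l \<Longrightarrow> n l = 0; \<And>l. l < i \<Longrightarrow> n l = 0\<rbrakk> \<Longrightarrow> u n = 0"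
    and step: "\<And>n j. \<lbrakk>\<And>l. k \<le> l \<Longrightarrow> n l = 0; j < i; \<And>l. l < j \<Longrightarrow> n l = 0\<rbrakk>
      \<Longrightarrow> \<bar>u (n(j := n j + 1)) - u n\<bar> \<le> b (taxicab k n)"
  shows "(\<And>l. k \<le> l \<Longrightarrow> n l = 0) \<Longrightarrow> \<bar>u n\<bar> \<le> real (taxicab k n) * b (taxicab k n)"
proof (induction "taxicab k n" arbitrary: n rule: less_induct)
  case less
  have bnn: "0 \<le> b m" for m using monoD[OF mono, of 0 m] b0 by linarith
  show ?case
  proof (cases "\<exists>l<i. n l \<noteq> 0")
    case False
    then have "u n = 0" using start less.prems by blast
    then show ?thesis using bnn by simp
  next
    case True
    define j where "j = (LEAST l. l < i \<and> n l \<noteq> 0)"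
    have j: "j < i" "n j \<noteq> 0" using LeastI_ex[OF True] by (auto simp: j_def)
    have jl: "n l = 0" if "l < j" for l
      using not_less_Least[of l "\<lambda>l. l < i \<and> n l \<noteq> 0"] that j by (auto simp: j_def)
    have jk: "j < k" using j ik by simp
    define n' where "n' = n(j := n j - sgn (n j))"
    have size: "taxicab k n' + 1 = taxicab k n"
      using taxicab_upd[OF jk, of n "n j - sgn (n j)"] j(2) by (auto simp: n'_def sgn_if split: if_splits)
    have n'k: "n' l = 0" if "k \<le> l" for l using that less.prems jk by (auto simp: n'_def)
    have IH: "\<bar>u n'\<bar> \<le> real (taxicab k n') * b (taxicab k n')"
      using less.hyps[of n'] size n'k by simp
    have "\<bar>u n - u n'\<bar> \<le> b (taxicab k n)"
    proof (cases "0 < n j")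
      case True
      then have "n = n'(j := n' j + 1)" by (auto simp: n'_def)
      moreover have "\<bar>u (n'(j := n' j + 1)) - u n'\<bar> \<le> b (taxicab k n')"
        using n'k j jl by (intro step) (auto simp: n'_def)
      ultimately have "\<bar>u n - u n'\<bar> \<le> b (taxicab k n')" by metis
      also have "\<dots> \<le> b (taxicab k n)" using monoD[OF mono] size by simp
      finally show ?thesis .
    next
      case False
      then have "n' = n(j := n j + 1)" using j by (auto simp: n'_def sgn_if)
      moreover have "\<bar>u (n(j := n j + 1)) - u n\<bar> \<le> b (taxicab k n)"
        using less.prems j jl by (intro step) auto
      ultimately show ?thesis by (simp add: abs_minus_commute)
    qed
    moreover have "real (taxicab k n') * b (taxicab k n') \<le> real (taxicab k n') * b (taxicab k n)"
      using monoD[OF mono, of "taxicab k n'" "taxicab k n"] size by (intro mult_left_mono) auto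
    ultimately have "\<bar>u n\<bar> \<le> real (taxicab k n') * b (taxicab k n) + b (taxicab k n)"
      using IH by linarith
    also have "\<dots> = real (taxicab k n) * b (taxicab k n)"
      using size by (simp add: algebra_simps flip: size)
    finally show ?thesis .
  qed
qed

lemma common_bound:
  assumes "\<And>i. i < (m::nat) \<Longrightarrow> \<exists>C\<ge>0. \<forall>x\<in>X. f i x \<le> C * (h x :: real)" and "\<And>x. x \<in> X \<Longrightarrow> 0 \<le> h x"
  shows "\<exists>C\<ge>0. \<forall>i<m. \<forall>x\<in>X. f i x \<le> C * h x"
  using assms(1)
proof (induction m)
  case (Suc m)
  obtain C where C: "0 \<le> C" "\<forall>i<m. \<forall>x\<in>X. f i x \<le> C * h x" using Suc by fastforce
  obtain D where D: "0 \<le> D" "\<forall>x\<in>X. f m x \<le> D * h x" using Suc.prems[of m] by auto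
  have "f i x \<le> (C + D) * h x" if "i < Suc m" "x \<in> X" for i x
  proof -
    have "0 \<le> C * h x" "0 \<le> D * h x" using C D assms(2)[OF that(2)] by auto
    moreover have "f i x \<le> C * h x \<or> f i x \<le> D * h x" using C D that by (metis less_antisym)
    ultimately show ?thesis by (auto simp: distrib_right)
  qed
  then show ?case using C D by (intro exI[of _ "C + D"]) auto
qed auto

lemma mono_poly_bound: "mono (\<lambda>m. C * (1 + real m) ^ d)" if "0 \<le> C"
  using that by (intro monoI mult_left_mono power_mono) auto

text \<open>
\<open>\<pi>\<close> identifies \<open>G / A\<close> with the lattice of integer sequences supported below \<open>k\<close>, \<open>b\<close> lifts the
standard basis to \<open>G\<close>, and \<open>\<phi>\<close> embeds \<open>A\<close> into the reals.
\<close>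

locale abelian_normal_coordinates = abelian_normal_data +
  fixes k :: nat and \<pi> :: "'a \<Rightarrow> nat \<Rightarrow> int" and b :: "nat \<Rightarrow> 'a" and \<phi> :: "'a \<Rightarrow> real"
  assumes b_closed: "i < k \<Longrightarrow> b i \<in> carrier G"
    and \<pi>_support: "g \<in> carrier G \<Longrightarrow> k \<le> i \<Longrightarrow> \<pi> g i = 0"
    and \<pi>_mult: "g \<in> carrier G \<Longrightarrow> h \<in> carrier G \<Longrightarrow> \<pi> (g \<otimes> h) = (\<lambda>i. \<pi> g i + \<pi> h i)"
    and \<pi>_kernel: "g \<in> carrier G \<Longrightarrow> \<pi> g = (\<lambda>_. 0) \<longleftrightarrow> g \<in> A"
    and \<pi>_b: "i < k \<Longrightarrow> \<pi> (b i) = (\<lambda>j. if j = i then 1 else 0)"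
    and \<phi>_mult: "x \<in> A \<Longrightarrow> y \<in> A \<Longrightarrow> \<phi> (x \<otimes> y) = \<phi> x + \<phi> y"
    and \<phi>_inj: "x \<in> A \<Longrightarrow> \<phi> x = 0 \<Longrightarrow> x = \<one>"
begin

lemma \<pi>_one: "\<pi> \<one> = (\<lambda>_. 0)"
  using \<pi>_kernel[of \<one>] subgroup.one_closed[OF subA] by simp

lemma \<pi>_inv: assumes "g \<in> carrier G" shows "\<pi> (inv g) = (\<lambda>i. - \<pi> g i)"
proof
  fix i
  have "\<pi> (g \<otimes> inv g) i = 0" using \<pi>_one assms by simp
  then show "\<pi> (inv g) i = - \<pi> g i" using \<pi>_mult[of g "inv g"] assms by simp
qed

lemma \<pi>_pow: assumes "g \<in> carrier G" shows "\<pi> (g [^] (m::int)) = (\<lambda>i. m * \<pi> g i)"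
proof -
  have nat: "\<pi> (g [^] (n::nat)) = (\<lambda>i. int n * \<pi> g i)" for n
  proof (induction n)
    case (Suc n)
    then show ?case using assms by (simp add: \<pi>_mult algebra_simps)
  qed (simp add: \<pi>_one)
  show ?thesis
  proof (cases m)
    case (nonneg p)
    then show ?thesis using nat[of p] by (simp add: int_pow_int)
  next
    case (neg p)
    have "g [^] m = inv (g [^] Suc p)" using assms neg by (metis int_pow_neg_int)
    moreover have "\<pi> (inv (g [^] Suc p)) = (\<lambda>i. - (int (Suc p) * \<pi> g i))"
      using assms by (simp only: \<pi>_inv[OF nat_pow_closed[OF assms]] nat)
    ultimately show ?thesis using neg by (simp only: mult_minus_left)
  qed
qed

lemma same_coordinates:
  assumes "x \<in> carrier G" "y \<in> carrier G" "\<pi> x = \<pi> y" shows "inv x \<otimes> y \<in> A"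
  using assms \<pi>_kernel[of "inv x \<otimes> y"] by (simp add: \<pi>_mult \<pi>_inv)

lemma \<phi>_one: "\<phi> \<one> = 0"
  using \<phi>_mult[of \<one> \<one>] subgroup.one_closed[OF subA] by simp

definition rep_from :: "nat list \<Rightarrow> (nat \<Rightarrow> int) \<Rightarrow> 'a" where
  "rep_from is n = foldr (\<lambda>i x. b i [^] n i \<otimes> x) is \<one>"

text \<open>
The section of \<open>\<pi>\<close> given by the normal forms \<open>b\<^sub>0 ^ n\<^sub>0 \<cdots> b\<^sub>k\<^sub>-\<^sub>1 ^ n\<^sub>k\<^sub>-\<^sub>1\<close>.
\<close>

definition rep :: "(nat \<Rightarrow> int) \<Rightarrow> 'a" where
  "rep n = rep_from [0..<k] n"

lemma rep_from_closed: "set is \<subseteq> {..<k} \<Longrightarrow> rep_from is n \<in> carrier G"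
  by (induction "is") (auto simp: rep_from_def b_closed)

lemma rep_closed [simp]: "rep n \<in> carrier G"
  unfolding rep_def by (rule rep_from_closed) auto

lemma \<pi>_rep_from:
  "set is \<subseteq> {..<k} \<Longrightarrow> distinct is \<Longrightarrow> \<pi> (rep_from is n) = (\<lambda>j. if j \<in> set is then n j else 0)"
proof (induction "is")
  case (Cons i "is")
  have c: "b i \<in> carrier G" "rep_from is n \<in> carrier G" using Cons b_closed rep_from_closed by auto
  have "rep_from (i # is) n = b i [^] n i \<otimes> rep_from is n" by (simp add: rep_from_def)
  then have "\<pi> (rep_from (i # is) n) = (\<lambda>j. n i * \<pi> (b i) j + \<pi> (rep_from is n) j)"
    using c by (simp add: \<pi>_mult \<pi>_pow)
  then show ?case using Cons by (auto simp: \<pi>_b fun_eq_iff)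
qed (simp add: rep_from_def \<pi>_one)

lemma \<pi>_rep:
  assumes "\<And>l. k \<le> l \<Longrightarrow> n l = 0" shows "\<pi> (rep n) = n"
proof -
  have eq: "\<pi> (rep n) = (\<lambda>j. if j \<in> set [0..<k] then n j else 0)"
    unfolding rep_def by (rule \<pi>_rep_from) auto
  show ?thesis
  proof
    fix j
    show "\<pi> (rep n) j = n j" unfolding eq using assms[of j] by (cases "j < k") auto
  qed
qed

lemma \<pi>_rep_\<pi>: "g \<in> carrier G \<Longrightarrow> \<pi> (rep (\<pi> g)) = \<pi> g"
  using \<pi>_rep \<pi>_support by blast

lemma rep_from_trivial: "(\<And>i. i \<in> set is \<Longrightarrow> n i = 0) \<Longrightarrow> x \<in> carrier G \<Longrightarrow>
    foldr (\<lambda>i x. b i [^] (n i :: int) \<otimes> x) is x = x"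
  by (induction "is") auto

lemma rep_zero: "rep (\<lambda>_. 0) = \<one>"
  unfolding rep_def rep_from_def by (rule rep_from_trivial) auto

text \<open>
If the coordinates before \<open>j\<close> vanish, the normal form starts with a power of \<open>b j\<close>, so that
multiplication by \<open>b j\<close> from the left yields a normal form again.
\<close>

lemma rep_step:
  assumes j: "j < k" and z: "\<And>l. l < j \<Longrightarrow> n l = 0"
  shows "rep (n(j := n j + 1)) = b j \<otimes> rep n"
proof -
  have tl: "rep_from [Suc j..<k] m \<in> carrier G" for m by (rule rep_from_closed) auto
  have split: "rep m = b j [^] m j \<otimes> rep_from [Suc j..<k] m" if "\<And>l. l < j \<Longrightarrow> m l = 0" for m
  proof -
    have "[0..<k] = [0..<j] @ j # [Suc j..<k]"
      using j by (metis le_add_diff_inverse less_imp_le_nat upt_add_eq_append upt_conv_Cons zero_le add_0)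
    then have "rep m = foldr (\<lambda>i x. b i [^] m i \<otimes> x) [0..<j] (b j [^] m j \<otimes> rep_from [Suc j..<k] m)"
      by (simp add: rep_def rep_from_def)
    also have "\<dots> = b j [^] m j \<otimes> rep_from [Suc j..<k] m"
      using that j b_closed tl by (intro rep_from_trivial) auto
    finally show ?thesis .
  qed
  have same: "rep_from [Suc j..<k] (n(j := n j + 1)) = rep_from [Suc j..<k] n"
    unfolding rep_from_def by (intro foldr_cong) auto
  have c: "b j \<in> carrier G" "rep_from [Suc j..<k] n \<in> carrier G"
    using b_closed j tl by auto
  have "rep (n(j := n j + 1)) = b j [^] (1 + n j) \<otimes> rep_from [Suc j..<k] n"
    using split[of "n(j := n j + 1)"] z unfolding same by (simp add: add.commute)
  also have "\<dots> = b j \<otimes> (b j [^] n j \<otimes> rep_from [Suc j..<k] n)"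
    using c int_pow_mult[of "b j" 1 "n j"] by (simp add: m_assoc)
  also have "\<dots> = b j \<otimes> rep n" using split[of n] z by simp
  finally show ?thesis .
qed

definition tempered :: "nat \<Rightarrow> ('a \<Rightarrow> real) \<Rightarrow> bool" where
  "tempered d F \<longleftrightarrow> (\<exists>C\<ge>0. \<forall>x\<in>carrier G. \<bar>F x\<bar> \<le> C * (1 + real (taxicab k (\<pi> x))) ^ d)"

lemma conj_depends_on_coordinates:
  assumes a: "a \<in> A" and xy: "x \<in> carrier G" "y \<in> carrier G" "\<pi> x = \<pi> y"
  shows "inv x \<otimes> a \<otimes> x = inv y \<otimes> a \<otimes> y"
proof -
  define c where "c = inv x \<otimes> y"
  have c: "c \<in> A" "c \<in> carrier G" using same_coordinates[OF xy] A_carrier by (auto simp: c_def)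
  have y: "y = x \<otimes> c" using xy by (simp add: c_def m_assoc[symmetric])
  have ac: "a \<in> carrier G" using a A_carrier by blast
  define d where "d = inv x \<otimes> a \<otimes> x"
  have d: "d \<in> A" "d \<in> carrier G" using conj_A'[OF xy(1) a] A_carrier by (auto simp: d_def)
  have "inv y \<otimes> a \<otimes> y = inv c \<otimes> d \<otimes> c"
    unfolding y d_def using xy ac c by (simp add: inv_mult_group m_assoc)
  also have "\<dots> = inv c \<otimes> (c \<otimes> d)" using A_comm[OF d(1) c(1)] c d by (simp add: m_assoc)
  also have "\<dots> = d" using c d by (simp add: m_assoc[symmetric])
  finally show ?thesis by (simp add: d_def)
qed

lemma lower_central_inv:
  assumes "x \<in> lower_central G n" shows "inv x \<in> lower_central G n"
proof (cases n)
  case 0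
  then show ?thesis using assms by simp
next
  case (Suc m)
  have "(\<Union>x\<in>lower_central G m. \<Union>y\<in>carrier G. {x \<otimes> y \<otimes> inv x \<otimes> inv y}) \<subseteq> carrier G"
    using lower_central_carrier[of m] by auto
  from generate_m_inv_closed[OF this] show ?thesis using assms Suc by simp
qed

text \<open>
Induction from the end of the lower central series. Passing from \<open>x\<close> to \<open>b i x\<close> changes the
conjugate of \<open>a\<close> by the conjugate of a commutator of \<open>a\<close> with \<open>b i\<close>, which lies one step deeper and
is bounded with a smaller degree. Summing these changes along a path raises the degree by one.
\<close>

lemma conj_tempered_aux:
  assumes d: "lower_central G d = {\<one>}"
  shows "j \<le> d \<Longrightarrow> a \<in> A \<Longrightarrow> a \<in> lower_central G (d - j) \<Longrightarrow> tempered j (\<lambda>x. \<phi> (inv x \<otimes> a \<otimes> x))"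
proof (induction j arbitrary: a)
  case 0
  then have "a = \<one>" using d by simp
  then show ?case unfolding tempered_def by (intro exI[of _ 0]) (auto simp: \<phi>_one)
next
  case (Suc j)
  have ac: "a \<in> carrier G" using Suc.prems A_carrier by blast
  define c where "c i = inv a \<otimes> inv (b i) \<otimes> a \<otimes> b i" for i
  have cA: "c i \<in> A" if "i < k" for i
    using commutator_A[of "inv a" "inv (b i)"] ac b_closed[OF that] by (simp add: c_def)
  have cl: "c i \<in> lower_central G (d - j)" if "i < k" for i
  proof -
    have "c i \<in> lower_central G (Suc (d - Suc j))"
      using commutator_lower_central[OF lower_central_inv[OF Suc.prems(3)], of "inv (b i)"] ac b_closed[OF that]
      by (simp add: c_def)
    moreover have "Suc (d - Suc j) = d - j" using Suc.prems by simp
    ultimately show ?thesis by metis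
  qed
  have "\<exists>C\<ge>0. \<forall>x\<in>carrier G. \<bar>\<phi> (inv x \<otimes> c i \<otimes> x)\<bar> \<le> C * (1 + real (taxicab k (\<pi> x))) ^ j" if "i < k" for i
    using Suc.IH[OF _ cA[OF that] cl[OF that]] Suc.prems(1) by (simp add: tempered_def)
  then have "\<exists>C\<ge>0. \<forall>i<k. \<forall>x\<in>carrier G. \<bar>\<phi> (inv x \<otimes> c i \<otimes> x)\<bar> \<le> C * (1 + real (taxicab k (\<pi> x))) ^ j"
    by (rule common_bound) auto
  then obtain C where C: "0 \<le> C"
    "\<And>i x. i < k \<Longrightarrow> x \<in> carrier G \<Longrightarrow> \<bar>\<phi> (inv x \<otimes> c i \<otimes> x)\<bar> \<le> C * (1 + real (taxicab k (\<pi> x))) ^ j"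
    by blast
  define u where "u n = \<phi> (inv (rep n) \<otimes> a \<otimes> rep n) - \<phi> a" for n
  have step: "\<bar>u (n(i := n i + 1)) - u n\<bar> \<le> C * (1 + real (taxicab k n)) ^ j"
    if n: "\<And>l. k \<le> l \<Longrightarrow> n l = 0" and i: "i < k" for n i
  proof -
    have bi: "b i \<in> carrier G" using b_closed i .
    have "\<pi> (rep (n(i := n i + 1))) = n(i := n i + 1)" using n i by (intro \<pi>_rep) auto
    also have "\<dots> = \<pi> (b i \<otimes> rep n)" using n i bi by (auto simp: \<pi>_mult \<pi>_rep \<pi>_b)
    finally have "inv (rep (n(i := n i + 1))) \<otimes> a \<otimes> rep (n(i := n i + 1)) = inv (b i \<otimes> rep n) \<otimes> a \<otimes> (b i \<otimes> rep n)"
      using bi by (intro conj_depends_on_coordinates Suc.prems) auto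
    also have "\<dots> = inv (rep n) \<otimes> (inv (b i) \<otimes> a \<otimes> b i) \<otimes> rep n"
      using bi ac by (simp add: inv_mult_group m_assoc)
    also have "inv (b i) \<otimes> a \<otimes> b i = a \<otimes> c i"
      using bi ac by (simp add: c_def m_assoc[symmetric])
    also have "inv (rep n) \<otimes> (a \<otimes> c i) \<otimes> rep n = (inv (rep n) \<otimes> a \<otimes> rep n) \<otimes> (inv (rep n) \<otimes> c i \<otimes> rep n)"
    proof -
      have ci: "c i \<in> carrier G" using cA i A_carrier by blast
      have "rep n \<otimes> (inv (rep n) \<otimes> c i \<otimes> rep n) = c i \<otimes> rep n" using ci by (simp add: m_assoc[symmetric])
      then show ?thesis using ac ci by (simp add: m_assoc)
    qed
    finally have eq: "inv (rep (n(i := n i + 1))) \<otimes> a \<otimes> rep (n(i := n i + 1)) =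
      (inv (rep n) \<otimes> a \<otimes> rep n) \<otimes> (inv (rep n) \<otimes> c i \<otimes> rep n)" .
    have "u (n(i := n i + 1)) - u n = \<phi> (inv (rep n) \<otimes> c i \<otimes> rep n)"
      unfolding u_def eq using \<phi>_mult[OF conj_A'[OF rep_closed Suc.prems(2)] conj_A'[OF rep_closed cA[OF i]]]
      by simp
    then show ?thesis using C(2)[OF i rep_closed, of n] \<pi>_rep[of n] n by simp
  qed
  have start: "u n = 0" if "\<And>l. k \<le> l \<Longrightarrow> n l = 0" "\<And>l. l < k \<Longrightarrow> n l = 0" for n
  proof -
    have "n = (\<lambda>_. 0)" using that by (auto simp: fun_eq_iff not_le[symmetric])
    then show ?thesis using ac by (simp add: u_def rep_zero)
  qed
  have bound: "\<bar>u n\<bar> \<le> real (taxicab k n) * (C * (1 + real (taxicab k n)) ^ j)" if "\<And>l. k \<le> l \<Longrightarrow> n l = 0" for n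
  proof (rule walk_bound[where i = k and b = "\<lambda>m. C * (1 + real m) ^ j"])
    show "mono (\<lambda>m. C * (1 + real m) ^ j)" by (rule mono_poly_bound[OF C(1)])
    show "u n = 0" if "\<And>l. k \<le> l \<Longrightarrow> n l = 0" "\<And>l. l < k \<Longrightarrow> n l = 0" for n
      using that by (rule start)
    show "\<bar>u (n(i := n i + 1)) - u n\<bar> \<le> C * (1 + real (taxicab k n)) ^ j"
      if "\<And>l. k \<le> l \<Longrightarrow> n l = 0" "i < k" "\<And>l. l < i \<Longrightarrow> n l = 0" for n i
      using that(1,2) by (rule step)
  qed (use C(1) that in auto)
  show ?case
    unfolding tempered_def
  proof (intro exI[of _ "C + \<bar>\<phi> a\<bar>"] conjI ballI)
    fix x assume x: "x \<in> carrier G"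
    let ?m = "real (taxicab k (\<pi> x))"
    have "inv x \<otimes> a \<otimes> x = inv (rep (\<pi> x)) \<otimes> a \<otimes> rep (\<pi> x)"
      using x \<pi>_rep_\<pi> by (intro conj_depends_on_coordinates Suc.prems) auto
    then have "\<bar>\<phi> (inv x \<otimes> a \<otimes> x)\<bar> \<le> ?m * (C * (1 + ?m) ^ j) + \<bar>\<phi> a\<bar>"
      using bound[of "\<pi> x"] \<pi>_support[OF x] by (simp add: u_def)
    also have "\<dots> \<le> (1 + ?m) * (C * (1 + ?m) ^ j) + \<bar>\<phi> a\<bar> * (1 + ?m) ^ Suc j"
    proof (rule add_mono)
      show "?m * (C * (1 + ?m) ^ j) \<le> (1 + ?m) * (C * (1 + ?m) ^ j)" using C(1) by (intro mult_right_mono) auto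
      have "1 \<le> (1 + ?m) ^ Suc j" by (rule one_le_power) simp
      then show "\<bar>\<phi> a\<bar> \<le> \<bar>\<phi> a\<bar> * (1 + ?m) ^ Suc j" by (metis abs_ge_zero mult.right_neutral mult_left_mono)
    qed
    also have "\<dots> = (C + \<bar>\<phi> a\<bar>) * (1 + ?m) ^ Suc j" by (simp add: algebra_simps)
    finally show "\<bar>\<phi> (inv x \<otimes> a \<otimes> x)\<bar> \<le> (C + \<bar>\<phi> a\<bar>) * (1 + ?m) ^ Suc j" .
  qed (use C in simp)
qed

lemma conj_tempered: "\<exists>d. \<forall>a\<in>A. tempered d (\<lambda>x. \<phi> (inv x \<otimes> a \<otimes> x))"
proof -
  obtain d where "lower_central G d = {\<one>}" using nilp by (auto simp: nilpotent_def)
  from conj_tempered_aux[OF this, of d] show ?thesis using A_carrier by auto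
qed

text \<open>
The real coordinate of \<open>g\<close>: the value of \<open>\<phi>\<close> on the \<open>A\<close>-part of its normal form.
\<close>

definition height :: "'a \<Rightarrow> real" where
  "height g = \<phi> (inv (rep (\<pi> g)) \<otimes> g)"

text \<open>
The cocycle of the action on \<open>\<int>\<^sup>k \<times> \<real>\<close>. It depends on \<open>x\<close> only through \<open>\<pi> x\<close>
(\<open>shift_depends_on_coordinates\<close>), because \<open>height\<close> is equivariant under right multiplication by \<open>A\<close>.
\<close>

definition shift :: "'a \<Rightarrow> 'a \<Rightarrow> real" where
  "shift g x = height (g \<otimes> x) - height x"

lemma rep_diff_A: "g \<in> carrier G \<Longrightarrow> inv (rep (\<pi> g)) \<otimes> g \<in> A"
  using \<pi>_rep_\<pi> by (intro same_coordinates) auto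

lemma height_mult_A:
  assumes g: "g \<in> carrier G" and a: "a \<in> A"
  shows "height (g \<otimes> a) = height g + \<phi> a"
proof -
  have ac: "a \<in> carrier G" using a A_carrier by blast
  have "\<pi> (g \<otimes> a) = \<pi> g" using g ac \<pi>_kernel[OF ac] a by (simp add: \<pi>_mult)
  then have "height (g \<otimes> a) = \<phi> ((inv (rep (\<pi> g)) \<otimes> g) \<otimes> a)" using g ac by (simp add: height_def m_assoc)
  then show ?thesis using \<phi>_mult[OF rep_diff_A[OF g] a] by (simp add: height_def)
qed

lemma height_rep: "(\<And>l. k \<le> l \<Longrightarrow> n l = 0) \<Longrightarrow> height (rep n) = 0"
  by (simp add: height_def \<pi>_rep \<phi>_one)

lemma shift_mult: "\<lbrakk>g \<in> carrier G; h \<in> carrier G; x \<in> carrier G\<rbrakk> \<Longrightarrow>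
    shift (g \<otimes> h) x = shift g (h \<otimes> x) + shift h x"
  by (simp add: shift_def m_assoc)

lemma shift_A:
  assumes a: "a \<in> A" and x: "x \<in> carrier G" shows "shift a x = \<phi> (inv x \<otimes> a \<otimes> x)"
proof -
  have ac: "a \<in> carrier G" using a A_carrier by blast
  have "a \<otimes> x = x \<otimes> (inv x \<otimes> a \<otimes> x)" using ac x by (simp add: m_assoc[symmetric])
  then have "height (a \<otimes> x) = height x + \<phi> (inv x \<otimes> a \<otimes> x)"
    using height_mult_A[OF x conj_A'[OF x a]] by metis
  then show ?thesis by (simp add: shift_def)
qed

lemma shift_depends_on_coordinates:
  assumes g: "g \<in> carrier G" and xy: "x \<in> carrier G" "y \<in> carrier G" "\<pi> x = \<pi> y"
  shows "shift g x = shift g y"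
proof -
  define c where "c = inv x \<otimes> y"
  have c: "c \<in> A" "c \<in> carrier G" using same_coordinates[OF xy] A_carrier by (auto simp: c_def)
  have y: "y = x \<otimes> c" using xy by (simp add: c_def m_assoc[symmetric])
  have "height (g \<otimes> y) = height (g \<otimes> x) + \<phi> c" "height y = height x + \<phi> c"
    unfolding y using height_mult_A c g xy by (simp_all add: m_assoc[symmetric])
  then show ?thesis by (simp add: shift_def)
qed

lemma shift_basis_zero:
  assumes j: "j < k" and x: "x \<in> carrier G" and z: "\<And>l. l < j \<Longrightarrow> \<pi> x l = 0"
  shows "shift (b j) x = 0"
proof -
  let ?n = "\<pi> x"
  have n: "\<And>l. k \<le> l \<Longrightarrow> ?n l = 0" using \<pi>_support x by blast
  have "shift (b j) x = shift (b j) (rep ?n)"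
    using x j b_closed \<pi>_rep_\<pi> by (intro shift_depends_on_coordinates) auto
  also have "\<dots> = height (rep (?n(j := ?n j + 1))) - height (rep ?n)"
    using rep_step[OF j, of ?n] z by (simp only: shift_def)
  also have "\<dots> = 0" using n j by (simp add: height_rep)
  finally show ?thesis .
qed

lemma tempered_mono_degree:
  assumes "tempered d F" "d \<le> d'" shows "tempered d' F"
proof -
  obtain C where C: "0 \<le> C" "\<And>x. x \<in> carrier G \<Longrightarrow> \<bar>F x\<bar> \<le> C * (1 + real (taxicab k (\<pi> x))) ^ d"
    using assms(1) by (auto simp: tempered_def)
  have "C * (1 + real m) ^ d \<le> C * (1 + real m) ^ d'" for m
    using C(1) assms(2) by (intro mult_left_mono power_increasing) auto
  then show ?thesis using C order_trans unfolding tempered_def by blast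
qed

text \<open>
For \<open>j < i\<close> the increment of the shift of \<open>b i\<close> from \<open>x\<close> to \<open>b j x\<close> is
\<open>height (b i b j x) - height (b j x) - height (b i x) + height x\<close>. Where the coordinates before \<open>j\<close>
vanish, the shift of \<open>b j\<close> is zero at \<open>x\<close> and at \<open>b i x\<close>, and what remains is the value of \<open>\<phi>\<close> on a
conjugate of the commutator of \<open>b i\<close> and \<open>b j\<close>. This is bounded by \<open>conj_tempered\<close>, and
\<open>walk_bound\<close> sums the increments.
\<close>

lemma shift_basis_tempered:
  assumes d: "\<forall>a\<in>A. tempered d (\<lambda>x. \<phi> (inv x \<otimes> a \<otimes> x))" and i: "i < k"
  shows "tempered (Suc d) (shift (b i))"
proof -
  have bi: "b i \<in> carrier G" using b_closed i .
  define c where "c j = inv (b j \<otimes> b i) \<otimes> (b i \<otimes> b j)" for j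
  have cA: "c j \<in> A" if "j < k" for j
    using that i b_closed by (auto simp: c_def \<pi>_mult add.commute intro!: same_coordinates)
  have "\<exists>C\<ge>0. \<forall>x\<in>carrier G. \<bar>\<phi> (inv x \<otimes> c j \<otimes> x)\<bar> \<le> C * (1 + real (taxicab k (\<pi> x))) ^ d" if "j < k" for j
    using d cA[OF that] by (simp add: tempered_def)
  then have "\<exists>C\<ge>0. \<forall>j<k. \<forall>x\<in>carrier G. \<bar>\<phi> (inv x \<otimes> c j \<otimes> x)\<bar> \<le> C * (1 + real (taxicab k (\<pi> x))) ^ d"
    by (rule common_bound) auto
  then obtain C where C: "0 \<le> C"
    "\<And>j x. j < k \<Longrightarrow> x \<in> carrier G \<Longrightarrow> \<bar>\<phi> (inv x \<otimes> c j \<otimes> x)\<bar> \<le> C * (1 + real (taxicab k (\<pi> x))) ^ d"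
    by blast
  define u where "u n = shift (b i) (rep n)" for n
  have start: "u n = 0" if "\<And>l. k \<le> l \<Longrightarrow> n l = 0" "\<And>l. l < i \<Longrightarrow> n l = 0" for n
    unfolding u_def using that i by (intro shift_basis_zero) (auto simp: \<pi>_rep)
  have step: "\<bar>u (n(j := n j + 1)) - u n\<bar> \<le> C * (1 + real (taxicab k n)) ^ d"
    if n: "\<And>l. k \<le> l \<Longrightarrow> n l = 0" and j: "j < i" and z: "\<And>l. l < j \<Longrightarrow> n l = 0" for n j
  proof -
    let ?x = "rep n"
    have jk: "j < k" using j i by simp
    have bj: "b j \<in> carrier G" using b_closed jk .
    have cj: "c j \<in> carrier G" using cA[OF jk] A_carrier by blast
    have \<pi>x: "\<pi> ?x = n" using n \<pi>_rep by blast
    have z1: "shift (b j) ?x = 0" using z jk by (intro shift_basis_zero) (auto simp: \<pi>x)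
    have z2: "shift (b j) (b i \<otimes> ?x) = 0"
      using z jk bi j i by (intro shift_basis_zero) (auto simp: \<pi>_mult \<pi>x \<pi>_b)
    \<comment> \<open>The commutator is moved to the right end, where \<open>height\<close> is additive.\<close>
    have "b i \<otimes> (b j \<otimes> ?x) = b j \<otimes> (b i \<otimes> ?x) \<otimes> (inv ?x \<otimes> c j \<otimes> ?x)"
    proof -
      have "b j \<otimes> (b i \<otimes> ?x) \<otimes> (inv ?x \<otimes> c j \<otimes> ?x) = (b j \<otimes> b i) \<otimes> ((?x \<otimes> inv ?x) \<otimes> (c j \<otimes> ?x))"
        using bi bj cj by (simp only: m_assoc m_closed inv_closed rep_closed)
      also have "\<dots> = ((b j \<otimes> b i) \<otimes> c j) \<otimes> ?x" using bi bj cj by (simp add: m_assoc)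
      also have "(b j \<otimes> b i) \<otimes> c j = b i \<otimes> b j"
        using bi bj unfolding c_def by (simp only: m_assoc[symmetric] m_closed inv_closed r_inv l_one)
      finally show ?thesis using bi bj by (simp add: m_assoc)
    qed
    then have "height (b i \<otimes> (b j \<otimes> ?x)) = height (b j \<otimes> (b i \<otimes> ?x)) + \<phi> (inv ?x \<otimes> c j \<otimes> ?x)"
      using height_mult_A[of "b j \<otimes> (b i \<otimes> ?x)"] bi bj conj_A'[OF rep_closed cA[OF jk]] by simp
    moreover have "u (n(j := n j + 1)) = shift (b i) (b j \<otimes> ?x)"
      using rep_step[OF jk, of n] z by (simp only: u_def)
    ultimately have "u (n(j := n j + 1)) - u n = \<phi> (inv ?x \<otimes> c j \<otimes> ?x)"
      using z1 z2 by (simp add: u_def shift_def)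
    then show ?thesis using C(2)[OF jk rep_closed, of n] \<pi>x by simp
  qed
  have bound: "\<bar>u n\<bar> \<le> real (taxicab k n) * (C * (1 + real (taxicab k n)) ^ d)" if "\<And>l. k \<le> l \<Longrightarrow> n l = 0" for n
  proof (rule walk_bound[where i = i and b = "\<lambda>m. C * (1 + real m) ^ d"])
    show "mono (\<lambda>m. C * (1 + real m) ^ d)" by (rule mono_poly_bound[OF C(1)])
    show "u n = 0" if "\<And>l. k \<le> l \<Longrightarrow> n l = 0" "\<And>l. l < i \<Longrightarrow> n l = 0" for n
      using that by (rule start)
    show "\<bar>u (n(j := n j + 1)) - u n\<bar> \<le> C * (1 + real (taxicab k n)) ^ d"
      if "\<And>l. k \<le> l \<Longrightarrow> n l = 0" "j < i" "\<And>l. l < j \<Longrightarrow> n l = 0" for n j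
      using that by (rule step)
  qed (use i C(1) that in auto)
  show ?thesis
    unfolding tempered_def
  proof (intro exI[of _ C] conjI ballI)
    fix x assume x: "x \<in> carrier G"
    let ?m = "real (taxicab k (\<pi> x))"
    have "\<bar>shift (b i) x\<bar> \<le> ?m * (C * (1 + ?m) ^ d)"
      using bound[of "\<pi> x"] \<pi>_support[OF x] shift_depends_on_coordinates[OF bi x rep_closed[of "\<pi> x"]]
        \<pi>_rep_\<pi>[OF x] by (simp add: u_def)
    also have "\<dots> \<le> (1 + ?m) * (C * (1 + ?m) ^ d)" using C(1) by (intro mult_right_mono) auto
    finally show "\<bar>shift (b i) x\<bar> \<le> C * (1 + ?m) ^ Suc d" by (simp add: algebra_simps)
  qed (use C in simp)
qed

lemma tempered_translate:
  assumes F: "tempered d F" and h: "h \<in> carrier G"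
  shows "tempered d (\<lambda>x. F (h \<otimes> x))"
proof -
  obtain C where C: "0 \<le> C" "\<And>x. x \<in> carrier G \<Longrightarrow> \<bar>F x\<bar> \<le> C * (1 + real (taxicab k (\<pi> x))) ^ d"
    using F by (auto simp: tempered_def)
  let ?p = "real (taxicab k (\<pi> h))"
  show ?thesis
    unfolding tempered_def
  proof (intro exI[of _ "C * (1 + ?p) ^ d"] conjI ballI)
    fix x assume x: "x \<in> carrier G"
    let ?m = "real (taxicab k (\<pi> x))"
    have "real (taxicab k (\<pi> (h \<otimes> x))) \<le> ?p + ?m"
      using taxicab_add_le[of k "\<pi> h" "\<pi> x"] h x by (simp add: \<pi>_mult)
    also have "1 + (?p + ?m) \<le> (1 + ?p) * (1 + ?m)" by (simp add: algebra_simps)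
    finally have "(1 + real (taxicab k (\<pi> (h \<otimes> x)))) ^ d \<le> ((1 + ?p) * (1 + ?m)) ^ d"
      by (intro power_mono) auto
    then have "C * (1 + real (taxicab k (\<pi> (h \<otimes> x)))) ^ d \<le> C * ((1 + ?p) * (1 + ?m)) ^ d"
      using C(1) by (intro mult_left_mono) auto
    then show "\<bar>F (h \<otimes> x)\<bar> \<le> C * (1 + ?p) ^ d * (1 + ?m) ^ d"
      using C(2)[of "h \<otimes> x"] h x by (simp add: power_mult_distrib mult.assoc)
  qed (use C in simp)
qed

lemma tempered_add:
  assumes "tempered d F" "tempered d F'" shows "tempered d (\<lambda>x. F x + F' x)"
proof -
  obtain C where C: "0 \<le> C" "\<And>x. x \<in> carrier G \<Longrightarrow> \<bar>F x\<bar> \<le> C * (1 + real (taxicab k (\<pi> x))) ^ d"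
    using assms(1) by (auto simp: tempered_def)
  obtain D where D: "0 \<le> D" "\<And>x. x \<in> carrier G \<Longrightarrow> \<bar>F' x\<bar> \<le> D * (1 + real (taxicab k (\<pi> x))) ^ d"
    using assms(2) by (auto simp: tempered_def)
  show ?thesis
    unfolding tempered_def using C D
    by (intro exI[of _ "C + D"]) (auto simp: distrib_right intro!: order_trans[OF abs_triangle_ineq add_mono])
qed

lemma tempered_cong: "(\<And>x. x \<in> carrier G \<Longrightarrow> F x = F' x) \<Longrightarrow> tempered d F \<longleftrightarrow> tempered d F'"
  by (simp add: tempered_def)

lemma tempered_minus: "tempered d F \<Longrightarrow> tempered d (\<lambda>x. - F x)"
  by (simp add: tempered_def)

text \<open>
By the cocycle identity the elements whose shift has at most a given polynomial growth form a
subgroup; it contains \<open>A\<close> and all \<open>b i\<close>, hence all normal forms.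
\<close>

theorem shift_tempered: "\<exists>d. \<forall>g\<in>carrier G. tempered d (shift g)"
proof -
  obtain d where d: "\<forall>a\<in>A. tempered d (\<lambda>x. \<phi> (inv x \<otimes> a \<otimes> x))" using conj_tempered by blast
  define T where "T = {g \<in> carrier G. tempered (Suc d) (shift g)}"
  have T: "subgroup T G"
  proof (rule subgroupI)
    show "T \<subseteq> carrier G" by (auto simp: T_def)
    have "tempered (Suc d) (shift \<one>)"
      unfolding tempered_def by (intro exI[of _ 0]) (auto simp: shift_def)
    then show "T \<noteq> {}" by (auto simp: T_def)
  next
    fix g assume g: "g \<in> T"
    then have gc: "g \<in> carrier G" by (simp add: T_def)
    have "tempered (Suc d) (\<lambda>x. - shift g (inv g \<otimes> x))"
      using g by (intro tempered_minus tempered_translate) (auto simp: T_def)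
    moreover have "- shift g (inv g \<otimes> x) = shift (inv g) x" if "x \<in> carrier G" for x
      using gc that by (simp add: shift_def m_assoc[symmetric])
    ultimately have "tempered (Suc d) (shift (inv g))"
      using tempered_cong[of "\<lambda>x. - shift g (inv g \<otimes> x)" "shift (inv g)"] by blast
    then show "inv g \<in> T" using gc by (simp add: T_def)
  next
    fix g h assume gh: "g \<in> T" "h \<in> T"
    then have c: "g \<in> carrier G" "h \<in> carrier G" by (auto simp: T_def)
    have "tempered (Suc d) (\<lambda>x. shift g (h \<otimes> x) + shift h x)"
      using gh by (intro tempered_add tempered_translate) (auto simp: T_def)
    then have "tempered (Suc d) (shift (g \<otimes> h))"
      using tempered_cong[of "shift (g \<otimes> h)" "\<lambda>x. shift g (h \<otimes> x) + shift h x"] shift_mult[OF c] by simp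
    then show "g \<otimes> h \<in> T" using c by (simp add: T_def)
  qed
  have AT: "a \<in> T" if "a \<in> A" for a
    using d that A_carrier tempered_cong[of "shift a" "\<lambda>x. \<phi> (inv x \<otimes> a \<otimes> x)" "Suc d"] shift_A
      tempered_mono_degree[of d _ "Suc d"] by (simp add: T_def)
  have bT: "b i \<in> T" if "i < k" for i
    using shift_basis_tempered[OF d that] b_closed[OF that] by (simp add: T_def)
  have rep_fromT: "rep_from is n \<in> T" if "set is \<subseteq> {..<k}" for "is" n
    using that
  proof (induction "is")
    case Nil
    then show ?case using subgroup.one_closed[OF T] by (simp add: rep_from_def)
  next
    case (Cons i "is")
    then have "b i [^] n i \<in> T" "rep_from is n \<in> T" using subgroup_int_pow_closed[OF T] bT by auto
    then show ?case using subgroup.m_closed[OF T] by (simp add: rep_from_def)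
  qed
  have repT: "rep n \<in> T" for n unfolding rep_def by (rule rep_fromT) auto
  have "g \<in> T" if g: "g \<in> carrier G" for g
  proof -
    have "g = rep (\<pi> g) \<otimes> (inv (rep (\<pi> g)) \<otimes> g)" using g by (simp add: m_assoc[symmetric])
    then show ?thesis using subgroup.m_closed[OF T repT AT[OF rep_diff_A[OF g]]] by metis
  qed
  then show ?thesis by (auto simp: T_def)
qed

end

section \<open>Gluing maps along a family of consecutive intervals\<close>

lemma has_sum_diff_real:
  fixes f g :: "'i \<Rightarrow> real"
  assumes "(f has_sum a) S" "(g has_sum b) S"
  shows "((\<lambda>i. f i - g i) has_sum (a - b)) S"
  using has_sum_add[OF assms(1), of "\<lambda>i. - g i" "- b"] assms(2) by (simp add: has_sum_uminus)

text \<open>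
A family of intervals of total length \<open>1\<close> with a linear order, not necessarily a well-order. The interval
with index \<open>i\<close> starts at the total length of its predecessors.
\<close>

locale ordered_intervals =
  fixes \<Omega> :: "'i set" and lt :: "'i \<Rightarrow> 'i \<Rightarrow> bool" and len :: "'i \<Rightarrow> real"
  assumes len_pos: "i \<in> \<Omega> \<Longrightarrow> 0 < len i"
    and total_len: "(len has_sum 1) \<Omega>"
    and lt_irrefl: "i \<in> \<Omega> \<Longrightarrow> \<not> lt i i"
    and lt_trans: "\<lbrakk>i \<in> \<Omega>; j \<in> \<Omega>; l \<in> \<Omega>; lt i j; lt j l\<rbrakk> \<Longrightarrow> lt i l"
    and lt_total: "\<lbrakk>i \<in> \<Omega>; j \<in> \<Omega>; i \<noteq> j\<rbrakk> \<Longrightarrow> lt i j \<or> lt j i"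
begin

definition left :: "'i \<Rightarrow> real" where
  "left i = infsum len {j \<in> \<Omega>. lt j i}"

text \<open>
The length of the part of the \<open>i\<close>-th interval that lies to the left of \<open>x\<close>.
\<close>

definition clip :: "'i \<Rightarrow> real \<Rightarrow> real" where
  "clip i x = max 0 (min (len i) (x - left i))"

lemma len_summable: "S \<subseteq> \<Omega> \<Longrightarrow> len summable_on S"
  using total_len has_sum_imp_summable summable_on_subset_banach by blast

lemma len_nonneg: "i \<in> \<Omega> \<Longrightarrow> 0 \<le> len i"
  using len_pos less_imp_le by blast

lemma lt_asym: "\<lbrakk>i \<in> \<Omega>; j \<in> \<Omega>; lt i j\<rbrakk> \<Longrightarrow> \<not> lt j i"
  using lt_irrefl lt_trans by blast

lemma infsum_len_mono: "S \<subseteq> T \<Longrightarrow> T \<subseteq> \<Omega> \<Longrightarrow> infsum len S \<le> infsum len T"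
  by (rule infsum_mono2) (auto intro!: len_summable len_nonneg)

lemma infsum_len_le_1: "S \<subseteq> \<Omega> \<Longrightarrow> infsum len S \<le> 1"
  using infsum_len_mono[of S \<Omega>] total_len infsumI by fastforce

lemma left_nonneg: "0 \<le> left i"
  unfolding left_def by (rule infsum_nonneg) (auto intro: len_nonneg)

lemma left_add_len: "i \<in> \<Omega> \<Longrightarrow> left i + len i = infsum len (insert i {j \<in> \<Omega>. lt j i})"
  unfolding left_def by (subst infsum_insert) (auto simp: lt_irrefl intro!: len_summable)

lemma right_le_left:
  assumes "i \<in> \<Omega>" "j \<in> \<Omega>" "lt i j"
  shows "left i + len i \<le> left j"
  unfolding left_add_len[OF assms(1)] left_def[of j]
proof (rule infsum_len_mono)
  show "insert i {j \<in> \<Omega>. lt j i} \<subseteq> {i \<in> \<Omega>. lt i j}"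
    using assms lt_trans[OF _ assms(1,2) _ assms(3)] by blast
qed auto

lemma right_le_1: "i \<in> \<Omega> \<Longrightarrow> left i + len i \<le> 1"
  by (simp add: left_add_len infsum_len_le_1)

lemma infsum_len_above:
  assumes "i \<in> \<Omega>"
  shows "infsum len {j \<in> \<Omega>. lt i j} = 1 - (left i + len i)"
proof -
  have "\<Omega> = insert i {j \<in> \<Omega>. lt j i} \<union> {j \<in> \<Omega>. lt i j}"
    using assms lt_total by auto
  moreover have "insert i {j \<in> \<Omega>. lt j i} \<inter> {j \<in> \<Omega>. lt i j} = {}"
    using assms lt_irrefl lt_asym by blast
  ultimately have "infsum len \<Omega> = infsum len (insert i {j \<in> \<Omega>. lt j i}) + infsum len {j \<in> \<Omega>. lt i j}"
    using assms infsum_Un_disjoint[of len "insert i {j \<in> \<Omega>. lt j i}" "{j \<in> \<Omega>. lt i j}"] len_summable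
    by auto
  then show ?thesis
    using left_add_len[OF assms] infsumI[OF total_len] by simp
qed

lemma left_inject: "i \<in> \<Omega> \<Longrightarrow> j \<in> \<Omega> \<Longrightarrow> left i = left j \<Longrightarrow> i = j"
  using right_le_left len_pos lt_total by (metis add_le_same_cancel1 not_le)

lemma clip_bounds: "i \<in> \<Omega> \<Longrightarrow> 0 \<le> clip i x \<and> clip i x \<le> len i"
  using len_pos[of i] by (auto simp: clip_def)

lemma clip_mono: "x \<le> y \<Longrightarrow> clip i x \<le> clip i y"
  by (auto simp: clip_def)

text \<open>
Among the finitely many intervals that start before \<open>x\<close>, the last one contributes at most
\<open>x - left i\<close>, and the others are predecessors of it with total length at most \<open>left i\<close>.
\<close>

lemma sum_clip_le:
  assumes F: "finite F" "F \<subseteq> \<Omega>" and x: "0 \<le> x"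
  shows "(\<Sum>i\<in>F. clip i x) \<le> x"
proof -
  define F' where "F' = {i \<in> F. left i < x}"
  have F': "finite F'" "F' \<subseteq> \<Omega>" using F by (auto simp: F'_def)
  have eq: "(\<Sum>i\<in>F. clip i x) = (\<Sum>i\<in>F'. clip i x)"
    using F len_pos by (intro sum.mono_neutral_right) (fastforce simp: F'_def clip_def)+
  show ?thesis
  proof (cases "F' = {}")
    case False
    then have "Max (left ` F') \<in> left ` F'" using F'(1) by (intro Max_in) auto
    then obtain i where i: "i \<in> F'" "Max (left ` F') = left i" by blast
    have imax: "left j \<le> left i" if "j \<in> F'" for j
      using Max_ge[of "left ` F'" "left j"] that F'(1) i(2) by simp
    have below: "F' - {i} \<subseteq> {j \<in> \<Omega>. lt j i}"
    proof
      fix j assume j: "j \<in> F' - {i}"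
      have mem: "i \<in> \<Omega>" "j \<in> \<Omega>" "i \<noteq> j" "j \<in> F'" using i(1) j F' by auto
      have "\<not> lt i j"
        using right_le_left[OF mem(1,2)] len_pos[OF mem(1)] imax[OF mem(4)] by linarith
      then show "j \<in> {j \<in> \<Omega>. lt j i}" using lt_total[OF mem(1-3)] mem(2) by simp
    qed
    have "(\<Sum>j\<in>F' - {i}. clip j x) \<le> (\<Sum>j\<in>F' - {i}. len j)"
      using F' clip_bounds by (intro sum_mono) auto
    also have "\<dots> \<le> left i"
      unfolding left_def using F' below
      by (intro finite_sum_le_infsum len_summable) (auto intro: len_nonneg)
    finally have "(\<Sum>j\<in>F' - {i}. clip j x) \<le> left i" .
    moreover have "clip i x \<le> x - left i"
      using i(1) by (auto simp: clip_def F'_def)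
    ultimately show ?thesis
      using eq i(1) F' by (simp add: sum.remove)
  qed (use eq x in simp)
qed

lemma sum_coclip_le:
  assumes F: "finite F" "F \<subseteq> \<Omega>" and x: "x \<le> 1"
  shows "(\<Sum>i\<in>F. len i - clip i x) \<le> 1 - x"
proof -
  define F' where "F' = {i \<in> F. x < left i + len i}"
  have F': "finite F'" "F' \<subseteq> \<Omega>" using F by (auto simp: F'_def)
  have eq: "(\<Sum>i\<in>F. len i - clip i x) = (\<Sum>i\<in>F'. len i - clip i x)"
    using F len_pos by (intro sum.mono_neutral_right) (fastforce simp: F'_def clip_def)+
  show ?thesis
  proof (cases "F' = {}")
    case False
    then have "Min (left ` F') \<in> left ` F'" using F'(1) by (intro Min_in) auto
    then obtain i where i: "i \<in> F'" "Min (left ` F') = left i" by blast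
    have imin: "left i \<le> left j" if "j \<in> F'" for j
      using Min_le[of "left ` F'" "left j"] that F'(1) i(2) by simp
    have above: "F' - {i} \<subseteq> {j \<in> \<Omega>. lt i j}"
    proof
      fix j assume j: "j \<in> F' - {i}"
      have mem: "i \<in> \<Omega>" "j \<in> \<Omega>" "i \<noteq> j" "j \<in> F'" using i(1) j F' by auto
      have "\<not> lt j i"
        using right_le_left[OF mem(2,1)] len_pos[OF mem(2)] imin[OF mem(4)] by linarith
      then show "j \<in> {j \<in> \<Omega>. lt i j}" using lt_total[OF mem(1-3)] mem(2) by simp
    qed
    have "(\<Sum>j\<in>F' - {i}. len j - clip j x) \<le> (\<Sum>j\<in>F' - {i}. len j)"
      using F' clip_bounds by (intro sum_mono) auto
    also have "\<dots> \<le> infsum len {j \<in> \<Omega>. lt i j}"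
      using F' above
      by (intro finite_sum_le_infsum len_summable) (auto intro: len_nonneg)
    also have "\<dots> = 1 - (left i + len i)" using i F' by (intro infsum_len_above) auto
    finally have "(\<Sum>j\<in>F' - {i}. len j - clip j x) \<le> 1 - (left i + len i)" .
    moreover have "len i - clip i x \<le> left i + len i - x"
      using i(1) by (auto simp: clip_def F'_def)
    ultimately show ?thesis
      using eq i(1) F' by (simp add: sum.remove)
  qed (use eq x in simp)
qed

lemma clip_summable: "(\<lambda>i. clip i x) summable_on \<Omega>"
  by (rule summable_on_comparison_test[OF len_summable[OF order_refl]]) (auto simp: clip_bounds)

text \<open>
The intervals fill \<open>[0, 1]\<close> up to a null set: the parts to the left of \<open>x\<close> have total length at most
\<open>x\<close>, those to the right at most \<open>1 - x\<close>, and together they have length \<open>1\<close>. This replaces any use of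
measure theory.
\<close>

lemma clip_has_sum:
  assumes x: "0 \<le> x" "x \<le> 1"
  shows "((\<lambda>i. clip i x) has_sum x) \<Omega>"
proof -
  have le: "infsum (\<lambda>i. clip i x) \<Omega> \<le> x"
    using sum_clip_le x by (intro infsum_le_finite_sums clip_summable) auto
  have s: "((\<lambda>i. len i - clip i x) has_sum (1 - infsum (\<lambda>i. clip i x) \<Omega>)) \<Omega>"
    by (intro has_sum_diff_real total_len has_sum_infsum clip_summable)
  have "1 - infsum (\<lambda>i. clip i x) \<Omega> \<le> 1 - x"
    using sum_coclip_le x by (intro has_sum_le_finite_sums[OF s]) auto
  then have "infsum (\<lambda>i. clip i x) \<Omega> = x" using le by linarith
  then show ?thesis using clip_summable has_sum_infsum by metis
qed

text \<open>
The image of \<open>x\<close> is the total length of the images of the parts to the left of \<open>x\<close>. This formula is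
defined and monotone on the closure of the union of the intervals as well, where a piecewise
definition would need limits.
\<close>

definition glue :: "('i \<Rightarrow> real \<Rightarrow> real) \<Rightarrow> real \<Rightarrow> real" where
  "glue h x = infsum (\<lambda>i. h i (clip i x)) \<Omega>"

definition piecewise_map :: "('i \<Rightarrow> 'i) \<Rightarrow> ('i \<Rightarrow> real \<Rightarrow> real) \<Rightarrow> bool" where
  "piecewise_map \<sigma> h \<longleftrightarrow> bij_betw \<sigma> \<Omega> \<Omega> \<and> (\<forall>i\<in>\<Omega>. \<forall>j\<in>\<Omega>. lt i j \<longrightarrow> lt (\<sigma> i) (\<sigma> j)) \<and>
     (\<forall>i\<in>\<Omega>. h i 0 = 0 \<and> h i (len i) = len (\<sigma> i) \<and> strict_mono_on {0..len i} (h i))"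

context
  fixes \<sigma> h assumes pm: "piecewise_map \<sigma> h"
begin

lemma shift_bij: "bij_betw \<sigma> \<Omega> \<Omega>"
  and shift_mono: "\<lbrakk>i \<in> \<Omega>; j \<in> \<Omega>; lt i j\<rbrakk> \<Longrightarrow> lt (\<sigma> i) (\<sigma> j)"
  and piece_0: "i \<in> \<Omega> \<Longrightarrow> h i 0 = 0"
  and piece_len: "i \<in> \<Omega> \<Longrightarrow> h i (len i) = len (\<sigma> i)"
  and piece_strict_mono: "i \<in> \<Omega> \<Longrightarrow> strict_mono_on {0..len i} (h i)"
  using pm by (auto simp: piecewise_map_def)

lemma shift_in: "i \<in> \<Omega> \<Longrightarrow> \<sigma> i \<in> \<Omega>"
  using shift_bij bij_betwE by blast

lemma shift_lt_iff: "\<lbrakk>i \<in> \<Omega>; j \<in> \<Omega>\<rbrakk> \<Longrightarrow> lt (\<sigma> i) (\<sigma> j) \<longleftrightarrow> lt i j"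
  using shift_mono shift_in lt_asym lt_total lt_irrefl by metis

lemma piece_mono: "\<lbrakk>i \<in> \<Omega>; 0 \<le> u; u \<le> v; v \<le> len i\<rbrakk> \<Longrightarrow> h i u \<le> h i v"
  using strict_mono_on_leD[OF piece_strict_mono, of i u v] by simp

lemma piece_bounds:
  assumes "i \<in> \<Omega>" "0 \<le> u" "u \<le> len i" shows "0 \<le> h i u \<and> h i u \<le> len (\<sigma> i)"
  using piece_mono[of i 0 u] piece_mono[of i u "len i"] assms by (simp add: piece_0 piece_len)

lemma image_len_summable: "(\<lambda>i. len (\<sigma> i)) summable_on \<Omega>"
  using summable_on_reindex_bij_betw[OF shift_bij, of len] len_summable by blast

lemma glue_summable: "(\<lambda>i. h i (clip i x)) summable_on \<Omega>"
  by (rule summable_on_comparison_test[OF image_len_summable])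
    (auto simp: clip_bounds piece_bounds)

lemma glue_has_sum: "((\<lambda>i. h i (clip i x)) has_sum glue h x) \<Omega>"
  unfolding glue_def using glue_summable by simp

lemma glue_mono: "x \<le> y \<Longrightarrow> glue h x \<le> glue h y"
  unfolding glue_def
  by (intro infsum_mono glue_summable piece_mono) (auto simp: clip_bounds clip_mono)

lemma glue_at:
  assumes i: "i \<in> \<Omega>" and u: "0 \<le> u" "u \<le> len i"
  shows "glue h (left i + u) = left (\<sigma> i) + h i u"
proof -
  let ?B = "{j \<in> \<Omega>. lt j i}"
  have below: "clip j (left i + u) = len j" if "j \<in> ?B" for j
    using right_le_left[of j i] that i u len_pos[of j] by (auto simp: clip_def)
  have above: "clip j (left i + u) = 0" if "j \<in> \<Omega>" "j \<noteq> i" "\<not> lt j i" for j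
    using right_le_left[of i j] that i u lt_total[of i j] by (auto simp: clip_def)
  have at: "clip i (left i + u) = u" using u by (auto simp: clip_def)
  have bij: "bij_betw \<sigma> ?B {j \<in> \<Omega>. lt j (\<sigma> i)}"
    unfolding bij_betw_def
  proof
    show "inj_on \<sigma> ?B" using shift_bij by (auto simp: bij_betw_def inj_on_def)
    show "\<sigma> ` ?B = {j \<in> \<Omega>. lt j (\<sigma> i)}"
    proof
      show "\<sigma> ` ?B \<subseteq> {j \<in> \<Omega>. lt j (\<sigma> i)}" using i shift_in shift_mono by auto
      show "{j \<in> \<Omega>. lt j (\<sigma> i)} \<subseteq> \<sigma> ` ?B"
      proof
        fix j assume j: "j \<in> {j \<in> \<Omega>. lt j (\<sigma> i)}"
        then obtain j' where "j' \<in> \<Omega>" "j = \<sigma> j'" using shift_bij by (auto simp: bij_betw_def)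
        then show "j \<in> \<sigma> ` ?B" using j i shift_lt_iff by auto
      qed
    qed
  qed
  have "glue h (left i + u) = infsum (\<lambda>j. h j (clip j (left i + u))) (insert i ?B)"
    unfolding glue_def using i above by (intro infsum_cong_neutral) (auto simp: piece_0)
  also have "\<dots> = h i u + infsum (\<lambda>j. h j (clip j (left i + u))) ?B"
    using i lt_irrefl at
    by (subst infsum_insert) (auto intro: summable_on_subset_banach[OF glue_summable])
  also have "infsum (\<lambda>j. h j (clip j (left i + u))) ?B = infsum (\<lambda>j. len (\<sigma> j)) ?B"
    by (intro infsum_cong) (simp add: below piece_len)
  also have "\<dots> = left (\<sigma> i)"
    unfolding left_def using infsum_reindex_bij_betw[OF bij, of len] by simp
  finally show ?thesis by simp
qed

text \<open>
The glued map sends the \<open>i\<close>-th interval to the one with index \<open>\<sigma> i\<close> by \<open>h i\<close>. In this form the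
property composes (\<open>glue_comp\<close>).
\<close>

lemma clip_glue:
  assumes i: "i \<in> \<Omega>"
  shows "clip (\<sigma> i) (glue h x) = h i (clip i x)"
proof -
  consider "x \<le> left i" | "left i + len i \<le> x" | "left i \<le> x" "x \<le> left i + len i" by linarith
  then show ?thesis
  proof cases
    case 1
    have "glue h x \<le> left (\<sigma> i)"
      using glue_mono[OF 1] glue_at[of i 0] i len_pos[of i] by (simp add: piece_0)
    then show ?thesis using 1 i len_pos[OF shift_in[OF i]] len_pos[OF i] by (auto simp: clip_def piece_0)
  next
    case 2
    have "glue h x \<ge> left (\<sigma> i) + len (\<sigma> i)"
      using glue_mono[OF 2] glue_at[of i "len i"] i len_pos[of i] by (simp add: piece_len)
    moreover have "clip i x = len i" using 2 i len_pos[OF i] by (auto simp: clip_def)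
    ultimately show ?thesis using i len_pos[OF shift_in[OF i]] by (auto simp: clip_def piece_len)
  next
    case 3
    have "glue h x = left (\<sigma> i) + h i (x - left i)" using glue_at[of i "x - left i"] i 3 by simp
    moreover have "clip i x = x - left i" using 3 by (auto simp: clip_def)
    ultimately show ?thesis using piece_bounds[of i "x - left i"] i 3 by (auto simp: clip_def)
  qed
qed

lemma glue_0: "glue h 0 = 0"
proof -
  have "clip i 0 = 0" if "i \<in> \<Omega>" for i
    using left_nonneg[of i] len_pos[OF that] by (auto simp: clip_def)
  then show ?thesis unfolding glue_def by (intro infsum_0) (auto simp: piece_0)
qed

lemma glue_1: "glue h 1 = 1"
proof -
  have "clip i 1 = len i" if "i \<in> \<Omega>" for i
    using right_le_1[OF that] len_pos[OF that] by (auto simp: clip_def)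
  then have "glue h 1 = infsum (\<lambda>i. len (\<sigma> i)) \<Omega>"
    unfolding glue_def by (intro infsum_cong) (auto simp: piece_len)
  also have "\<dots> = 1" using infsum_reindex_bij_betw[OF shift_bij, of len] infsumI[OF total_len] by simp
  finally show ?thesis .
qed

lemma glue_in_unit: "x \<in> {0..1} \<Longrightarrow> glue h x \<in> {0..1}"
  using glue_mono[of 0 x] glue_mono[of x 1] by (simp add: glue_0 glue_1)

end

lemma glue_comp:
  assumes pm: "piecewise_map \<sigma> h" and pm': "piecewise_map \<sigma>' h'"
    and comp: "\<And>i u. \<lbrakk>i \<in> \<Omega>; 0 \<le> u; u \<le> len i\<rbrakk> \<Longrightarrow> h'' i u = h' (\<sigma> i) (h i u)"
  shows "glue h'' x = glue h' (glue h x)"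
proof -
  have "glue h' (glue h x) = infsum (\<lambda>i. h' (\<sigma> i) (clip (\<sigma> i) (glue h x))) \<Omega>"
    unfolding glue_def[of h']
    using infsum_reindex_bij_betw[OF shift_bij[OF pm], of "\<lambda>i. h' i (clip i (glue h x))"] by simp
  also have "\<dots> = infsum (\<lambda>i. h'' i (clip i x)) \<Omega>"
    by (intro infsum_cong) (simp add: clip_glue[OF pm] comp clip_bounds)
  finally show ?thesis by (simp add: glue_def)
qed

lemma glue_id:
  assumes "\<And>i u. \<lbrakk>i \<in> \<Omega>; 0 \<le> u; u \<le> len i\<rbrakk> \<Longrightarrow> h i u = u" and "x \<in> {0..1}"
  shows "glue h x = x"
proof -
  have "glue h x = infsum (\<lambda>i. clip i x) \<Omega>"
    unfolding glue_def by (intro infsum_cong) (simp add: assms clip_bounds)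
  also have "\<dots> = x" using clip_has_sum assms by (intro infsumI) auto
  finally show ?thesis .
qed

text \<open>
The mean value property stands in for differentiability: it is what \<open>glue_increment\<close> sums up, and it
avoids one-sided derivatives at the end points of the pieces, where \<open>d i\<close> is normalized to \<open>1\<close>.
\<close>

definition piecewise_derivative ::
    "('i \<Rightarrow> real \<Rightarrow> real) \<Rightarrow> ('i \<Rightarrow> real \<Rightarrow> real) \<Rightarrow> real \<Rightarrow> real \<Rightarrow> bool" where
  "piecewise_derivative h d C \<alpha> \<longleftrightarrow>
     (\<forall>i\<in>\<Omega>. d i 0 = 1 \<and> d i (len i) = 1 \<and>
       (\<forall>u v. 0 \<le> u \<longrightarrow> u < v \<longrightarrow> v \<le> len i \<longrightarrow>
          (\<exists>z. u < z \<and> z < v \<and> h i v - h i u = d i z * (v - u))) \<and>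
       (\<forall>u\<in>{0..len i}. \<forall>v\<in>{0..len i}. \<bar>d i u - d i v\<bar> \<le> C * \<bar>u - v\<bar> powr \<alpha>))"

definition glue_deriv :: "('i \<Rightarrow> real \<Rightarrow> real) \<Rightarrow> real \<Rightarrow> real" where
  "glue_deriv d x = (if \<exists>i\<in>\<Omega>. left i < x \<and> x < left i + len i
     then let i = (THE i. i \<in> \<Omega> \<and> left i < x \<and> x < left i + len i) in d i (x - left i) else 1)"

lemma interval_unique:
  assumes "i \<in> \<Omega>" "j \<in> \<Omega>" "left i < x" "x < left i + len i" "left j < x" "x < left j + len j"
  shows "i = j"
  using assms right_le_left[of i j] right_le_left[of j i] lt_total[of i j] by fastforce

context
  fixes h d C \<alpha>
  assumes pd: "piecewise_derivative h d C \<alpha>" and C: "0 \<le> C" and \<alpha>: "0 < \<alpha>"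
begin

lemma d_ends: "i \<in> \<Omega> \<Longrightarrow> d i 0 = 1 \<and> d i (len i) = 1"
  and d_holder: "\<lbrakk>i \<in> \<Omega>; 0 \<le> u; u \<le> len i; 0 \<le> v; v \<le> len i\<rbrakk> \<Longrightarrow> \<bar>d i u - d i v\<bar> \<le> C * \<bar>u - v\<bar> powr \<alpha>"
  and d_mvt: "\<lbrakk>i \<in> \<Omega>; 0 \<le> u; u < v; v \<le> len i\<rbrakk> \<Longrightarrow> \<exists>z. u < z \<and> z < v \<and> h i v - h i u = d i z * (v - u)"
  using pd by (auto simp: piecewise_derivative_def)

lemma glue_deriv_in:
  assumes i: "i \<in> \<Omega>" and u: "0 \<le> u" "u \<le> len i"
  shows "glue_deriv d (left i + u) = d i u"
proof (cases "0 < u \<and> u < len i")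
  case True
  then have "(THE j. j \<in> \<Omega> \<and> left j < left i + u \<and> left i + u < left j + len j) = i"
    using i interval_unique[of _ i "left i + u"] by (intro the_equality) auto
  then show ?thesis using i True by (auto simp: glue_deriv_def Let_def)
next
  case False
  have "\<not> (left j < left i + u \<and> left i + u < left j + len j)" if "j \<in> \<Omega>" for j
    using False u that i right_le_left[of i j] right_le_left[of j i] lt_total[of i j] len_pos[of i] len_pos[of j]
    by (cases "i = j") fastforce+
  then have "glue_deriv d (left i + u) = 1" by (auto simp: glue_deriv_def)
  then show ?thesis using False u d_ends[OF i] by (cases "u = 0") auto
qed

text \<open>
Two points in a common interval are compared within it. Otherwise there is an end point between
them on the side of each point that lies in an interval, and both values are compared with the
value \<open>1\<close> taken there; this costs the factor \<open>2\<close>.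
\<close>

lemma glue_deriv_holder_le:
  assumes xy: "x \<le> y"
  shows "\<bar>glue_deriv d x - glue_deriv d y\<bar> \<le> 2 * C * (y - x) powr \<alpha>"
proof -
  have mono: "C * u powr \<alpha> \<le> C * (y - x) powr \<alpha>" if "0 \<le> u" "u \<le> y - x" for u
    using that C \<alpha> by (intro mult_left_mono powr_mono2) auto
  have X: "glue_deriv d x = 1 \<or> (\<exists>i\<in>\<Omega>. left i < x \<and> x < left i + len i)"
    by (auto simp: glue_deriv_def)
  have Y: "glue_deriv d y = 1 \<or> (\<exists>i\<in>\<Omega>. left i < y \<and> y < left i + len i)"
    by (auto simp: glue_deriv_def)
  show ?thesis
  proof (cases "\<exists>i\<in>\<Omega>. left i \<le> x \<and> y \<le> left i + len i")
    case True
    then obtain i where i: "i \<in> \<Omega>" "left i \<le> x" "y \<le> left i + len i" by blast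
    have "\<bar>glue_deriv d x - glue_deriv d y\<bar> \<le> C * (y - x) powr \<alpha>"
      using glue_deriv_in[of i "x - left i"] glue_deriv_in[of i "y - left i"] i xy
        d_holder[of i "x - left i" "y - left i"] by simp
    moreover have "0 \<le> C * (y - x) powr \<alpha>" using C by simp
    ultimately show ?thesis by linarith
  next
    case False
    have "\<bar>glue_deriv d x - 1\<bar> \<le> C * (y - x) powr \<alpha>"
      using X
    proof
      assume "\<exists>i\<in>\<Omega>. left i < x \<and> x < left i + len i"
      then obtain i where i: "i \<in> \<Omega>" "left i < x" "x < left i + len i" by blast
      then have y: "left i + len i < y" using False by force
      have "\<bar>glue_deriv d x - 1\<bar> \<le> C * (left i + len i - x) powr \<alpha>"
        using glue_deriv_in[of i "x - left i"] i d_ends[OF i(1)]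
          d_holder[of i "x - left i" "len i"] by (simp add: algebra_simps abs_minus_commute)
      also have "\<dots> \<le> C * (y - x) powr \<alpha>" using i y by (intro mono) auto
      finally show ?thesis .
    qed (use C in simp)
    moreover have "\<bar>glue_deriv d y - 1\<bar> \<le> C * (y - x) powr \<alpha>"
      using Y
    proof
      assume "\<exists>i\<in>\<Omega>. left i < y \<and> y < left i + len i"
      then obtain i where i: "i \<in> \<Omega>" "left i < y" "y < left i + len i" by blast
      then have x: "x < left i" using False by force
      have "\<bar>glue_deriv d y - 1\<bar> \<le> C * (y - left i) powr \<alpha>"
        using glue_deriv_in[of i "y - left i"] i d_ends[OF i(1)]
          d_holder[of i "y - left i" 0] by simp
      also have "\<dots> \<le> C * (y - x) powr \<alpha>" using i x by (intro mono) auto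
      finally show ?thesis .
    qed (use C in simp)
    ultimately show ?thesis by linarith
  qed
qed

lemma glue_deriv_holder:
  "\<bar>glue_deriv d x - glue_deriv d y\<bar> \<le> 2 * C * \<bar>x - y\<bar> powr \<alpha>"
  using glue_deriv_holder_le[of x y] glue_deriv_holder_le[of y x]
  by (cases "x \<le> y") (simp_all add: abs_minus_commute)

lemma piece_increment:
  assumes i: "i \<in> \<Omega>" and xy: "x \<le> y" and w: "x \<le> w" "w \<le> y"
  shows "\<bar>h i (clip i y) - h i (clip i x) - glue_deriv d w * (clip i y - clip i x)\<bar>
           \<le> 2 * C * (y - x) powr \<alpha> * (clip i y - clip i x)"
proof (cases "clip i x < clip i y")
  case True
  obtain z where z: "clip i x < z" "z < clip i y"
      "h i (clip i y) - h i (clip i x) = d i z * (clip i y - clip i x)"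
    using d_mvt[OF i, of "clip i x" "clip i y"] clip_bounds[OF i] True by blast
  have z': "0 \<le> z" "z \<le> len i"
    using z clip_bounds[OF i, of x] clip_bounds[OF i, of y] by auto
  have "x \<le> left i + z" "left i + z \<le> y" using z z' by (auto simp: clip_def)
  then have "\<bar>left i + z - w\<bar> \<le> y - x" using w by linarith
  then have "2 * C * \<bar>left i + z - w\<bar> powr \<alpha> \<le> 2 * C * (y - x) powr \<alpha>"
    using C \<alpha> by (intro mult_left_mono powr_mono2) auto
  then have "\<bar>d i z - glue_deriv d w\<bar> \<le> 2 * C * (y - x) powr \<alpha>"
    using glue_deriv_holder[of "left i + z" w] glue_deriv_in[OF i z'] by simp
  moreover have "h i (clip i y) - h i (clip i x) - glue_deriv d w * (clip i y - clip i x)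
      = (d i z - glue_deriv d w) * (clip i y - clip i x)"
    using z(3) by (simp add: algebra_simps)
  ultimately show ?thesis using True by (simp add: abs_mult)
next
  case False
  then have "clip i x = clip i y" using clip_mono[OF xy, of i] by linarith
  then show ?thesis by simp
qed

text \<open>
The mean value theorem on every interval, summed up: the lengths of the parts of all intervals
between \<open>x\<close> and \<open>y\<close> add up to \<open>y - x\<close> by \<open>clip_has_sum\<close>.
\<close>

lemma glue_increment:
  assumes pm: "piecewise_map \<sigma> h" and xy: "0 \<le> x" "x \<le> y" "y \<le> 1" and w: "x \<le> w" "w \<le> y"
  shows "\<bar>glue h y - glue h x - glue_deriv d w * (y - x)\<bar> \<le> 2 * C * (y - x) powr \<alpha> * (y - x)"
proof -
  let ?t = "\<lambda>i. h i (clip i y) - h i (clip i x) - glue_deriv d w * (clip i y - clip i x)"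
  have c: "((\<lambda>i. clip i y - clip i x) has_sum (y - x)) \<Omega>"
    using xy by (intro has_sum_diff_real clip_has_sum) auto
  have t: "(?t has_sum (glue h y - glue h x - glue_deriv d w * (y - x))) \<Omega>"
    by (intro has_sum_diff_real has_sum_cmult_right c glue_has_sum[OF pm])
  have m: "((\<lambda>i. 2 * C * (y - x) powr \<alpha> * (clip i y - clip i x)) has_sum
              (2 * C * (y - x) powr \<alpha> * (y - x))) \<Omega>"
    by (intro has_sum_cmult_right c)
  have b: "\<bar>?t i\<bar> \<le> 2 * C * (y - x) powr \<alpha> * (clip i y - clip i x)" if "i \<in> \<Omega>" for i
    using piece_increment[OF that] xy w by blast
  have "glue h y - glue h x - glue_deriv d w * (y - x) \<le> 2 * C * (y - x) powr \<alpha> * (y - x)"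
    using b by (intro has_sum_mono[OF t m]) (auto simp: abs_le_iff)
  moreover have "((\<lambda>i. glue_deriv d w * (clip i y - clip i x) - (h i (clip i y) - h i (clip i x))) has_sum
      (glue_deriv d w * (y - x) - (glue h y - glue h x))) \<Omega>"
    by (intro has_sum_diff_real has_sum_cmult_right c glue_has_sum[OF pm])
  then have "glue_deriv d w * (y - x) - (glue h y - glue h x) \<le> 2 * C * (y - x) powr \<alpha> * (y - x)"
    using b by (intro has_sum_mono[OF _ m]) (auto simp: abs_le_iff)
  ultimately show ?thesis by linarith
qed

text \<open>
In \<open>glue_increment\<close> the error is of order \<open>1 + \<alpha>\<close> in \<open>y - x\<close>, hence negligible as \<open>\<alpha> > 0\<close>.
\<close>

lemma glue_has_derivative:
  assumes pm: "piecewise_map \<sigma> h" and x: "x \<in> {0..1}"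
  shows "(glue h has_real_derivative glue_deriv d x) (at x within {0..1})"
  unfolding has_field_derivative_iff
proof (rule LIM_zero_cancel, rule Lim_null_comparison)
  show "((\<lambda>y. 2 * C * \<bar>y - x\<bar> powr \<alpha>) \<longlongrightarrow> 0) (at x within {0..1})"
    using \<alpha> by (auto intro!: tendsto_eq_intros tendsto_powr2)
  show "\<forall>\<^sub>F y in at x within {0..1}.
      norm ((glue h y - glue h x) / (y - x) - glue_deriv d x) \<le> 2 * C * \<bar>y - x\<bar> powr \<alpha>"
    unfolding eventually_at_filter
  proof (rule always_eventually, intro allI impI)
    fix y assume y: "y \<noteq> x" "y \<in> {0..1}"
    have "\<bar>glue h y - glue h x - glue_deriv d x * (y - x)\<bar> \<le> 2 * C * \<bar>y - x\<bar> powr \<alpha> * \<bar>y - x\<bar>"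
    proof (cases "x \<le> y")
      case True
      then show ?thesis using glue_increment[OF pm, of x y x] x y by simp
    next
      case False
      then show ?thesis using glue_increment[OF pm, of y x x] x y
        by (simp add: abs_minus_commute algebra_simps)
    qed
    moreover have "(glue h y - glue h x) / (y - x) - glue_deriv d x
        = (glue h y - glue h x - glue_deriv d x * (y - x)) / (y - x)"
      using y by (simp add: field_simps)
    ultimately show "norm ((glue h y - glue h x) / (y - x) - glue_deriv d x) \<le> 2 * C * \<bar>y - x\<bar> powr \<alpha>"
      using y by (simp add: abs_divide divide_le_eq)
  qed
qed

end

end

section \<open>Translations in slowly varying charts of an interval\<close>

lemma mono_bounded_tendsto_at_top:
  fixes P :: "real \<Rightarrow> real"
  assumes "mono P" "\<And>t. P t \<le> b"
  shows "\<exists>l. (P \<longlongrightarrow> l) at_top"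
proof
  have bdd: "bdd_above (range P)" using assms(2) by (auto simp: bdd_above_def)
  show "(P \<longlongrightarrow> Sup (range P)) at_top"
  proof (rule order_tendstoI)
    fix a assume "a < Sup (range P)"
    then obtain t where "a < P t" using less_cSup_iff[OF _ bdd] by auto
    then show "\<forall>\<^sub>F x in at_top. a < P x"
      using assms(1) by (intro eventually_at_top_linorderI[of t]) (metis monoD order_less_le_trans)
  next
    fix a assume "Sup (range P) < a"
    then show "\<forall>\<^sub>F x in at_top. P x < a"
      using cSup_upper[OF _ bdd] by (intro always_eventually) (metis order_le_less_trans rangeI)
  qed
qed

lemma bell_pos: "0 < (1 + t\<^sup>2) powr a" for t :: real
proof -
  have "0 < 1 + t\<^sup>2" by (simp add: add_pos_nonneg)
  then show ?thesis by simp
qed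

text \<open>
For \<open>t \<ge> 1\<close> the integrand is at most \<open>t powr (- 2 * \<gamma>)\<close>, whose integral over \<open>[1, \<infinity>)\<close> converges
to the stated constant.
\<close>

lemma bell_antiderivative_bounded:
  fixes \<gamma> :: real
  assumes \<gamma>: "1 / 2 < \<gamma>"
    and P: "\<And>t. (P has_real_derivative (1 + t\<^sup>2) powr (- \<gamma>)) (at t)"
  shows "mono P" and "P t \<le> P 1 + 1 / (2 * \<gamma> - 1)"
proof -
  show m: "mono P"
  proof (rule monoI)
    fix s t :: real assume "s \<le> t"
    then show "P s \<le> P t" by (rule DERIV_nonneg_imp_nondecreasing) (use P in fastforce)
  qed
  show "P t \<le> P 1 + 1 / (2 * \<gamma> - 1)"
  proof (cases "t \<le> 1")
    case True
    have "0 < 1 / (2 * \<gamma> - 1)" using \<gamma> by simp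
    then show ?thesis using monoD[OF m True] by linarith
  next
    case False
    define R where "R = (\<lambda>t. P t + t powr (1 - 2 * \<gamma>) / (2 * \<gamma> - 1))"
    have "R t \<le> R 1"
    proof (rule DERIV_nonpos_imp_nonincreasing[where a = 1 and b = t and f = R])
      fix s :: real assume s: "1 \<le> s" "s \<le> t"
      have "(R has_real_derivative (1 + s\<^sup>2) powr (- \<gamma>) - s powr (- 2 * \<gamma>)) (at s)"
        unfolding R_def using s \<gamma> P
        by (auto intro!: derivative_eq_intros simp: divide_simps) (auto simp: algebra_simps)
      moreover have "(1 + s\<^sup>2) powr (- \<gamma>) \<le> s powr (- 2 * \<gamma>)"
      proof -
        have "(1 + s\<^sup>2) powr (- \<gamma>) \<le> (s\<^sup>2) powr (- \<gamma>)"
          using s \<gamma> by (intro powr_mono2') auto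
        also have "\<dots> = s powr (- 2 * \<gamma>)"
          using s by (simp add: powr_powr flip: powr_numeral)
        finally show ?thesis .
      qed
      ultimately show "\<exists>y. DERIV R s :> y \<and> y \<le> 0" by (metis diff_le_0_iff_le)
    qed (use False in simp)
    moreover have "0 \<le> t powr (1 - 2 * \<gamma>) / (2 * \<gamma> - 1)" using \<gamma> by simp
    ultimately show ?thesis by (simp add: R_def)
  qed
qed

text \<open>
\<open>\<Xi>\<close> is the distribution function of the density proportional to \<open>(1 + t\<^sup>2) powr (- \<gamma>)\<close>: an
increasing bijection from the reals to \<open>(0, 1)\<close>.
\<close>

locale bell_profile =
  fixes \<gamma> \<kappa> :: real and \<Xi> :: "real \<Rightarrow> real"
  assumes exponent: "1 / 2 < \<gamma>" "\<gamma> < 1" and height: "0 < \<kappa>"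
    and profile_deriv: "\<And>t. (\<Xi> has_real_derivative \<kappa> * (1 + t\<^sup>2) powr (- \<gamma>)) (at t)"
    and profile_bot: "(\<Xi> \<longlongrightarrow> 0) at_bot" and profile_top: "(\<Xi> \<longlongrightarrow> 1) at_top"

lemma bell_profile_exists:
  assumes \<gamma>: "1 / 2 < \<gamma>" "\<gamma> < 1"
  shows "\<exists>\<kappa> \<Xi>. bell_profile \<gamma> \<kappa> \<Xi>"
proof -
  have "\<exists>F. \<forall>t::real. - \<infinity> < ereal t \<longrightarrow> ereal t < \<infinity> \<longrightarrow>
      (F has_vector_derivative (1 + t\<^sup>2) powr (- \<gamma>)) (at t)"
    by (rule einterval_antiderivative) (auto intro!: continuous_intros simp: add_nonneg_eq_0_iff)
  then obtain P where P: "\<And>t::real. (P has_real_derivative (1 + t\<^sup>2) powr (- \<gamma>)) (at t)"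
    by (auto simp: has_real_derivative_iff_has_vector_derivative)
  \<comment> \<open>The reflected antiderivative turns the limit at \<open>- \<infinity>\<close> into one at \<open>\<infinity>\<close>.\<close>
  define Q where "Q = (\<lambda>t. - P (- t))"
  have Q: "(Q has_real_derivative (1 + t\<^sup>2) powr (- \<gamma>)) (at t)" for t
    unfolding Q_def using DERIV_minus[OF DERIV_mirror[THEN iffD1, OF P[of "-t"]]] by simp
  obtain hi where hi: "(P \<longlongrightarrow> hi) at_top"
    using mono_bounded_tendsto_at_top bell_antiderivative_bounded[OF \<gamma>(1) P] by metis
  obtain lo' where lo': "(Q \<longlongrightarrow> lo') at_top"
    using mono_bounded_tendsto_at_top bell_antiderivative_bounded[OF \<gamma>(1) Q] by metis
  define lo where "lo = - lo'"
  have lo: "(P \<longlongrightarrow> lo) at_bot"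
    using tendsto_minus[OF lo'] unfolding Q_def lo_def filterlim_at_bot_mirror by simp
  have m: "mono P" by (rule bell_antiderivative_bounded[OF \<gamma>(1) P])
  have Ppos: "\<exists>y. (P has_real_derivative y) (at t) \<and> 0 < y" for t
    using P[of t] bell_pos[of t "- \<gamma>"] by blast
  have "P 0 < P 1" by (rule DERIV_pos_imp_increasing[OF _ Ppos]) simp
  moreover have "P 1 \<le> hi"
    using m by (intro tendsto_lowerbound[OF hi] eventually_at_top_linorderI[of 1]) (auto dest: monoD)
  moreover have "lo \<le> P 0"
    using m by (intro tendsto_upperbound[OF lo] eventually_at_bot_linorderI[of 0]) (auto dest: monoD)
  ultimately have lh: "0 < hi - lo" by linarith
  have "bell_profile \<gamma> (1 / (hi - lo)) (\<lambda>t. (P t - lo) / (hi - lo))"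
  proof
    show "((\<lambda>t. (P t - lo) / (hi - lo)) has_real_derivative 1 / (hi - lo) * (1 + t\<^sup>2) powr (- \<gamma>)) (at t)" for t
      using lh by (auto intro!: derivative_eq_intros P)
    show "((\<lambda>t. (P t - lo) / (hi - lo)) \<longlongrightarrow> 0) at_bot" using lh by (auto intro!: tendsto_eq_intros lo)
    show "((\<lambda>t. (P t - lo) / (hi - lo)) \<longlongrightarrow> 1) at_top" using lh by (auto intro!: tendsto_eq_intros hi)
  qed (use \<gamma> lh in auto)
  then show ?thesis by blast
qed

context bell_profile
begin

lemma profile_less:
  assumes "s < t" shows "\<Xi> s < \<Xi> t"
proof (rule DERIV_pos_imp_increasing[OF assms])
  show "\<exists>y. (\<Xi> has_real_derivative y) (at t) \<and> 0 < y" for t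
    using profile_deriv[of t] mult_pos_pos[OF height bell_pos[of t "- \<gamma>"]] by blast
qed

lemma profile_less_iff: "\<Xi> s < \<Xi> t \<longleftrightarrow> s < t"
  using profile_less by (metis less_asym linorder_neqE_linordered_idom order_less_irrefl)

lemma profile_inj: "\<Xi> s = \<Xi> t \<Longrightarrow> s = t"
  using profile_less by (metis linorder_neqE_linordered_idom order_less_irrefl)

lemma profile_gt_0: "0 < \<Xi> t"
proof -
  have "0 \<le> \<Xi> (t - 1)"
    using profile_less
    by (intro tendsto_upperbound[OF profile_bot] eventually_at_bot_linorderI[of "t - 1"])
      (auto simp: order_le_less)
  then show ?thesis using profile_less[of "t - 1" t] by simp
qed

lemma profile_lt_1: "\<Xi> t < 1"
proof -
  have "\<Xi> (t + 1) \<le> 1"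
    using profile_less
    by (intro tendsto_lowerbound[OF profile_top] eventually_at_top_linorderI[of "t + 1"])
      (auto simp: order_le_less)
  then show ?thesis using profile_less[of t "t + 1"] by simp
qed

lemma profile_surj:
  assumes "0 < x" "x < 1" shows "\<exists>t. \<Xi> t = x"
proof -
  obtain s where s: "\<Xi> s < x"
    using order_tendstoD(2)[OF profile_bot assms(1)] by (auto simp: eventually_at_bot_linorder)
  obtain t where t: "x < \<Xi> t"
    using order_tendstoD(1)[OF profile_top assms(2)] by (auto simp: eventually_at_top_linorder)
  have "s \<le> t" using s t profile_less_iff[of s t] by simp
  then show ?thesis
    using IVT[of \<Xi> s x t] s t profile_deriv by (metis DERIV_isCont less_imp_le)
qed

definition profile_inv :: "real \<Rightarrow> real" where
  "profile_inv x = (THE t. \<Xi> t = x)"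

lemma profile_inv_profile [simp]: "profile_inv (\<Xi> t) = t"
  unfolding profile_inv_def using profile_inj by blast

lemma profile_profile_inv: "0 < x \<Longrightarrow> x < 1 \<Longrightarrow> \<Xi> (profile_inv x) = x"
  using profile_surj profile_inv_profile by metis

text \<open>
The chart of an interval of length \<open>L\<close> with scale \<open>l\<close>, and its inverse.
\<close>

definition param :: "real \<Rightarrow> real \<Rightarrow> real \<Rightarrow> real" where
  "param l L t = L * \<Xi> (t / l)"

definition coord :: "real \<Rightarrow> real \<Rightarrow> real \<Rightarrow> real" where
  "coord l L u = l * profile_inv (u / L)"

text \<open>
The translation by \<open>c\<close>, read in the chart with scale \<open>l\<close> on \<open>[0, L]\<close> and in the chart with scale \<open>l'\<close>
on \<open>[0, L']\<close>.
\<close>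

definition slide :: "real \<Rightarrow> real \<Rightarrow> real \<Rightarrow> real \<Rightarrow> real \<Rightarrow> real \<Rightarrow> real" where
  "slide l L l' L' c u = (if u \<le> 0 then 0 else if L \<le> u then L' else param l' L' (coord l L u + c))"

text \<open>
The quotient of the densities of the two charts at \<open>t + c\<close> and \<open>t\<close>, for lengths that are balanced as
in \<open>slide_has_deriv\<close>.
\<close>

definition speed_ratio :: "real \<Rightarrow> real \<Rightarrow> real \<Rightarrow> real \<Rightarrow> real" where
  "speed_ratio l l' c t = ((l\<^sup>2 + t\<^sup>2) / (l'\<^sup>2 + (t + c)\<^sup>2)) powr \<gamma>"

definition slide_deriv :: "real \<Rightarrow> real \<Rightarrow> real \<Rightarrow> real \<Rightarrow> real \<Rightarrow> real" where
  "slide_deriv l L l' c u = (if u \<le> 0 \<or> L \<le> u then 1 else speed_ratio l l' c (coord l L u))"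

lemma param_bounds: "0 < L \<Longrightarrow> 0 < param l L t \<and> param l L t < L"
  using profile_gt_0[of "t / l"] profile_lt_1[of "t / l"] by (simp add: param_def)

lemma param_less_iff: "0 < l \<Longrightarrow> 0 < L \<Longrightarrow> param l L s < param l L t \<longleftrightarrow> s < t"
  by (simp add: param_def profile_less_iff divide_less_cancel)

lemma coord_param: "0 < l \<Longrightarrow> 0 < L \<Longrightarrow> coord l L (param l L t) = t"
  by (simp add: coord_def param_def)

lemma param_coord: "0 < l \<Longrightarrow> 0 < u \<Longrightarrow> u < L \<Longrightarrow> param l L (coord l L u) = u"
  by (simp add: coord_def param_def profile_profile_inv)

lemma slide_comp:
  assumes "0 < l" "0 < L" "0 < l'" "0 < L'" "0 < L''" and u: "0 \<le> u" "u \<le> L"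
  shows "slide l' L' l'' L'' c' (slide l L l' L' c u) = slide l L l'' L'' (c + c') u"
proof (cases "0 < u \<and> u < L")
  case True
  then have "slide l L l' L' c u = param l' L' (coord l L u + c)" by (simp add: slide_def)
  then show ?thesis
    using True assms param_bounds[of L' l' "coord l L u + c"]
    by (simp add: slide_def coord_param add.assoc)
next
  case False
  then show ?thesis using u assms by (auto simp: slide_def)
qed

lemma slide_id: "0 < l \<Longrightarrow> 0 \<le> u \<Longrightarrow> u \<le> L \<Longrightarrow> slide l L l L 0 u = u"
  by (auto simp: slide_def param_coord)

lemma slide_translation_unique:
  assumes "0 < l" "0 < L" and eq: "\<And>u. 0 \<le> u \<Longrightarrow> u \<le> L \<Longrightarrow> slide l L l L c u = u"
  shows "c = 0"
proof -
  have b: "0 < param l L 0" "param l L 0 < L" using param_bounds[of L l 0] assms by auto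
  have "param l L (coord l L (param l L 0) + c) = param l L 0"
    using eq[of "param l L 0"] b by (simp add: slide_def)
  then have "param l L c = param l L 0" using assms by (simp add: coord_param)
  then show "c = 0" using param_less_iff[of l L c 0] param_less_iff[of l L 0 c] assms by linarith
qed

lemma slide_0: "slide l L l' L' c 0 = 0"
  and slide_end: "0 < L \<Longrightarrow> slide l L l' L' c L = L'"
  by (auto simp: slide_def)

lemma slide_strict_mono:
  assumes "0 < l" "0 < L" "0 < l'" "0 < L'"
  shows "strict_mono_on {0..L} (slide l L l' L' c)"
proof (rule strict_mono_onI)
  fix u v assume uv: "u \<in> {0..L}" "v \<in> {0..L}" "u < v"
  show "slide l L l' L' c u < slide l L l' L' c v"
  proof (cases "0 < u \<and> v < L")
    case True
    then have "param l L (coord l L u) < param l L (coord l L v)"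
      using uv assms by (simp add: param_coord)
    then have "coord l L u < coord l L v" using assms by (simp add: param_less_iff)
    then show ?thesis using True uv assms by (simp add: slide_def param_less_iff)
  next
    case False
    then show ?thesis using uv assms param_bounds[of L' l'] by (auto simp: slide_def)
  qed
qed

text \<open>
The constant \<open>L * l powr (2 * \<gamma> - 1)\<close> is the factor of the tail \<open>t powr (- 2 * \<gamma>)\<close>. Charts with the
same constant are tangent to each other at the ends of the intervals.
\<close>

lemma param_deriv:
  assumes "0 < l"
  shows "(param l L has_real_derivative L * \<kappa> * l powr (2 * \<gamma> - 1) * (l\<^sup>2 + t\<^sup>2) powr (- \<gamma>)) (at t)"
proof -
  have "(param l L has_real_derivative L * (\<kappa> * (1 + (t / l)\<^sup>2) powr (- \<gamma>) * (1 / l))) (at t)"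
    unfolding param_def[abs_def]
    by (rule DERIV_cmult, rule DERIV_chain2[OF profile_deriv]) (use assms in \<open>auto intro!: derivative_eq_intros\<close>)
  moreover have "(1 + (t / l)\<^sup>2) powr (- \<gamma>) * (1 / l) = l powr (2 * \<gamma> - 1) * (l\<^sup>2 + t\<^sup>2) powr (- \<gamma>)"
  proof -
    have "l\<^sup>2 + t\<^sup>2 = l powr 2 * (1 + (t / l)\<^sup>2)"
      using assms by (simp add: field_simps power2_eq_square)
    then have "(l\<^sup>2 + t\<^sup>2) powr (- \<gamma>) = l powr (- 2 * \<gamma>) * (1 + (t / l)\<^sup>2) powr (- \<gamma>)"
      by (simp add: powr_mult powr_powr)
    moreover have "l powr (2 * \<gamma> - 1) * l powr (- 2 * \<gamma>) = l powr (- 1)"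
      by (simp flip: powr_add)
    then have "l powr (2 * \<gamma> - 1) * l powr (- 2 * \<gamma>) = 1 / l"
      using assms by (simp add: powr_minus_divide)
    ultimately show ?thesis by (simp add: mult.assoc[symmetric])
  qed
  then have "L * (\<kappa> * (1 + (t / l)\<^sup>2) powr (- \<gamma>) * (1 / l)) =
      L * \<kappa> * l powr (2 * \<gamma> - 1) * (l\<^sup>2 + t\<^sup>2) powr (- \<gamma>)"
    by (simp only: mult.assoc)
  ultimately show ?thesis by simp
qed

lemma param_at_bot: "0 < l \<Longrightarrow> (param l L \<longlongrightarrow> 0) at_bot"
  and param_at_top: "0 < l \<Longrightarrow> (param l L \<longlongrightarrow> L) at_top"
proof -
  assume l: "0 < l"
  have "filterlim (\<lambda>t. t / l) at_bot at_bot" using l by real_asymp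
  from filterlim_compose[OF profile_bot this] show "(param l L \<longlongrightarrow> 0) at_bot"
    unfolding param_def[abs_def] by (auto intro!: tendsto_eq_intros)
  have "filterlim (\<lambda>t. t / l) at_top at_top" using l by real_asymp
  from filterlim_compose[OF profile_top this] show "(param l L \<longlongrightarrow> L) at_top"
    unfolding param_def[abs_def] by (auto intro!: tendsto_eq_intros)
qed

lemma coord_at_bot:
  assumes "0 < l" "0 < L" shows "filterlim (coord l L) at_bot (at_right 0)"
  unfolding filterlim_at_bot
proof
  fix Z
  show "\<forall>\<^sub>F u in at_right 0. coord l L u \<le> Z"
    unfolding eventually_at_right_field
  proof (intro exI conjI allI impI)
    show "0 < param l L Z" using assms param_bounds by blast
    fix u assume u: "0 < u" "u < param l L Z"
    then have "param l L (coord l L u) < param l L Z"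
      using assms param_bounds[of L l Z] by (simp add: param_coord)
    then show "coord l L u \<le> Z" using assms by (simp add: param_less_iff)
  qed
qed

lemma coord_at_top:
  assumes "0 < l" "0 < L" shows "filterlim (coord l L) at_top (at_left L)"
  unfolding filterlim_at_top
proof
  fix Z
  show "\<forall>\<^sub>F u in at_left L. Z \<le> coord l L u"
    unfolding eventually_at_left_field
  proof (intro exI conjI allI impI)
    show "param l L Z < L" using assms param_bounds by blast
    fix u assume u: "param l L Z < u" "u < L"
    then have "param l L Z < param l L (coord l L u)"
      using assms param_bounds[of L l Z] by (simp add: param_coord)
    then show "Z \<le> coord l L u" using assms by (simp add: param_less_iff)
  qed
qed

lemma coord_deriv:
  assumes l: "0 < l" and u: "0 < u" "u < L"
  shows "(coord l L has_real_derivative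
    inverse (L * \<kappa> * l powr (2 * \<gamma> - 1) * (l\<^sup>2 + (coord l L u)\<^sup>2) powr (- \<gamma>))) (at u)"
proof (rule DERIV_inverse_function[where f = "param l L" and a = 0 and b = L])
  show "(param l L has_real_derivative L * \<kappa> * l powr (2 * \<gamma> - 1) * (l\<^sup>2 + (coord l L u)\<^sup>2) powr (- \<gamma>))
      (at (coord l L u))" using param_deriv[OF l] .
  have "0 < l\<^sup>2 + (coord l L u)\<^sup>2" using l by (simp add: add_pos_nonneg)
  then show "L * \<kappa> * l powr (2 * \<gamma> - 1) * (l\<^sup>2 + (coord l L u)\<^sup>2) powr (- \<gamma>) \<noteq> 0"
    using l u height by simp
  show "param l L (coord l L v) = v" if "0 < v" "v < L" for v
    using l that by (rule param_coord)
  have "isCont (coord l L) (param l L (coord l L u))"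
  proof (rule isCont_inverse_function[where f = "param l L" and d = 1])
    show "coord l L (param l L z) = z" for z using l u by (simp add: coord_param)
    show "isCont (param l L) z" for z using param_deriv[OF l] DERIV_isCont by blast
  qed simp
  then show "isCont (coord l L) u" using l u by (simp add: param_coord)
qed (use u in auto)

lemma slide_has_deriv:
  assumes pos: "0 < l" "0 < L" "0 < l'" "0 < L'"
    and bal: "L * l powr (2 * \<gamma> - 1) = L' * l' powr (2 * \<gamma> - 1)" and u: "0 < u" "u < L"
  shows "(slide l L l' L' c has_real_derivative slide_deriv l L l' c u) (at u)"
proof -
  let ?t = "coord l L u"
  have p: "0 < l\<^sup>2 + ?t\<^sup>2" "0 < l'\<^sup>2 + (?t + c)\<^sup>2" using pos by (simp_all add: add_pos_nonneg)
  have "((\<lambda>u. param l' L' (coord l L u + c)) has_real_derivative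
      (L' * \<kappa> * l' powr (2 * \<gamma> - 1) * (l'\<^sup>2 + (?t + c)\<^sup>2) powr (- \<gamma>)) *
       inverse (L * \<kappa> * l powr (2 * \<gamma> - 1) * (l\<^sup>2 + ?t\<^sup>2) powr (- \<gamma>))) (at u)"
    by (rule DERIV_chain2[OF param_deriv[OF pos(3)]])
      (use coord_deriv[OF pos(1) u] in \<open>auto intro!: derivative_eq_intros\<close>)
  moreover have "(L' * \<kappa> * l' powr (2 * \<gamma> - 1) * (l'\<^sup>2 + (?t + c)\<^sup>2) powr (- \<gamma>)) *
       inverse (L * \<kappa> * l powr (2 * \<gamma> - 1) * (l\<^sup>2 + ?t\<^sup>2) powr (- \<gamma>)) = slide_deriv l L l' c u"
  proof -
    have "L' * \<kappa> * l' powr (2 * \<gamma> - 1) = L * \<kappa> * l powr (2 * \<gamma> - 1)" using bal by (simp add: mult.commute mult.left_commute)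
    moreover have "L * \<kappa> * l powr (2 * \<gamma> - 1) \<noteq> 0" using pos height by simp
    moreover have "(l'\<^sup>2 + (?t + c)\<^sup>2) powr (- \<gamma>) * inverse ((l\<^sup>2 + ?t\<^sup>2) powr (- \<gamma>)) = speed_ratio l l' c ?t"
      using p unfolding speed_ratio_def by (simp add: powr_minus powr_divide field_simps)
    ultimately show ?thesis using u by (simp add: slide_deriv_def field_simps)
  qed
  ultimately have "((\<lambda>u. param l' L' (coord l L u + c)) has_real_derivative slide_deriv l L l' c u) (at u)"
    by simp
  then show ?thesis
    by (rule has_field_derivative_transform_within_open[where S = "{0<..<L}"]) (use u in \<open>auto simp: slide_def\<close>)
qed

lemma slide_continuous:
  assumes pos: "0 < l" "0 < L" "0 < l'" "0 < L'"
    and bal: "L * l powr (2 * \<gamma> - 1) = L' * l' powr (2 * \<gamma> - 1)"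
  shows "continuous_on {0..L} (slide l L l' L' c)"
proof (rule continuous_on_IccI)
  have "filterlim (\<lambda>u. coord l L u + c) at_bot (at_right 0)"
    by (rule filterlim_compose[OF _ coord_at_bot[OF pos(1,2)]]) real_asymp
  from filterlim_compose[OF param_at_bot[OF pos(3)] this]
  have lim: "((\<lambda>u. param l' L' (coord l L u + c)) \<longlongrightarrow> 0) (at_right 0)" .
  have "\<forall>\<^sub>F u in at_right 0. param l' L' (coord l L u + c) = slide l L l' L' c u"
    unfolding eventually_at_right_field by (rule exI[of _ L]) (use pos in \<open>auto simp: slide_def\<close>)
  from Lim_transform_eventually[OF lim this]
  show "(slide l L l' L' c \<longlongrightarrow> slide l L l' L' c 0) (at_right 0)" by (simp add: slide_0)
  have "filterlim (\<lambda>u. coord l L u + c) at_top (at_left L)"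
    by (rule filterlim_compose[OF _ coord_at_top[OF pos(1,2)]]) real_asymp
  from filterlim_compose[OF param_at_top[OF pos(3)] this]
  have lim: "((\<lambda>u. param l' L' (coord l L u + c)) \<longlongrightarrow> L') (at_left L)" .
  have "\<forall>\<^sub>F u in at_left L. param l' L' (coord l L u + c) = slide l L l' L' c u"
    unfolding eventually_at_left_field by (rule exI[of _ 0]) (use pos in \<open>auto simp: slide_def\<close>)
  from Lim_transform_eventually[OF lim this]
  show "(slide l L l' L' c \<longlongrightarrow> slide l L l' L' c L) (at_left L)"
    using pos(2) by (simp add: slide_end)
  show "slide l L l' L' c \<midarrow>x\<rightarrow> slide l L l' L' c x" if "0 < x" "x < L" for x
    using DERIV_isCont[OF slide_has_deriv[OF pos bal that]] by (simp add: isCont_def)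
qed (use pos in simp)

lemma slide_mvt:
  assumes pos: "0 < l" "0 < L" "0 < l'" "0 < L'"
    and bal: "L * l powr (2 * \<gamma> - 1) = L' * l' powr (2 * \<gamma> - 1)"
    and uv: "0 \<le> u" "u < v" "v \<le> L"
  shows "\<exists>z. u < z \<and> z < v \<and>
    slide l L l' L' c v - slide l L l' L' c u = slide_deriv l L l' c z * (v - u)"
proof -
  have "continuous_on {u..v} (slide l L l' L' c)"
    using slide_continuous[OF pos bal] by (rule continuous_on_subset) (use uv in auto)
  moreover have der: "(slide l L l' L' c has_real_derivative slide_deriv l L l' c z) (at z)"
    if "u < z" "z < v" for z
    using slide_has_deriv[OF pos bal, of z c] that uv by linarith
  ultimately obtain D z where z: "u < z" "z < v" "(slide l L l' L' c has_real_derivative D) (at z)"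
      "slide l L l' L' c v - slide l L l' L' c u = (v - u) * D"
    using MVT[OF uv(2), of "slide l L l' L' c"] real_differentiable_def by blast
  then have "D = slide_deriv l L l' c z"
    using DERIV_unique der by blast
  then show ?thesis using z by (auto simp: mult.commute)
qed

lemma speed_ratio_tendsto:
  shows "(speed_ratio l l' c \<longlongrightarrow> 1) at_top" and "(speed_ratio l l' c \<longlongrightarrow> 1) at_bot"
proof -
  have a: "((\<lambda>t. (l\<^sup>2 + t\<^sup>2) / (l'\<^sup>2 + (t + c)\<^sup>2)) \<longlongrightarrow> 1) at_top" by real_asymp
  have b: "((\<lambda>t. (l\<^sup>2 + t\<^sup>2) / (l'\<^sup>2 + (t + c)\<^sup>2)) \<longlongrightarrow> 1) at_bot" by real_asymp
  show "(speed_ratio l l' c \<longlongrightarrow> 1) at_top" "(speed_ratio l l' c \<longlongrightarrow> 1) at_bot"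
    unfolding speed_ratio_def[abs_def]
    using tendsto_powr[OF a tendsto_const, of \<gamma>] tendsto_powr[OF b tendsto_const, of \<gamma>] by simp_all
qed

text \<open>
With \<open>p = l\<^sup>2 + t\<^sup>2\<close> and \<open>q = l'\<^sup>2 + (t + c)\<^sup>2\<close>, the logarithmic derivative of the speed ratio is
\<open>2 * \<gamma> * (t * q - (t + c) * p) / (p * q)\<close>. All terms of the numerator that do not cancel contain a
factor \<open>c\<close> or \<open>l' - l\<close>, whence the numerator is of order \<open>l * p / N\<close>. As \<open>p\<close> and \<open>q\<close> are comparable,
the derivative is of order \<open>l / (N * p)\<close>, and \<open>\<gamma> \<le> 1\<close> allows one to trade a power of \<open>p\<close> for a power
of \<open>l\<close> so as to reach the density of the chart.
\<close>

lemma speed_ratio_deriv_bound: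
  assumes pos: "0 < l" "0 < l'" and B: "1 \<le> B" and N: "1 \<le> N"
    and c: "\<bar>c\<bar> \<le> B * l / N" and ll': "\<bar>l' - l\<bar> \<le> B * l / N" "l \<le> B * l'"
  shows "\<exists>D. (speed_ratio l l' c has_real_derivative D) (at t) \<and>
     \<bar>D\<bar> \<le> 12 * \<gamma> * (3 * B ^ 4) powr (\<gamma> + 1) * B\<^sup>2 / N * l powr (2 * \<gamma> - 1) * (l\<^sup>2 + t\<^sup>2) powr (- \<gamma>)"
proof -
  define p where "p = l\<^sup>2 + t\<^sup>2"
  define q where "q = l'\<^sup>2 + (t + c)\<^sup>2"
  define num where "num = t * q - (t + c) * p"
  have p: "0 < p" and q: "0 < q" using pos by (simp_all add: p_def q_def add_pos_nonneg)
  have "((\<lambda>t. (l\<^sup>2 + t\<^sup>2) / (l'\<^sup>2 + (t + c)\<^sup>2)) has_real_derivative (2 * num / q\<^sup>2)) (at t)"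
    using q by (auto intro!: derivative_eq_intros simp: q_def p_def num_def power2_eq_square field_simps)
  from DERIV_powr[OF this, of "\<lambda>_. \<gamma>" 0]
  have deriv: "(speed_ratio l l' c has_real_derivative (p / q) powr \<gamma> * (2 * num / q\<^sup>2 * \<gamma> / (p / q))) (at t)"
    unfolding speed_ratio_def[abs_def] using p q by (simp add: p_def q_def)
  define T where "T = sqrt p"
  have T: "T\<^sup>2 = p" "0 < T" "\<bar>t\<bar> \<le> T" "l \<le> T"
    using p pos by (auto simp: T_def p_def intro!: real_le_rsqrt)
  have BlN: "B * l / N \<le> B * l"
  proof -
    have "0 \<le> B * l" using B pos by simp
    then have "B * l * 1 \<le> B * l * N" using N by (intro mult_left_mono) auto
    then show ?thesis using N by (simp add: divide_le_eq)
  qed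
  have l'_le: "l' \<le> (1 + B) * l" using BlN ll'(1) by (simp add: algebra_simps)
  have cl: "\<bar>c\<bar> \<le> B * l" using c BlN by linarith
  have num_eq: "num = t * ((l' - l) * (l' + l)) + c * t\<^sup>2 + c * (c * t) - c * l\<^sup>2"
    by (simp add: num_def p_def q_def power2_eq_square algebra_simps)
  have e: "B * l / N \<ge> 0" using B N pos by simp
  have n1: "\<bar>t * ((l' - l) * (l' + l))\<bar> \<le> T * (B * l / N * ((2 + B) * T))"
  proof -
    have "l' + l \<le> (2 + B) * T"
    proof -
      have "B * l \<le> B * T" using T(4) B by (intro mult_left_mono) auto
      moreover have "(1 + B) * l = l + B * l" "(2 + B) * T = 2 * T + B * T"
        by (simp_all add: algebra_simps)
      ultimately show ?thesis using l'_le T(4) by linarith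
    qed
    then show ?thesis
      unfolding abs_mult using T(2,3) ll'(1) e pos B by (intro mult_mono) auto
  qed
  have n2: "\<bar>c * t\<^sup>2\<bar> \<le> B * l / N * T\<^sup>2"
    unfolding abs_mult using T c e by (intro mult_mono) (auto simp: abs_le_square_iff[symmetric])
  have n3: "\<bar>c * (c * t)\<bar> \<le> B * l / N * (B * T * T)"
  proof -
    have "B * l \<le> B * T" using T(4) B by (intro mult_left_mono) auto
    then have "\<bar>c\<bar> \<le> B * T" using cl by linarith
    then show ?thesis unfolding abs_mult using T(2,3) c e B by (intro mult_mono) auto
  qed
  have n4: "\<bar>c * l\<^sup>2\<bar> \<le> B * l / N * T\<^sup>2"
    unfolding abs_mult using T c e pos by (intro mult_mono) (auto simp: abs_le_square_iff[symmetric])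
  have "\<bar>num\<bar> \<le> B * l / N * T\<^sup>2 * (2 * B + 4)"
  proof -
    have "\<bar>num\<bar> \<le> \<bar>t * ((l' - l) * (l' + l))\<bar> + \<bar>c * t\<^sup>2\<bar> + \<bar>c * (c * t)\<bar> + \<bar>c * l\<^sup>2\<bar>"
      unfolding num_eq by linarith
    also have "\<dots> \<le> T * (B * l / N * ((2 + B) * T)) + B * l / N * T\<^sup>2 + B * l / N * (B * T * T) + B * l / N * T\<^sup>2"
      using n1 n2 n3 n4 by linarith
    also have "\<dots> = B * l / N * T\<^sup>2 * (2 * B + 4)" by (simp add: power2_eq_square algebra_simps)
    finally show ?thesis .
  qed
  also have "\<dots> \<le> B * l / N * T\<^sup>2 * (6 * B)"
    by (rule mult_left_mono[OF _ mult_nonneg_nonneg[OF e zero_le_power2]]) (use B in simp)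
  also have "\<dots> = 6 * B\<^sup>2 * (l / N) * p" unfolding T(1) by (simp add: power2_eq_square)
  finally have num: "\<bar>num\<bar> \<le> 6 * B\<^sup>2 * (l / N) * p" .
  \<comment> \<open>\<open>p\<close> and \<open>q\<close> are comparable because \<open>c\<close> is at most \<open>B * l\<close> and \<open>l\<close> is at most \<open>B * l'\<close>.\<close>
  have pq: "p \<le> 3 * B ^ 4 * q"
  proof -
    have "c\<^sup>2 \<le> (B * l)\<^sup>2" using cl B pos by (simp add: abs_le_square_iff[symmetric])
    then have "c\<^sup>2 \<le> B\<^sup>2 * l\<^sup>2" by (simp add: power_mult_distrib)
    moreover have "t\<^sup>2 \<le> 2 * (t + c)\<^sup>2 + 2 * c\<^sup>2"
      using zero_le_power2[of "t + 2 * c"] by (simp add: power2_eq_square algebra_simps)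
    ultimately have "p \<le> (1 + 2 * B\<^sup>2) * l\<^sup>2 + 2 * (t + c)\<^sup>2" by (simp add: p_def algebra_simps)
    also have "\<dots> \<le> (3 * B\<^sup>2) * (B\<^sup>2 * l'\<^sup>2) + 3 * B ^ 4 * (t + c)\<^sup>2"
    proof (intro add_mono mult_mono)
      show "l\<^sup>2 \<le> B\<^sup>2 * l'\<^sup>2"
        using power_mono[OF ll'(2), of 2] pos by (simp add: power_mult_distrib)
      show "1 + 2 * B\<^sup>2 \<le> 3 * B\<^sup>2" using B by (simp add: one_le_power)
      show "2 \<le> 3 * B ^ 4" using one_le_power[OF B, of 4] by simp
    qed auto
    also have "\<dots> = 3 * B ^ 4 * q"
      by (simp add: q_def algebra_simps power2_eq_square power4_eq_xxxx)
    finally show ?thesis .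
  qed
  let ?E = "3 * B ^ 4"
  have E: "0 < ?E" using B by simp
  have "(p / q) powr \<gamma> \<le> ?E powr \<gamma>"
    using p q pq exponent by (intro powr_mono2) (auto simp: divide_le_eq)
  moreover have "\<bar>2 * num / q\<^sup>2 * \<gamma> / (p / q)\<bar> \<le> 12 * \<gamma> * B\<^sup>2 * ?E * (l / N) / p"
  proof -
    have "\<bar>2 * num / q\<^sup>2 * \<gamma> / (p / q)\<bar> = 2 * \<gamma> * (\<bar>num\<bar> / p) * (1 / q)"
      using p q exponent by (simp add: abs_mult power2_eq_square mult_ac)
    also have "\<dots> \<le> 2 * \<gamma> * (6 * B\<^sup>2 * (l / N)) * (?E / p)"
    proof (intro mult_mono)
      show "\<bar>num\<bar> / p \<le> 6 * B\<^sup>2 * (l / N)" using num p by (simp add: pos_divide_le_eq)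
      show "1 / q \<le> ?E / p" using pq p q by (simp add: divide_le_eq le_divide_eq mult.commute)
    qed (use exponent pos N p q in auto)
    also have "\<dots> = 12 * \<gamma> * B\<^sup>2 * ?E * (l / N) / p" by simp
    finally show ?thesis .
  qed
  ultimately have "\<bar>(p / q) powr \<gamma> * (2 * num / q\<^sup>2 * \<gamma> / (p / q))\<bar>
      \<le> ?E powr \<gamma> * (12 * \<gamma> * B\<^sup>2 * ?E * (l / N) / p)"
    unfolding abs_mult[of "(p / q) powr \<gamma>"] by (intro mult_mono) auto
  also have "\<dots> = 12 * \<gamma> * ?E powr (\<gamma> + 1) * B\<^sup>2 / N * (l / p)"
    using E by (simp add: powr_add field_simps)
  also have "\<dots> \<le> 12 * \<gamma> * ?E powr (\<gamma> + 1) * B\<^sup>2 / N * (l powr (2 * \<gamma> - 1) * p powr (- \<gamma>))"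
  proof (rule mult_left_mono)
    \<comment> \<open>This is where \<open>\<gamma> < 1\<close> enters.\<close>
    have "p powr (\<gamma> - 1) \<le> (l\<^sup>2) powr (\<gamma> - 1)"
      using pos exponent by (intro powr_mono2') (auto simp: p_def)
    also have "\<dots> = l powr (2 * \<gamma> - 2)" using pos by (simp add: powr_powr algebra_simps flip: powr_numeral)
    finally have "p powr (\<gamma> - 1) * (l * p powr (- \<gamma>)) \<le> l powr (2 * \<gamma> - 2) * (l * p powr (- \<gamma>))"
      using pos by (intro mult_right_mono) auto
    moreover have "p powr (\<gamma> - 1) * (l * p powr (- \<gamma>)) = l / p"
      using p by (simp add: powr_diff powr_minus_divide)
    moreover have "l powr (2 * \<gamma> - 2) * (l * p powr (- \<gamma>)) = l powr (2 * \<gamma> - 1) * p powr (- \<gamma>)"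
      using pos powr_add[of l "2 * \<gamma> - 2" 1] by simp
    ultimately show "l / p \<le> l powr (2 * \<gamma> - 1) * p powr (- \<gamma>)" by simp
  qed (use exponent N in auto)
  finally show ?thesis using deriv by (auto simp: p_def mult.assoc)
qed

text \<open>
\<open>speed_ratio_deriv_bound\<close> compares the derivative of the speed ratio with the derivative of the chart, so
the speed ratio is Lipschitz as a function of the point of the interval; the limits of both at
infinity extend the estimate to the end points.
\<close>

lemma slide_deriv_lipschitz:
  assumes pos: "0 < l" "0 < L" "0 < l'" and B: "1 \<le> B" and N: "1 \<le> N"
    and c: "\<bar>c\<bar> \<le> B * l / N" and ll': "\<bar>l' - l\<bar> \<le> B * l / N" "l \<le> B * l'"
    and uv: "u \<in> {0..L}" "v \<in> {0..L}"
  shows "\<bar>slide_deriv l L l' c u - slide_deriv l L l' c v\<bar>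
    \<le> 12 * \<gamma> * (3 * B ^ 4) powr (\<gamma> + 1) * B\<^sup>2 / \<kappa> / (N * L) * \<bar>u - v\<bar>"
proof -
  define M where "M = 12 * \<gamma> * (3 * B ^ 4) powr (\<gamma> + 1) * B\<^sup>2 / \<kappa> / (N * L)"
  let ?F = "speed_ratio l l' c" and ?x = "param l L"
  have step: "\<bar>?F t - ?F s\<bar> \<le> M * (?x t - ?x s)" if "s \<le> t" for s t
  proof -
    have D: "\<exists>D. (?F has_real_derivative D) (at r) \<and> \<bar>D\<bar> \<le>
        M * (L * \<kappa> * l powr (2 * \<gamma> - 1) * (l\<^sup>2 + r\<^sup>2) powr (- \<gamma>))" for r
    proof -
      have "M * (L * \<kappa> * l powr (2 * \<gamma> - 1) * (l\<^sup>2 + r\<^sup>2) powr (- \<gamma>)) =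
          12 * \<gamma> * (3 * B ^ 4) powr (\<gamma> + 1) * B\<^sup>2 / N * l powr (2 * \<gamma> - 1) * (l\<^sup>2 + r\<^sup>2) powr (- \<gamma>)"
        unfolding M_def using height pos N by (simp add: field_simps)
      then show ?thesis using speed_ratio_deriv_bound[OF pos(1,3) B N c ll', of r] by simp
    qed
    have "M * ?x s - ?F s \<le> M * ?x t - ?F t"
    proof (rule DERIV_nonneg_imp_nondecreasing[OF that])
      fix r
      obtain D where "(?F has_real_derivative D) (at r)"
        "\<bar>D\<bar> \<le> M * (L * \<kappa> * l powr (2 * \<gamma> - 1) * (l\<^sup>2 + r\<^sup>2) powr (- \<gamma>))" using D by blast
      then show "\<exists>y. ((\<lambda>a. M * ?x a - ?F a) has_real_derivative y) (at r) \<and> 0 \<le> y"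
        using DERIV_diff[OF DERIV_cmult[OF param_deriv[OF pos(1), of L r], of M]] by fastforce
    qed
    moreover have "M * ?x s + ?F s \<le> M * ?x t + ?F t"
    proof (rule DERIV_nonneg_imp_nondecreasing[OF that])
      fix r
      obtain D where "(?F has_real_derivative D) (at r)"
        "\<bar>D\<bar> \<le> M * (L * \<kappa> * l powr (2 * \<gamma> - 1) * (l\<^sup>2 + r\<^sup>2) powr (- \<gamma>))" using D by blast
      then show "\<exists>y. ((\<lambda>a. M * ?x a + ?F a) has_real_derivative y) (at r) \<and> 0 \<le> y"
        using DERIV_add[OF DERIV_cmult[OF param_deriv[OF pos(1), of L r], of M]] by fastforce
    qed
    ultimately show ?thesis by (simp add: algebra_simps abs_le_iff)
  qed
  have low: "\<bar>?F t - 1\<bar> \<le> M * (?x t - 0)" for t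
  proof (rule tendsto_le[OF trivial_limit_at_bot_linorder])
    show "((\<lambda>s. \<bar>?F t - ?F s\<bar>) \<longlongrightarrow> \<bar>?F t - 1\<bar>) at_bot"
      by (intro tendsto_intros speed_ratio_tendsto)
    show "((\<lambda>s. M * (?x t - ?x s)) \<longlongrightarrow> M * (?x t - 0)) at_bot"
      by (intro tendsto_intros param_at_bot pos)
    show "\<forall>\<^sub>F s in at_bot. \<bar>?F t - ?F s\<bar> \<le> M * (?x t - ?x s)"
      using step by (intro eventually_at_bot_linorderI[of t]) auto
  qed
  have high: "\<bar>1 - ?F s\<bar> \<le> M * (L - ?x s)" for s
  proof (rule tendsto_le[OF trivial_limit_at_top_linorder])
    show "((\<lambda>t. \<bar>?F t - ?F s\<bar>) \<longlongrightarrow> \<bar>1 - ?F s\<bar>) at_top"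
      by (intro tendsto_intros speed_ratio_tendsto)
    show "((\<lambda>t. M * (?x t - ?x s)) \<longlongrightarrow> M * (L - ?x s)) at_top"
      by (intro tendsto_intros param_at_top pos)
    show "\<forall>\<^sub>F t in at_top. \<bar>?F t - ?F s\<bar> \<le> M * (?x t - ?x s)"
      using step by (intro eventually_at_top_linorderI[of s]) auto
  qed
  have M: "0 \<le> M" using exponent height N pos by (simp add: M_def)
  have main: "\<bar>slide_deriv l L l' c u - slide_deriv l L l' c v\<bar> \<le> M * (v - u)"
    if uv: "0 \<le> u" "u \<le> v" "v \<le> L" for u v
  proof -
    consider "0 < u \<and> v < L" | "u = 0 \<and> 0 < v \<and> v < L" | "0 < u \<and> u < L \<and> v = L" |
        "(u = 0 \<or> u = L) \<and> (v = 0 \<or> v = L)"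
      using uv by linarith
    then show ?thesis
    proof cases
      case 1
      have "coord l L u \<le> coord l L v"
        using param_less_iff[OF pos(1,2), of "coord l L v" "coord l L u"] 1 uv pos
        by (auto simp: param_coord not_less[symmetric])
      then show ?thesis
        using step[of "coord l L u" "coord l L v"] 1 uv pos
        by (simp add: slide_deriv_def param_coord abs_minus_commute)
    next
      case 2
      then show ?thesis using low[of "coord l L v"] pos
        by (simp add: slide_deriv_def param_coord abs_minus_commute)
    next
      case 3
      then show ?thesis using high[of "coord l L u"] pos
        by (simp add: slide_deriv_def param_coord abs_minus_commute)
    next
      case 4
      then show ?thesis using uv M by (auto simp: slide_deriv_def)
    qed
  qed
  show ?thesis
    using main[of u v] main[of v u] uv unfolding M_def[symmetric]
    by (cases "u \<le> v") (auto simp: abs_minus_commute)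
qed

end

section \<open>The integer lattice: lexicographic order and summability\<close>

definition lex_less :: "(nat \<Rightarrow> int) \<Rightarrow> (nat \<Rightarrow> int) \<Rightarrow> bool" where
  "lex_less m n \<longleftrightarrow> (\<exists>l. m l < n l \<and> (\<forall>i<l. m i = n i))"

lemma lex_less_irrefl: "\<not> lex_less n n"
  by (simp add: lex_less_def)

lemma lex_less_trans:
  assumes "lex_less m n" "lex_less n p" shows "lex_less m p"
proof -
  obtain a where a: "m a < n a" "\<And>i. i < a \<Longrightarrow> m i = n i" using assms(1) by (auto simp: lex_less_def)
  obtain b where b: "n b < p b" "\<And>i. i < b \<Longrightarrow> n i = p i" using assms(2) by (auto simp: lex_less_def)
  have "m (min a b) < p (min a b)"
    using a(1) b(1) a(2)[of b] b(2)[of a] by (cases a b rule: linorder_cases) (auto simp: min_def)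
  moreover have "m i = p i" if "i < min a b" for i using that a(2)[of i] b(2)[of i] by simp
  ultimately show ?thesis unfolding lex_less_def by blast
qed

lemma lex_less_total:
  assumes "m \<noteq> n" shows "lex_less m n \<or> lex_less n m"
proof -
  have ex: "\<exists>l. m l \<noteq> n l" using assms by auto
  define l where "l = (LEAST l. m l \<noteq> n l)"
  have "m l \<noteq> n l" unfolding l_def by (rule LeastI_ex[OF ex])
  moreover have "m i = n i" if "i < l" for i using not_less_Least[of i "\<lambda>l. m l \<noteq> n l"] that by (auto simp: l_def)
  ultimately show ?thesis unfolding lex_less_def by (metis linorder_neqE)
qed

lemma lex_less_translate: "lex_less m n \<Longrightarrow> lex_less (\<lambda>i. v i + m i) (\<lambda>i. v i + n i)"
  by (auto simp: lex_less_def)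

lemma int_powr_sums_bounded:
  assumes p: "1 < p"
  shows "\<exists>C. \<forall>Z. finite Z \<longrightarrow> (\<Sum>z\<in>Z. (1 + \<bar>real_of_int z\<bar>) powr (- p)) \<le> C"
proof -
  let ?w = "\<lambda>n::nat. (1 + real n) powr (- p)"
  have "summable (\<lambda>n::nat. real n powr (- p))" using p by (simp add: summable_real_powr_iff)
  then have "summable (\<lambda>n. real (Suc n) powr (- p))"
    using summable_Suc_iff[of "\<lambda>n. real n powr (- p)"] by blast
  then have sm: "summable ?w" by (simp add: add.commute)
  have fin: "(\<Sum>n\<in>X. ?w n) \<le> suminf ?w" if "finite X" for X
    using that sm by (intro sum_le_suminf) auto
  show ?thesis
  proof (intro exI[of _ "2 * suminf ?w"] allI impI)
    fix Z :: "int set" assume Z: "finite Z"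
    have "(\<Sum>z\<in>Z. (1 + \<bar>real_of_int z\<bar>) powr (- p)) =
        (\<Sum>z\<in>Z \<inter> {0..}. (1 + \<bar>real_of_int z\<bar>) powr (- p)) + (\<Sum>z\<in>Z - {0..}. (1 + \<bar>real_of_int z\<bar>) powr (- p))"
      using Z sum.Int_Diff by blast
    also have "(\<Sum>z\<in>Z \<inter> {0..}. (1 + \<bar>real_of_int z\<bar>) powr (- p)) = (\<Sum>n\<in>nat ` (Z \<inter> {0..}). ?w n)"
      by (subst sum.reindex) (auto simp: inj_on_def intro!: sum.cong)
    also have "(\<Sum>z\<in>Z - {0..}. (1 + \<bar>real_of_int z\<bar>) powr (- p)) = (\<Sum>n\<in>(\<lambda>z. nat (- z)) ` (Z - {0..}). ?w n)"
      by (subst sum.reindex) (auto simp: inj_on_def intro!: sum.cong)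
    also have "(\<Sum>n\<in>nat ` (Z \<inter> {0..}). ?w n) + (\<Sum>n\<in>(\<lambda>z. nat (- z)) ` (Z - {0..}). ?w n) \<le> suminf ?w + suminf ?w"
      using Z by (intro add_mono fin) auto
    finally show "(\<Sum>z\<in>Z. (1 + \<bar>real_of_int z\<bar>) powr (- p)) \<le> 2 * suminf ?w" by simp
  qed
qed

text \<open>
The summand is at most the product over the coordinates of \<open>(1 + \<bar>n i\<bar>) powr (- p / k)\<close>, and the sum
of the product over a box is the product of \<open>k\<close> convergent one-dimensional sums.
\<close>

lemma lattice_powr_summable:
  assumes k: "0 < k" and p: "real k < p"
  shows "(\<lambda>n. (1 + real (taxicab k n)) powr (- p)) summable_on int_lattice k"
proof -
  define q where "q = p / real k"
  have q: "1 < q" using k p by (simp add: q_def)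
  define w where "w z = (1 + \<bar>real_of_int z\<bar>) powr (- q)" for z
  obtain C where C: "\<And>Z. finite Z \<Longrightarrow> (\<Sum>z\<in>Z. w z) \<le> C"
    using int_powr_sums_bounded[OF q] unfolding w_def by blast
  have w0: "0 \<le> w z" for z by (simp add: w_def)
  have le: "(1 + real (taxicab k n)) powr (- p) \<le> (\<Prod>i<k. w (n i))" for n
  proof -
    have "(1 + real (taxicab k n)) powr (- p) = (\<Prod>i<k. (1 + real (taxicab k n)) powr (- q))"
    proof -
      have "(\<Prod>i<k. (1 + real (taxicab k n)) powr (- q)) = (1 + real (taxicab k n)) powr (real k * (- q))"
        by (simp add: powr_power mult.commute)
      also have "real k * (- q) = - p" using k by (simp add: q_def)
      finally show ?thesis by simp
    qed
    also have "\<dots> \<le> (\<Prod>i<k. w (n i))"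
    proof (rule prod_mono, intro conjI)
      fix i assume i: "i \<in> {..<k}"
      have "nat \<bar>n i\<bar> \<le> taxicab k n" unfolding taxicab_def using i by (intro member_le_sum) auto
      then have "real_of_int \<bar>n i\<bar> \<le> real (taxicab k n)" by linarith
      then show "(1 + real (taxicab k n)) powr (- q) \<le> w (n i)"
        unfolding w_def using q by (intro powr_mono2') auto
    qed simp
    finally show ?thesis .
  qed
  show ?thesis
  proof (rule nonneg_bdd_above_summable_on)
    show "bdd_above (sum (\<lambda>n. (1 + real (taxicab k n)) powr (- p)) ` {F. F \<subseteq> int_lattice k \<and> finite F})"
      unfolding bdd_above_def
    proof (intro exI[of _ "C ^ k"] ballI)
      fix s assume "s \<in> sum (\<lambda>n. (1 + real (taxicab k n)) powr (- p)) ` {F. F \<subseteq> int_lattice k \<and> finite F}"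
      then obtain F where F: "F \<subseteq> int_lattice k" "finite F"
        and s: "s = (\<Sum>n\<in>F. (1 + real (taxicab k n)) powr (- p))" by blast
      define Z where "Z = (\<Union>n\<in>F. n ` {..<k})"
      have Z: "finite Z" using F by (simp add: Z_def)
      have inj: "inj_on (\<lambda>n. restrict n {..<k}) F"
      proof (rule inj_onI, rule ext)
        fix m n l assume mn: "m \<in> F" "n \<in> F" and eq: "restrict m {..<k} = restrict n {..<k}"
        show "m l = n l"
        proof (cases "l < k")
          case True
          then show ?thesis using fun_cong[OF eq, of l] by simp
        next
          case False
          have "m \<in> int_lattice k" "n \<in> int_lattice k" using mn F by auto
          then show ?thesis using False by (simp add: int_lattice_def)
        qed
      qed
      have "s \<le> (\<Sum>n\<in>F. \<Prod>i<k. w (n i))" unfolding s by (intro sum_mono le)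
      also have "\<dots> = (\<Sum>g\<in>(\<lambda>n. restrict n {..<k}) ` F. \<Prod>i<k. w (g i))"
        by (subst sum.reindex[OF inj]) simp
      also have "\<dots> \<le> (\<Sum>g\<in>PiE {..<k} (\<lambda>_. Z). \<Prod>i<k. w (g i))"
      proof (rule sum_mono2)
        show "finite (PiE {..<k} (\<lambda>_. Z))" using Z by (intro finite_PiE) auto
        show "(\<lambda>n. restrict n {..<k}) ` F \<subseteq> PiE {..<k} (\<lambda>_. Z)"
          by (auto simp: Z_def restrict_PiE_iff split: if_splits)
      qed (auto intro: prod_nonneg w0)
      also have "\<dots> = (\<Prod>i<k. \<Sum>z\<in>Z. w z)"
        using Z by (intro prod_sum_PiE[symmetric]) auto
      also have "\<dots> = (\<Sum>z\<in>Z. w z) ^ k" by simp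
      also have "\<dots> \<le> C ^ k" using C[OF Z] w0 by (intro power_mono sum_nonneg)
      finally show "s \<le> C ^ k" .
    qed
  qed simp
qed

lemma power_difference_bound:
  fixes x y M :: real
  assumes "0 \<le> x" "x \<le> M" "0 \<le> y" "y \<le> M"
  shows "\<bar>y ^ Suc m - x ^ Suc m\<bar> \<le> real (Suc m) * \<bar>y - x\<bar> * M ^ m"
proof (induction m)
  case (Suc m)
  have "y ^ Suc (Suc m) - x ^ Suc (Suc m) = y * (y ^ Suc m - x ^ Suc m) + (y - x) * x ^ Suc m"
    by (simp add: algebra_simps)
  then have "\<bar>y ^ Suc (Suc m) - x ^ Suc (Suc m)\<bar> \<le> \<bar>y * (y ^ Suc m - x ^ Suc m)\<bar> + \<bar>(y - x) * x ^ Suc m\<bar>"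
    by linarith
  also have "\<dots> \<le> M * (real (Suc m) * \<bar>y - x\<bar> * M ^ m) + \<bar>y - x\<bar> * M ^ Suc m"
  proof (rule add_mono)
    show "\<bar>y * (y ^ Suc m - x ^ Suc m)\<bar> \<le> M * (real (Suc m) * \<bar>y - x\<bar> * M ^ m)"
      unfolding abs_mult using assms Suc by (intro mult_mono) auto
    show "\<bar>(y - x) * x ^ Suc m\<bar> \<le> \<bar>y - x\<bar> * M ^ Suc m"
      unfolding abs_mult using assms power_mono[of x M "Suc m"] by (intro mult_mono) auto
  qed
  also have "\<dots> = real (Suc (Suc m)) * \<bar>y - x\<bar> * M ^ Suc m" by (simp add: algebra_simps)
  finally show ?case .
qed simp

section \<open>From lattice cocycles to diffeomorphisms\<close>

lemma holder_continuous:
  assumes \<alpha>: "0 < \<alpha>" and holder: "\<And>x y. \<bar>F x - F y\<bar> \<le> C * \<bar>x - y\<bar> powr \<alpha>"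
  shows "continuous_on S (F :: real \<Rightarrow> real)"
proof -
  have "isCont F x" for x
    unfolding isCont_def
  proof (rule LIM_zero_cancel, rule Lim_null_comparison)
    show "((\<lambda>y. C * \<bar>y - x\<bar> powr \<alpha>) \<longlongrightarrow> 0) (at x)"
      using \<alpha> by (auto intro!: tendsto_eq_intros tendsto_powr2)
    show "\<forall>\<^sub>F y in at x. norm (F y - F x) \<le> C * \<bar>y - x\<bar> powr \<alpha>"
      using holder by (intro always_eventually) simp
  qed
  then show ?thesis by (simp add: continuous_at_imp_continuous_on)
qed

lemma has_nth_derivative_on_1:
  assumes "\<And>x. x \<in> S \<Longrightarrow> (f has_real_derivative D x) (at x within S)"
  shows "has_nth_derivative_on f 1 D S"
  unfolding has_nth_derivative_on_def
  using assms by (intro exI[of _ "\<lambda>i. if i = 0 then f else D"]) auto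

text \<open>
What the construction of diffeomorphisms uses of the group: a homomorphism to the lattice and a
real cocycle of polynomial growth that together act faithfully on \<open>\<int>\<^sup>k \<times> \<real>\<close>.
\<close>

locale lattice_cocycle = group G for G :: "('a, 'b) monoid_scheme" (structure) +
  fixes k :: nat and \<pi> :: "'a \<Rightarrow> nat \<Rightarrow> int" and c :: "'a \<Rightarrow> (nat \<Rightarrow> int) \<Rightarrow> real" and d :: nat
  assumes k_pos: "0 < k"
    and \<pi>_lattice: "g \<in> carrier G \<Longrightarrow> \<pi> g \<in> int_lattice k"
    and \<pi>_add: "g \<in> carrier G \<Longrightarrow> h \<in> carrier G \<Longrightarrow> \<pi> (g \<otimes> h) = (\<lambda>i. \<pi> g i + \<pi> h i)"
    and cocycle: "\<lbrakk>g \<in> carrier G; h \<in> carrier G; n \<in> int_lattice k\<rbrakk> \<Longrightarrow>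
      c (g \<otimes> h) n = c g (\<lambda>i. \<pi> h i + n i) + c h n"
    and growth: "g \<in> carrier G \<Longrightarrow>
      \<exists>C\<ge>0. \<forall>n\<in>int_lattice k. \<bar>c g n\<bar> \<le> C * (1 + real (taxicab k n)) ^ d"
    and faithful: "\<lbrakk>g \<in> carrier G; \<pi> g = (\<lambda>_. 0); c g (\<lambda>_. 0) = 0\<rbrakk> \<Longrightarrow> g = \<one>"

text \<open>
The choice of exponents: intervals have length \<open>size_at n powr (- 1 / \<alpha>)\<close> up to normalization and scale
\<open>size_at n ^ Suc m\<close>; the equation for \<open>\<gamma>\<close> makes their charts balanced, and \<open>d \<le> m\<close> keeps the cocycle
small compared with the scale.
\<close>

locale lattice_action = lattice_cocycle + bell_profile \<gamma> \<eta> \<Xi> for \<gamma> \<eta> :: real and \<Xi> +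
  fixes \<alpha> :: real and m :: nat
  assumes \<alpha>_pos: "0 < \<alpha>" and \<alpha>_k: "\<alpha> * real k < 1"
    and m_d: "d \<le> m" and exponents: "2 * \<gamma> - 1 = 1 / \<alpha> / real (Suc m)"
begin

abbreviation \<Omega> :: "(nat \<Rightarrow> int) set" where "\<Omega> \<equiv> int_lattice k"

definition size_at :: "(nat \<Rightarrow> int) \<Rightarrow> real" where
  "size_at n = 1 + real (taxicab k n)"

definition mass :: real where
  "mass = infsum (\<lambda>n. size_at n powr (- 1 / \<alpha>)) \<Omega>"

definition len :: "(nat \<Rightarrow> int) \<Rightarrow> real" where
  "len n = size_at n powr (- 1 / \<alpha>) / mass"

definition scale :: "(nat \<Rightarrow> int) \<Rightarrow> real" where
  "scale n = size_at n ^ Suc m"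

definition \<sigma> :: "'a \<Rightarrow> (nat \<Rightarrow> int) \<Rightarrow> nat \<Rightarrow> int" where
  "\<sigma> g n = (\<lambda>i. \<pi> g i + n i)"

definition piece :: "'a \<Rightarrow> (nat \<Rightarrow> int) \<Rightarrow> real \<Rightarrow> real" where
  "piece g n = slide (scale n) (len n) (scale (\<sigma> g n)) (len (\<sigma> g n)) (c g n)"

definition piece_deriv :: "'a \<Rightarrow> (nat \<Rightarrow> int) \<Rightarrow> real \<Rightarrow> real" where
  "piece_deriv g n = slide_deriv (scale n) (len n) (scale (\<sigma> g n)) (c g n)"

lemma size_at_ge_1: "1 \<le> size_at n"
  by (simp add: size_at_def)

lemma size_at_pos: "0 < size_at n"
  using size_at_ge_1[of n] by simp

lemma size_summable: "(\<lambda>n. size_at n powr (- 1 / \<alpha>)) summable_on \<Omega>"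
proof -
  have "real k < 1 / \<alpha>" using \<alpha>_pos \<alpha>_k by (simp add: field_simps)
  then show ?thesis using lattice_powr_summable[OF k_pos, of "1 / \<alpha>"] by (simp add: size_at_def)
qed

lemma zero_in_\<Omega>: "(\<lambda>_. 0) \<in> \<Omega>"
  by (simp add: int_lattice_def)

lemma mass_pos: "0 < mass"
proof -
  have "(\<Sum>n\<in>{\<lambda>_. 0}. size_at n powr (- 1 / \<alpha>)) \<le> mass"
    unfolding mass_def using zero_in_\<Omega> by (intro finite_sum_le_infsum size_summable) auto
  then have le: "size_at (\<lambda>_. 0) powr (- 1 / \<alpha>) \<le> mass" by simp
  have "0 < size_at (\<lambda>_. 0) powr (- 1 / \<alpha>)" using size_at_pos[of "\<lambda>_. 0"] by simp
  then show ?thesis using le by (rule order_less_le_trans)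
qed

lemma length_pos: "0 < len n"
  using size_at_pos[of n] mass_pos by (simp add: len_def)

lemma scale_pos: "0 < scale n"
  using size_at_pos[of n] by (simp add: scale_def)

lemma len_has_sum: "(len has_sum 1) \<Omega>"
proof -
  have "((\<lambda>n. size_at n powr (- 1 / \<alpha>)) has_sum mass) \<Omega>"
    unfolding mass_def using size_summable by simp
  from has_sum_cmult_left[OF this, of "1 / mass"] show ?thesis
    using mass_pos by (simp add: len_def[abs_def])
qed

sublocale ordered_intervals \<Omega> lex_less len
  by unfold_locales
    (use length_pos len_has_sum lex_less_irrefl lex_less_trans lex_less_total in blast)+

lemma balance: "len n * scale n powr (2 * \<gamma> - 1) = 1 / mass"
proof -
  have "scale n powr (2 * \<gamma> - 1) = size_at n powr (real (Suc m) * (2 * \<gamma> - 1))"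
    by (simp only: scale_def powr_powr flip: powr_realpow[OF size_at_pos])
  also have "real (Suc m) * (2 * \<gamma> - 1) = 1 / \<alpha>" unfolding exponents by simp
  finally have "scale n powr (2 * \<gamma> - 1) = size_at n powr (1 / \<alpha>)" .
  then show ?thesis using size_at_pos[of n] by (simp add: len_def flip: powr_add)
qed

lemma \<sigma>_in: "g \<in> carrier G \<Longrightarrow> n \<in> \<Omega> \<Longrightarrow> \<sigma> g n \<in> \<Omega>"
  using \<pi>_lattice[of g] by (simp add: \<sigma>_def int_lattice_def)

lemma \<sigma>_mult: "g \<in> carrier G \<Longrightarrow> h \<in> carrier G \<Longrightarrow> \<sigma> (g \<otimes> h) n = \<sigma> g (\<sigma> h n)"
  by (simp add: \<sigma>_def \<pi>_add add.assoc)

lemma \<pi>_one: "\<pi> \<one> = (\<lambda>_. 0)"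
proof
  fix i
  have "\<pi> (\<one> \<otimes> \<one>) i = \<pi> \<one> i + \<pi> \<one> i" by (simp only: \<pi>_add[OF one_closed one_closed])
  then show "\<pi> \<one> i = 0" by simp
qed

lemma \<sigma>_one: "\<sigma> \<one> n = n"
  by (simp add: \<sigma>_def \<pi>_one)

lemma c_one: "n \<in> \<Omega> \<Longrightarrow> c \<one> n = 0"
  using cocycle[of \<one> \<one> n] by (simp add: \<pi>_one)

lemma \<sigma>_bij: assumes g: "g \<in> carrier G" shows "bij_betw (\<sigma> g) \<Omega> \<Omega>"
proof (rule bij_betw_byWitness[where f' = "\<sigma> (inv g)"])
  show "\<forall>n\<in>\<Omega>. \<sigma> (inv g) (\<sigma> g n) = n"
    using \<sigma>_mult[of "inv g" g] g by (simp add: \<sigma>_one flip: \<sigma>_mult)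
  show "\<forall>n\<in>\<Omega>. \<sigma> g (\<sigma> (inv g) n) = n"
    using g by (simp add: \<sigma>_one flip: \<sigma>_mult)
qed (use \<sigma>_in g in auto)

lemma piecewise_map_piece:
  assumes g: "g \<in> carrier G" shows "piecewise_map (\<sigma> g) (piece g)"
  unfolding piecewise_map_def
proof (intro conjI ballI impI)
  show "lex_less (\<sigma> g i) (\<sigma> g j)" if "lex_less i j" for i j
    using that unfolding \<sigma>_def by (rule lex_less_translate)
  show "strict_mono_on {0..len i} (piece g i)" for i
    unfolding piece_def by (intro slide_strict_mono scale_pos length_pos)
qed (auto simp: \<sigma>_bij g piece_def slide_0 slide_end length_pos)

lemma piece_comp:
  assumes g: "g \<in> carrier G" and h: "h \<in> carrier G" and n: "n \<in> \<Omega>" and u: "0 \<le> u" "u \<le> len n"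
  shows "piece (g \<otimes> h) n u = piece g (\<sigma> h n) (piece h n u)"
proof -
  have "c (g \<otimes> h) n = c h n + c g (\<sigma> h n)" using cocycle[OF g h n] by (simp add: \<sigma>_def)
  then show ?thesis
    unfolding piece_def \<sigma>_mult[OF g h] using u
    by (simp add: slide_comp scale_pos length_pos)
qed

lemma piece_one: "n \<in> \<Omega> \<Longrightarrow> 0 \<le> u \<Longrightarrow> u \<le> len n \<Longrightarrow> piece \<one> n u = u"
  by (simp add: piece_def \<sigma>_one c_one slide_id scale_pos)

lemma size_at_translate:
  "size_at (\<lambda>i. v i + n i) \<le> (1 + real (taxicab k v)) * size_at n"
  "\<bar>size_at (\<lambda>i. v i + n i) - size_at n\<bar> \<le> real (taxicab k v)"
proof -
  have a: "real (taxicab k (\<lambda>i. v i + n i)) \<le> real (taxicab k v) + real (taxicab k n)"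
    using taxicab_add_le[of k v n] by (simp flip: of_nat_add)
  have "taxicab k n \<le> taxicab k (\<lambda>i. - v i) + taxicab k (\<lambda>i. v i + n i)"
    using taxicab_add_le[of k "\<lambda>i. - v i" "\<lambda>i. v i + n i"] by simp
  then have b: "real (taxicab k n) \<le> real (taxicab k v) + real (taxicab k (\<lambda>i. v i + n i))"
    by (simp add: taxicab_neg flip: of_nat_add)
  show "\<bar>size_at (\<lambda>i. v i + n i) - size_at n\<bar> \<le> real (taxicab k v)"
    using a b by (simp add: size_at_def abs_le_iff)
  have "(1 + real (taxicab k v)) * size_at n =
      1 + real (taxicab k v) + real (taxicab k n) + real (taxicab k v) * real (taxicab k n)"
    by (simp add: size_at_def algebra_simps)
  moreover have "0 \<le> real (taxicab k v) * real (taxicab k n)" by simp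
  ultimately show "size_at (\<lambda>i. v i + n i) \<le> (1 + real (taxicab k v)) * size_at n"
    using a unfolding size_at_def by linarith
qed

text \<open>
The hypotheses of \<open>slide_deriv_lipschitz\<close> hold with one constant for all intervals, the role of \<open>N\<close>
being played by \<open>size_at n\<close>.
\<close>

lemma scale_distortion:
  assumes g: "g \<in> carrier G"
  shows "\<exists>B\<ge>1. \<forall>n\<in>\<Omega>. \<bar>c g n\<bar> \<le> B * scale n / size_at n \<and>
     \<bar>scale (\<sigma> g n) - scale n\<bar> \<le> B * scale n / size_at n \<and> scale n \<le> B * scale (\<sigma> g n)"
proof -
  obtain C where C: "0 \<le> C" "\<And>n. n \<in> \<Omega> \<Longrightarrow> \<bar>c g n\<bar> \<le> C * size_at n ^ d"
    using growth[OF g] unfolding size_at_def by blast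
  define v where "v = real (taxicab k (\<pi> g))"
  have v: "0 \<le> v" by (simp add: v_def)
  define D where "D = real (Suc m) * v * (1 + v) ^ m"
  define E where "E = (1 + v) ^ Suc m"
  define B where "B = 1 + C + D + E"
  have nonneg: "0 \<le> D" "0 \<le> E" using v by (simp_all add: D_def E_def)
  have B: "1 \<le> B" "C \<le> B" "D \<le> B" "E \<le> B" using C(1) nonneg by (simp_all add: B_def)
  show ?thesis
  proof (intro exI[of _ B] conjI ballI B(1))
    fix n assume n: "n \<in> \<Omega>"
    let ?x = "size_at n" and ?y = "size_at (\<sigma> g n)"
    have quot: "scale n / ?x = ?x ^ m" using size_at_pos[of n] by (simp add: scale_def)
    have y1: "?y \<le> (1 + v) * ?x" and diff: "\<bar>?y - ?x\<bar> \<le> v"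
      using size_at_translate[of "\<pi> g" n] by (simp_all add: \<sigma>_def v_def)
    have x2: "?x \<le> (1 + v) * ?y"
      using size_at_translate(1)[of "\<lambda>i. - \<pi> g i" "\<sigma> g n"] by (simp add: \<sigma>_def v_def taxicab_neg)
    have "\<bar>c g n\<bar> \<le> C * ?x ^ d" using C(2) n .
    also have "\<dots> \<le> B * ?x ^ m"
      using B C(1) size_at_ge_1[of n] m_d by (intro mult_mono power_increasing) auto
    finally show "\<bar>c g n\<bar> \<le> B * scale n / ?x" using quot by (simp flip: times_divide_eq_right)
    have xx: "?x \<le> (1 + v) * ?x" using v size_at_pos[of n] by (simp add: algebra_simps)
    have "\<bar>?y ^ Suc m - ?x ^ Suc m\<bar> \<le> real (Suc m) * \<bar>?y - ?x\<bar> * ((1 + v) * ?x) ^ m"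
      using size_at_pos[of n] size_at_pos[of "\<sigma> g n"] xx y1
      by (intro power_difference_bound) auto
    also have "\<dots> \<le> real (Suc m) * v * ((1 + v) * ?x) ^ m"
      using diff v size_at_pos[of n] by (intro mult_right_mono mult_left_mono) auto
    also have "\<dots> = D * ?x ^ m" by (simp add: D_def power_mult_distrib)
    also have "\<dots> \<le> B * ?x ^ m" using B size_at_pos[of n] by (intro mult_right_mono) auto
    finally show "\<bar>scale (\<sigma> g n) - scale n\<bar> \<le> B * scale n / ?x"
      using quot by (simp add: scale_def flip: times_divide_eq_right)
    have "?x ^ Suc m \<le> ((1 + v) * ?y) ^ Suc m" using x2 size_at_pos[of n] by (intro power_mono) auto
    also have "\<dots> = E * scale (\<sigma> g n)" by (simp only: E_def scale_def power_mult_distrib)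
    also have "\<dots> \<le> B * scale (\<sigma> g n)" using B scale_pos[of "\<sigma> g n"] by (intro mult_right_mono) auto
    finally show "scale n \<le> B * scale (\<sigma> g n)" by (simp only: scale_def)
  qed
qed

text \<open>
On an interval of length \<open>len n\<close>, a Lipschitz bound is a Hoelder bound with constant multiplied by
\<open>len n powr (1 - \<alpha>)\<close>; the lengths are chosen such that \<open>size_at n * len n powr \<alpha>\<close> does not depend on
\<open>n\<close>.
\<close>

lemma lipschitz_to_holder:
  assumes t: "0 \<le> t" "t \<le> len n" and \<alpha>1: "\<alpha> \<le> 1"
  shows "t / (size_at n * len n) \<le> mass powr \<alpha> * t powr \<alpha>"
proof (cases "t = 0")
  case False
  have l: "0 < len n" and x: "0 < size_at n" using length_pos size_at_pos by auto
  have "t = t powr \<alpha> * t powr (1 - \<alpha>)" using t False by (simp flip: powr_add)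
  also have "\<dots> \<le> t powr \<alpha> * len n powr (1 - \<alpha>)"
    using t \<alpha>1 by (intro mult_left_mono powr_mono2) auto
  finally have "t / (size_at n * len n) \<le> t powr \<alpha> * len n powr (1 - \<alpha>) / (size_at n * len n)"
    using l x by (intro divide_right_mono) auto
  also have "\<dots> = t powr \<alpha> * (len n powr (- \<alpha>) / size_at n)"
    using l by (simp add: powr_diff powr_minus_divide)
  also have "len n powr (- \<alpha>) / size_at n = mass powr \<alpha>"
  proof -
    have "len n powr \<alpha> = size_at n powr (- 1) / mass powr \<alpha>"
      using \<alpha>_pos x mass_pos by (simp add: len_def powr_divide powr_powr)
    then show ?thesis using x mass_pos by (simp add: powr_minus_divide)
  qed
  finally show ?thesis by (simp add: mult.commute)
qed simp

lemma \<alpha>_lt_1: "\<alpha> < 1"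
proof -
  have "\<alpha> * 1 \<le> \<alpha> * real k" using \<alpha>_pos k_pos by (intro mult_left_mono) auto
  then show ?thesis using \<alpha>_k by simp
qed

lemma piecewise_derivative_piece:
  assumes g: "g \<in> carrier G"
  shows "\<exists>C\<ge>0. piecewise_derivative (piece g) (piece_deriv g) C \<alpha>"
proof -
  obtain B where B: "1 \<le> B" "\<And>n. n \<in> \<Omega> \<Longrightarrow> \<bar>c g n\<bar> \<le> B * scale n / size_at n"
     "\<And>n. n \<in> \<Omega> \<Longrightarrow> \<bar>scale (\<sigma> g n) - scale n\<bar> \<le> B * scale n / size_at n"
     "\<And>n. n \<in> \<Omega> \<Longrightarrow> scale n \<le> B * scale (\<sigma> g n)"
    using scale_distortion[OF g] by blast
  define K where "K = 12 * \<gamma> * (3 * B ^ 4) powr (\<gamma> + 1) * B\<^sup>2 / \<eta>"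
  have K: "0 \<le> K" using exponent height by (simp add: K_def)
  have bal: "len n * scale n powr (2 * \<gamma> - 1) = len (\<sigma> g n) * scale (\<sigma> g n) powr (2 * \<gamma> - 1)" for n
    by (simp only: balance)
  show ?thesis
  proof (intro exI[of _ "K * mass powr \<alpha>"] conjI)
    show "piecewise_derivative (piece g) (piece_deriv g) (K * mass powr \<alpha>) \<alpha>"
      unfolding piecewise_derivative_def
    proof (intro ballI conjI allI impI)
      fix n assume n: "n \<in> \<Omega>"
      show "piece_deriv g n 0 = 1" "piece_deriv g n (len n) = 1"
        by (simp_all add: piece_deriv_def slide_deriv_def)
      show "\<exists>z>u. z < v \<and> piece g n v - piece g n u = piece_deriv g n z * (v - u)"
        if "0 \<le> u" "u < v" "v \<le> len n" for u v
        unfolding piece_def piece_deriv_def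
        by (rule slide_mvt[OF scale_pos length_pos scale_pos length_pos bal that])
      fix u v assume uv: "u \<in> {0..len n}" "v \<in> {0..len n}"
      have "\<bar>piece_deriv g n u - piece_deriv g n v\<bar> \<le> K / (size_at n * len n) * \<bar>u - v\<bar>"
        unfolding piece_deriv_def K_def
        by (rule slide_deriv_lipschitz[OF scale_pos length_pos scale_pos B(1) size_at_ge_1 B(2)[OF n] B(3)[OF n] B(4)[OF n] uv])
      also have "\<dots> = K * (\<bar>u - v\<bar> / (size_at n * len n))" by simp
      also have "\<dots> \<le> K * (mass powr \<alpha> * \<bar>u - v\<bar> powr \<alpha>)"
        using uv K \<alpha>_lt_1 by (intro mult_left_mono lipschitz_to_holder) auto
      finally show "\<bar>piece_deriv g n u - piece_deriv g n v\<bar> \<le> K * mass powr \<alpha> * \<bar>u - v\<bar> powr \<alpha>"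
        by (simp add: mult.assoc)
    qed
  qed (use K in simp)
qed

definition act :: "'a \<Rightarrow> real \<Rightarrow> real" where
  "act g = restrict (glue (piece g)) {0..1}"

lemma act_in: "g \<in> carrier G \<Longrightarrow> x \<in> {0..1} \<Longrightarrow> act g x \<in> {0..1}"
  using glue_in_unit[OF piecewise_map_piece] by (simp add: act_def)

lemma act_mult:
  assumes g: "g \<in> carrier G" and h: "h \<in> carrier G" and x: "x \<in> {0..1}"
  shows "act (g \<otimes> h) x = act g (act h x)"
proof -
  have "glue (piece (g \<otimes> h)) x = glue (piece g) (glue (piece h) x)"
    by (rule glue_comp[OF piecewise_map_piece[OF h] piecewise_map_piece[OF g]]) (rule piece_comp[OF g h])
  moreover have "glue (piece h) x \<in> {0..1}" using glue_in_unit[OF piecewise_map_piece[OF h] x] .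
  ultimately show ?thesis using x unfolding act_def by (simp only: restrict_apply' if_True)
qed

lemma act_one: "x \<in> {0..1} \<Longrightarrow> act \<one> x = x"
  using glue_id[OF piece_one] by (simp add: act_def)

lemma act_inv_left: "g \<in> carrier G \<Longrightarrow> x \<in> {0..1} \<Longrightarrow> act (inv g) (act g x) = x"
  using act_mult[of "inv g" g x] by (simp add: act_one)

lemma act_inv_right: "g \<in> carrier G \<Longrightarrow> x \<in> {0..1} \<Longrightarrow> act g (act (inv g) x) = x"
  using act_mult[of g "inv g" x] by (simp add: act_one)

lemma act_bij: assumes "g \<in> carrier G" shows "bij_betw (act g) {0..1} {0..1}"
proof (rule bij_betw_byWitness[where f' = "act (inv g)"])
  show "\<forall>x\<in>{0..1}. act (inv g) (act g x) = x" using act_inv_left assms by blast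
  show "\<forall>x\<in>{0..1}. act g (act (inv g) x) = x" using act_inv_right assms by blast
  show "act g ` {0..1} \<subseteq> {0..1}" using act_in[OF assms] by blast
  show "act (inv g) ` {0..1} \<subseteq> {0..1}" using act_in[OF inv_closed[OF assms]] by blast
qed

lemma act_strict_mono: assumes g: "g \<in> carrier G" shows "strict_mono_on {0..1} (act g)"
proof (rule strict_mono_onI)
  fix x y :: real assume xy: "x \<in> {0..1}" "y \<in> {0..1}" "x < y"
  have "act g x \<le> act g y" using glue_mono[OF piecewise_map_piece[OF g], of x y] xy by (simp add: act_def)
  moreover have "act g x \<noteq> act g y" using act_inv_left[OF g xy(1)] act_inv_left[OF g xy(2)] xy(3) by auto
  ultimately show "act g x < act g y" by simp
qed

lemma act_derivative:
  assumes g: "g \<in> carrier G"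
  shows "\<exists>D C. (\<forall>x\<in>{0..1}. (act g has_real_derivative D x) (at x within {0..1})) \<and>
    continuous_on {0..1} D \<and> (\<forall>x y. \<bar>D x - D y\<bar> \<le> C * \<bar>x - y\<bar> powr \<alpha>)"
proof -
  obtain C where C: "0 \<le> C" "piecewise_derivative (piece g) (piece_deriv g) C \<alpha>"
    using piecewise_derivative_piece[OF g] by blast
  let ?D = "glue_deriv (piece_deriv g)"
  have H: "\<bar>?D x - ?D y\<bar> \<le> 2 * C * \<bar>x - y\<bar> powr \<alpha>" for x y
    by (rule glue_deriv_holder[OF C(2,1) \<alpha>_pos])
  have "(act g has_real_derivative ?D x) (at x within {0..1})" if x: "x \<in> {0..1}" for x
    by (rule has_field_derivative_transform_within[OF glue_has_derivative[OF C(2,1) \<alpha>_pos piecewise_map_piece[OF g] x] zero_less_one x])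
      (simp add: act_def)
  then show ?thesis using holder_continuous[OF \<alpha>_pos H] H by blast
qed

lemma act_Diff: assumes g: "g \<in> carrier G" shows "act g \<in> carrier (Diff_plus 1 \<alpha>)"
proof -
  obtain D C where D: "\<And>x. x \<in> {0..1} \<Longrightarrow> (act g has_real_derivative D x) (at x within {0..1})"
    "continuous_on {0..1} D" "\<And>x y. \<bar>D x - D y\<bar> \<le> C * \<bar>x - y\<bar> powr \<alpha>"
    using act_derivative[OF g] by blast
  obtain D' where D': "\<And>x. x \<in> {0..1} \<Longrightarrow> (act (inv g) has_real_derivative D' x) (at x within {0..1})"
    "continuous_on {0..1} D'"
    using act_derivative[OF inv_closed[OF g]] by blast
  have inv_eq: "inv_into {0..1} (act g) x = act (inv g) x" if x: "x \<in> {0..1}" for x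
    using act_bij[OF g] act_in[OF inv_closed[OF g] x] act_inv_right[OF g x]
    by (intro inv_into_f_eq) (auto simp: bij_betw_def)
  have D'': "(inv_into {0..1} (act g) has_real_derivative D' x) (at x within {0..1})" if x: "x \<in> {0..1}" for x
    by (rule has_field_derivative_transform_within[OF D'(1)[OF x] zero_less_one x]) (simp add: inv_eq)
  have "act g \<in> Bij {0..1}" using act_bij[OF g] by (simp add: Bij_def act_def)
  moreover have "has_nth_derivative_on (act g) 1 D {0..1}" using D(1) by (rule has_nth_derivative_on_1)
  moreover have "has_nth_derivative_on (inv_into {0..1} (act g)) 1 D' {0..1}"
    using D'' by (rule has_nth_derivative_on_1)
  moreover have "Holder_on \<alpha> D {0..1}" using D(3) by (auto simp: Holder_on_def)
  ultimately show ?thesis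
    using act_strict_mono[OF g] D(2) D'(2) by (auto simp: Diff_plus_def C_on_def)
qed

lemma act_hom: "act \<in> hom G (Diff_plus 1 \<alpha>)"
proof (rule homI)
  fix g h assume gh: "g \<in> carrier G" "h \<in> carrier G"
  have B: "act f \<in> Bij {0..1}" if "f \<in> carrier G" for f
    using act_bij[OF that] by (simp add: Bij_def act_def)
  have "act (g \<otimes> h) = compose {0..1} (act g) (act h)"
  proof
    fix x show "act (g \<otimes> h) x = compose {0..1} (act g) (act h) x"
      using act_mult[OF gh] by (cases "x \<in> {0..1}") (auto simp: compose_def act_def)
  qed
  then show "act (g \<otimes> h) = act g \<otimes>\<^bsub>Diff_plus 1 \<alpha>\<^esub> act h"
    using B gh by (simp add: Diff_plus_def BijGroup_def)
qed (rule act_Diff)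

text \<open>
An element that acts trivially fixes the interval over the origin, so it lies in the kernel of \<open>\<pi>\<close>,
and it acts there as the translation by its cocycle value, which must be \<open>0\<close>.
\<close>

lemma act_eq_id:
  assumes g: "g \<in> carrier G" and id: "\<And>x. x \<in> {0..1} \<Longrightarrow> act g x = x"
  shows "g = \<one>"
proof -
  let ?o = "\<lambda>_::nat. 0::int"
  have pm: "piecewise_map (\<sigma> g) (piece g)" by (rule piecewise_map_piece[OF g])
  have unit: "left ?o + u \<in> {0..1}" if "0 \<le> u" "u \<le> len ?o" for u
    using that left_nonneg[of ?o] right_le_1[OF zero_in_\<Omega>] by auto
  have glue_eq: "left (\<sigma> g ?o) + piece g ?o u = left ?o + u" if u: "0 \<le> u" "u \<le> len ?o" for u
    using glue_at[OF pm zero_in_\<Omega> u] id[OF unit[OF u]] unit[OF u] by (simp add: act_def)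
  have "left (\<sigma> g ?o) = left ?o"
    using glue_eq[of 0] length_pos[of ?o] by (simp add: piece_def slide_0)
  then have fixed: "\<sigma> g ?o = ?o" using left_inject \<sigma>_in[OF g zero_in_\<Omega>] zero_in_\<Omega> by blast
  then have \<pi>0: "\<pi> g = ?o" by (simp add: \<sigma>_def)
  have "slide (scale ?o) (len ?o) (scale ?o) (len ?o) (c g ?o) u = u" if "0 \<le> u" "u \<le> len ?o" for u
    using glue_eq[OF that] by (simp add: fixed piece_def)
  then have "c g ?o = 0" by (rule slide_translation_unique[OF scale_pos length_pos])
  then show ?thesis using faithful[OF g \<pi>0] by simp
qed

theorem embeds: "embeds_into G (Diff_plus 1 \<alpha>)"
proof -
  have "inj_on act (carrier G)"
  proof (rule inj_onI)
    fix g h assume gh: "g \<in> carrier G" "h \<in> carrier G" and eq: "act g = act h"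
    have "act (inv h \<otimes> g) x = x" if "x \<in> {0..1}" for x
      using act_mult[of "inv h" g x] act_inv_left[of h x] gh that eq by simp
    then have "inv h \<otimes> g = \<one>" using gh by (intro act_eq_id) auto
    then show "g = h" using gh by (metis inv_closed inv_equality inv_inv)
  qed
  then have "act \<in> mon G (Diff_plus 1 \<alpha>)" using act_hom by (simp add: mon_def)
  then show ?thesis by (auto simp: embeds_into_def)
qed

end

text \<open>
Any \<open>m\<close> above the degree of the cocycle and above \<open>1 / \<alpha>\<close> will do; the latter gives \<open>\<gamma> < 1\<close>.
\<close>

theorem (in lattice_cocycle) embeds_into_Diff:
  assumes \<alpha>: "0 < \<alpha>" "\<alpha> * real k < 1"
  shows "embeds_into G (Diff_plus 1 \<alpha>)"
proof -
  obtain m where m: "max (real d) (1 / \<alpha>) < real m" using reals_Archimedean2 by blast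
  define \<gamma> where "\<gamma> = (1 + 1 / \<alpha> / real (Suc m)) / 2"
  have "0 < 1 / \<alpha> / real (Suc m)" using \<alpha> by simp
  moreover have "1 / \<alpha> / real (Suc m) < 1"
  proof -
    have "1 / \<alpha> < real (Suc m)" using m by simp
    then show ?thesis by (subst pos_divide_less_eq) auto
  qed
  ultimately have \<gamma>: "1 / 2 < \<gamma>" "\<gamma> < 1" by (simp_all add: \<gamma>_def)
  then obtain \<eta> \<Xi> where "bell_profile \<gamma> \<eta> \<Xi>" using bell_profile_exists by blast
  moreover have "d \<le> m" using m by simp
  moreover have "2 * ((1 + q) / 2) - 1 = q" for q :: real by (simp add: field_simps)
  then have "2 * \<gamma> - 1 = 1 / \<alpha> / real (Suc m)" unfolding \<gamma>_def .
  ultimately have "lattice_action G k \<pi> c d \<gamma> \<eta> \<Xi> \<alpha> m"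
    using \<alpha> lattice_cocycle_axioms by (simp add: lattice_action_def lattice_action_axioms_def)
  then show ?thesis by (rule lattice_action.embeds)
qed

section \<open>The embedding and the critical regularity\<close>

context abelian_normal_data
begin

lemma quotient_finitely_generated:
  assumes "finitely_generated G" shows "finitely_generated (G Mod A)"
proof -
  interpret N: normal A G using normalA .
  interpret Q: group "G Mod A" using N.factorgroup_is_group .
  interpret h: group_hom G "G Mod A" "\<lambda>x. A #> x"
    by unfold_locales (rule N.r_coset_hom_Mod)
  obtain S where S: "finite S" "S \<subseteq> carrier G" "generate G S = carrier G"
    using assms by (auto simp: finitely_generated_def)
  have "generate (G Mod A) ((\<lambda>x. A #> x) ` S) = (\<lambda>x. A #> x) ` carrier G"
    using h.generate_img[OF S(2)] S(3) by simp
  also have "\<dots> = carrier (G Mod A)" by (auto simp: FactGroup_def RCOSETS_def)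
  finally show ?thesis
    using S h.hom_closed unfolding finitely_generated_def
    by (intro exI[of _ "(\<lambda>x. A #> x) ` S"]) auto
qed

text \<open>
Coordinates of a coset with respect to a basis of \<open>G / A\<close>, cut off at the rank.
\<close>

lemma quotient_coordinates:
  assumes fg: "finitely_generated G"
  shows "\<exists>\<pi> b. (\<forall>i<torsion_free_rank (G Mod A). b i \<in> carrier G) \<and>
    (\<forall>g\<in>carrier G. \<pi> g \<in> int_lattice (torsion_free_rank (G Mod A))) \<and>
    (\<forall>g\<in>carrier G. \<forall>h\<in>carrier G. \<pi> (g \<otimes> h) = (\<lambda>i. \<pi> g i + \<pi> h i)) \<and>
    (\<forall>g\<in>carrier G. \<pi> g = (\<lambda>_. 0) \<longleftrightarrow> g \<in> A) \<and>
    (\<forall>i<torsion_free_rank (G Mod A). \<pi> (b i) = (\<lambda>j. if j = i then 1 else 0))"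
proof -
  interpret N: normal A G using normalA .
  interpret Q: comm_group "G Mod A" by (rule quotient_comm_group)
  obtain r e where e: "e ` {..<r} \<subseteq> carrier (G Mod A)"
    and span: "\<forall>X\<in>carrier (G Mod A). \<exists>n. X = Q.lincomb r e n"
    and indep: "\<forall>n. Q.lincomb r e n = \<one>\<^bsub>G Mod A\<^esub> \<longrightarrow> (\<forall>i<r. n i = 0)"
    using Q.finitely_generated_torsion_free_basis[OF quotient_torsion_free quotient_finitely_generated[OF fg]]
    by (elim exE conjE) (rule that)
  have rank: "torsion_free_rank (G Mod A) = r"
    by (rule Q.torsion_free_rank_eq_basis_size[OF e span indep])
  note uniq = Q.lincomb_unique[OF e indep]
  have coset: "A #> g \<in> carrier (G Mod A)" if "g \<in> carrier G" for g
    using that by (auto simp: FactGroup_def RCOSETS_def)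
  have "\<forall>X. \<exists>n. X \<in> carrier (G Mod A) \<longrightarrow> X = Q.lincomb r e n" using span by blast
  then obtain co where co: "\<And>X. X \<in> carrier (G Mod A) \<Longrightarrow> X = Q.lincomb r e (co X)" by metis
  have lin_co: "Q.lincomb r e (co (A #> g)) = A #> g" if "g \<in> carrier G" for g
    by (rule co[OF coset[OF that], symmetric])
  define \<pi> where "\<pi> g = (\<lambda>i. if i < r then co (A #> g) i else 0)" for g
  have "\<forall>i. \<exists>g. i < r \<longrightarrow> g \<in> carrier G \<and> e i = A #> g"
    using e by (force simp: FactGroup_def RCOSETS_def)
  then obtain b where b: "\<And>i. i < r \<Longrightarrow> b i \<in> carrier G" "\<And>i. i < r \<Longrightarrow> e i = A #> b i" by metis
  have mult: "\<pi> (g \<otimes> h) = (\<lambda>i. \<pi> g i + \<pi> h i)" if gh: "g \<in> carrier G" "h \<in> carrier G" for g h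
  proof
    fix i
    have "A #> (g \<otimes> h) = (A #> g) \<otimes>\<^bsub>G Mod A\<^esub> (A #> h)"
      using gh by (simp add: FactGroup_def N.rcos_sum)
    then have "Q.lincomb r e (co (A #> (g \<otimes> h))) = Q.lincomb r e (\<lambda>i. co (A #> g) i + co (A #> h) i)"
      unfolding Q.lincomb_add[OF e] lin_co[OF gh(1)] lin_co[OF gh(2)] lin_co[OF m_closed[OF gh]] .
    from uniq[OF this, of i] show "\<pi> (g \<otimes> h) i = \<pi> g i + \<pi> h i" by (simp add: \<pi>_def)
  qed
  have kernel: "\<pi> g = (\<lambda>_. 0) \<longleftrightarrow> g \<in> A" if g: "g \<in> carrier G" for g
  proof
    assume "\<pi> g = (\<lambda>_. 0)"
    then have z: "co (A #> g) i = 0" if "i < r" for i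
      using that unfolding \<pi>_def by (auto dest: fun_cong[of _ _ i])
    have "A #> g = Q.lincomb r e (co (A #> g))" using lin_co[OF g] by (rule sym)
    also have "\<dots> = Q.lincomb r e (\<lambda>_. 0)"
      using e z by (rule Q.lincomb_cong)
    also have "\<dots> = A" unfolding Q.lincomb_zero by (simp add: FactGroup_def)
    finally show "g \<in> A" using rcos_self[OF g subA] by simp
  next
    assume "g \<in> A"
    then have "A #> g = \<one>\<^bsub>G Mod A\<^esub>" by (simp add: FactGroup_def subgroup.rcos_const[OF subA is_group])
    then have "Q.lincomb r e (co (A #> g)) = \<one>\<^bsub>G Mod A\<^esub>" unfolding lin_co[OF g] .
    then show "\<pi> g = (\<lambda>_. 0)" using indep by (auto simp: \<pi>_def)
  qed
  have unit: "\<pi> (b i) = (\<lambda>j. if j = i then 1 else 0)" if i: "i < r" for i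
  proof
    fix j
    have eq: "Q.lincomb r e (co (A #> b i)) = Q.lincomb r e (\<lambda>j. if j = i then 1 else 0)"
      unfolding lin_co[OF b(1)[OF i]] Q.lincomb_unit[OF e i] by (rule b(2)[OF i, symmetric])
    then show "\<pi> (b i) j = (if j = i then 1 else 0)"
      using uniq[OF eq, of j] i by (cases "j < r") (auto simp: \<pi>_def)
  qed
  show ?thesis
    unfolding rank using b(1) mult kernel unit
    by (intro exI[of _ \<pi>] exI[of _ b]) (auto simp: \<pi>_def int_lattice_def)
qed

lemma A_embeds_in_reals:
  assumes fg: "finitely_generated G"
  shows "\<exists>\<phi>. (\<forall>x\<in>A. \<forall>y\<in>A. \<phi> (x \<otimes> y) = \<phi> x + (\<phi> y :: real)) \<and> (\<forall>x\<in>A. \<phi> x = 0 \<longrightarrow> x = \<one>)"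
proof -
  interpret H: comm_group "G\<lparr>carrier := A\<rparr>" by (rule comm_groupA)
  obtain S where S: "finite S" "S \<subseteq> carrier G" "generate G S = carrier G"
    using fg by (auto simp: finitely_generated_def)
  have "countable (carrier G)" using countable_generate[OF countable_finite[OF S(1)] S(2)] S(3) by simp
  then have "countable (carrier (G\<lparr>carrier := A\<rparr>))" using A_carrier by (auto intro: countable_subset)
  moreover have "torsion_free (G\<lparr>carrier := A\<rparr>)"
    unfolding torsion_free_def
  proof (intro ballI allI impI)
    fix x and n :: nat
    assume "x \<in> carrier (G\<lparr>carrier := A\<rparr>)" "0 < n" "x [^]\<^bsub>G\<lparr>carrier := A\<rparr>\<^esub> n = \<one>\<^bsub>G\<lparr>carrier := A\<rparr>\<^esub>"
    then show "x = \<one>\<^bsub>G\<lparr>carrier := A\<rparr>\<^esub>"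
      using tf A_carrier by (auto simp: torsion_free_def simp flip: nat_pow_consistent)
  qed
  ultimately show ?thesis using H.torsion_free_embeds_in_reals by simp
qed

end

context abelian_normal_coordinates
begin

lemma shift_lattice_cocycle:
  assumes "0 < k"
  shows "\<exists>d. lattice_cocycle G k \<pi> (\<lambda>g n. shift g (rep n)) d"
proof -
  obtain d where d: "\<forall>g\<in>carrier G. tempered d (shift g)" using shift_tempered by blast
  have rep: "\<pi> (rep n) = n" if "n \<in> int_lattice k" for n
    using that by (intro \<pi>_rep) (simp add: int_lattice_def)
  have "lattice_cocycle G k \<pi> (\<lambda>g n. shift g (rep n)) d"
  proof
    fix g h n assume gh: "g \<in> carrier G" "h \<in> carrier G" and n: "n \<in> int_lattice k"
    have sum: "(\<lambda>i. \<pi> h i + n i) \<in> int_lattice k"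
      using n \<pi>_support[OF gh(2)] by (simp add: int_lattice_def)
    have "shift g (h \<otimes> rep n) = shift g (rep (\<lambda>i. \<pi> h i + n i))"
      using gh n sum rep by (intro shift_depends_on_coordinates) (auto simp: \<pi>_mult)
    then show "shift (g \<otimes> h) (rep n) = shift g (rep (\<lambda>i. \<pi> h i + n i)) + shift h (rep n)"
      using shift_mult[OF gh rep_closed] by simp
  next
    fix g assume g: "g \<in> carrier G"
    then obtain C where "0 \<le> C" "\<And>x. x \<in> carrier G \<Longrightarrow> \<bar>shift g x\<bar> \<le> C * (1 + real (taxicab k (\<pi> x))) ^ d"
      using d unfolding tempered_def by blast
    then show "\<exists>C\<ge>0. \<forall>n\<in>int_lattice k. \<bar>shift g (rep n)\<bar> \<le> C * (1 + real (taxicab k n)) ^ d"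
      using rep by (metis rep_closed)
  next
    fix g assume g: "g \<in> carrier G" "\<pi> g = (\<lambda>_. 0)" "shift g (rep (\<lambda>_. 0)) = 0"
    then have gA: "g \<in> A" using \<pi>_kernel by blast
    then have "\<phi> g = 0" using g(3) shift_A[OF gA one_closed] g(1) by (simp add: rep_zero)
    then show "g = \<one>" using \<phi>_inj gA by blast
  next
    show "\<pi> g \<in> int_lattice k" if "g \<in> carrier G" for g
      using \<pi>_support[OF that] by (simp add: int_lattice_def)
  qed (use assms \<pi>_mult in auto)
  then show ?thesis by blast
qed

end

lemma Holder_on_unit_mono:
  assumes "Holder_on \<beta> g {0..1}" "\<alpha> \<le> \<beta>" shows "Holder_on \<alpha> g {0..1}"
proof -
  obtain C where C: "\<forall>x\<in>{0..1}. \<forall>y\<in>{0..1}. \<bar>g x - g y\<bar> \<le> C * \<bar>x - y\<bar> powr \<beta>"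
    using assms(1) by (auto simp: Holder_on_def)
  have "\<bar>g x - g y\<bar> \<le> \<bar>C\<bar> * \<bar>x - y\<bar> powr \<alpha>" if xy: "x \<in> {0..1}" "y \<in> {0..1}" for x y
  proof -
    have "\<bar>g x - g y\<bar> \<le> C * \<bar>x - y\<bar> powr \<beta>" using C xy by blast
    also have "\<dots> \<le> \<bar>C\<bar> * \<bar>x - y\<bar> powr \<beta>" by (intro mult_right_mono) auto
    also have "\<dots> \<le> \<bar>C\<bar> * \<bar>x - y\<bar> powr \<alpha>"
      using xy assms(2) by (intro mult_left_mono powr_mono') auto
    finally show ?thesis .
  qed
  then show ?thesis unfolding Holder_on_def by blast
qed

lemma embeds_into_mono:
  assumes "embeds_into G (Diff_plus n \<beta>)" "carrier (Diff_plus n \<beta>) \<subseteq> carrier (Diff_plus n' \<alpha>)"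
  shows "embeds_into G (Diff_plus n' \<alpha>)"
proof -
  obtain f where "f \<in> mon G (Diff_plus n \<beta>)" using assms(1) by (auto simp: embeds_into_def)
  moreover have "monoid.mult (Diff_plus n \<beta>) = monoid.mult (Diff_plus n' \<alpha>)" by (simp add: Diff_plus_def)
  ultimately have "f \<in> mon G (Diff_plus n' \<alpha>)"
    using assms(2) by (auto simp: mon_def hom_def)
  then show ?thesis by (auto simp: embeds_into_def)
qed

lemma Diff_plus_Holder_mono: "\<alpha> \<le> \<beta> \<Longrightarrow> carrier (Diff_plus n \<beta>) \<subseteq> carrier (Diff_plus n \<alpha>)"
  using Holder_on_unit_mono by (auto simp: Diff_plus_def)

lemma C_on_1_imp_C_on_0:
  assumes "C_on 1 f S" shows "C_on 0 f S"
proof -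
  obtain D :: "nat \<Rightarrow> real \<Rightarrow> real" where D: "D 0 = f" "\<And>x. x \<in> S \<Longrightarrow> (D 0 has_real_derivative D (Suc 0) x) (at x within S)"
    using assms by (auto simp: C_on_def has_nth_derivative_on_def)
  have "continuous_on S f" using D by (metis DERIV_continuous_on)
  moreover have "has_nth_derivative_on f 0 f S"
    unfolding has_nth_derivative_on_def by (intro exI[of _ "\<lambda>_. f"]) simp
  ultimately show ?thesis unfolding C_on_def by blast
qed

lemma Diff_plus_1_subset_homeo: "carrier (Diff_plus 1 \<alpha>) \<subseteq> carrier (Diff_plus 0 0)"
proof
  fix f assume f: "f \<in> carrier (Diff_plus 1 \<alpha>)"
  have maps: "f x \<in> {0..1}" if "x \<in> {0..1}" for x
    using f that Bij_imp_funcset by (fastforce simp: Diff_plus_def)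
  have "\<bar>f x - f y\<bar> \<le> 1 * \<bar>x - y\<bar> powr 0" if "x \<in> {0..1}" "y \<in> {0..1}" for x y
    using maps[OF that(1)] maps[OF that(2)] by (cases "x = y") auto
  then have "Holder_on 0 f {0..1}" unfolding Holder_on_def by blast
  moreover have "has_nth_derivative_on f 0 f {0..1}"
    unfolding has_nth_derivative_on_def by (intro exI[of _ "\<lambda>_. f"]) simp
  ultimately show "f \<in> carrier (Diff_plus 0 0)"
    using f C_on_1_imp_C_on_0 by (auto simp: Diff_plus_def)
qed

text \<open>
The supremum need not be attained, so \<open>s\<close> is approached from below.
\<close>

lemma Crit_lower_bound:
  assumes emb: "\<And>\<alpha>. 0 \<le> \<alpha> \<Longrightarrow> \<alpha> < 1 \<Longrightarrow> \<alpha> < s \<Longrightarrow> embeds_into G (Diff_plus 1 \<alpha>)"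
    and s: "0 < s" "s \<le> 1"
  shows "ereal (1 + s) \<le> Crit G"
proof -
  have "embeds_into G (Diff_plus 0 0)"
    using embeds_into_mono[OF emb Diff_plus_1_subset_homeo, of 0] s by simp
  then have Crit: "Crit G = Sup {ereal (real n + \<alpha>) | n \<alpha>. 0 \<le> \<alpha> \<and> \<alpha> < 1 \<and> embeds_into G (Diff_plus n \<alpha>)}"
    by (simp add: Crit_def)
  show ?thesis
  proof (rule ereal_le_epsilon2)
    fix \<epsilon> :: real assume \<epsilon>: "0 < \<epsilon>"
    define \<alpha> where "\<alpha> = max 0 (s - \<epsilon>)"
    have \<alpha>: "0 \<le> \<alpha>" "\<alpha> < 1" "\<alpha> < s" using s \<epsilon> by (auto simp: \<alpha>_def)
    have "ereal (real 1 + \<alpha>) \<le> Crit G"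
      unfolding Crit using emb[OF \<alpha>] \<alpha> by (intro Sup_upper) blast
    moreover have "ereal (1 + s) \<le> ereal (real 1 + \<alpha>) + ereal \<epsilon>" by (simp add: \<alpha>_def)
    ultimately show "ereal (1 + s) \<le> Crit G + ereal \<epsilon>"
      by (meson add_right_mono order_trans)
  qed
qed

theorem theoremA:
  fixes G :: "('a, 'b) monoid_scheme" and A :: "'a set" and k :: nat
  assumes "group G"
    and "\<not> comm_group G"
    and "torsion_free G"
    and "finitely_generated G"
    and "nilpotent G"
    and "metabelian G"
    and "maximal_abelian_subgroup A G"
    and "derived G (carrier G) \<subseteq> A"
    and "k = torsion_free_rank (G Mod A)"
  shows "(\<forall>\<alpha>::real. 0 \<le> \<alpha> \<and> \<alpha> < 1 \<and> \<alpha> < 1 / real k \<longrightarrow> embeds_into G (Diff_plus 1 \<alpha>))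
       \<and> ereal (1 + 1 / real k) \<le> Crit G"
proof -
  interpret D: abelian_normal_data G A
    using assms by (simp add: abelian_normal_data_def abelian_normal_data_axioms_def)
  obtain \<pi> b where b: "\<And>i. i < k \<Longrightarrow> b i \<in> carrier G"
    and \<pi>: "\<And>g. g \<in> carrier G \<Longrightarrow> \<pi> g \<in> int_lattice k"
      "\<And>g h. g \<in> carrier G \<Longrightarrow> h \<in> carrier G \<Longrightarrow> \<pi> (g \<otimes>\<^bsub>G\<^esub> h) = (\<lambda>i. \<pi> g i + \<pi> h i)"
      "\<And>g. g \<in> carrier G \<Longrightarrow> \<pi> g = (\<lambda>_. 0) \<longleftrightarrow> g \<in> A"
      "\<And>i. i < k \<Longrightarrow> \<pi> (b i) = (\<lambda>j. if j = i then 1 else 0)"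
    using D.quotient_coordinates[OF assms(4)] unfolding assms(9)[symmetric] by blast
  obtain \<phi> where \<phi>: "\<And>x y. x \<in> A \<Longrightarrow> y \<in> A \<Longrightarrow> \<phi> (x \<otimes>\<^bsub>G\<^esub> y) = \<phi> x + (\<phi> y :: real)"
      "\<And>x. x \<in> A \<Longrightarrow> \<phi> x = 0 \<Longrightarrow> x = \<one>\<^bsub>G\<^esub>"
    using D.A_embeds_in_reals[OF assms(4)] by blast
  interpret C: abelian_normal_coordinates G A k \<pi> b \<phi>
    by unfold_locales (use b \<pi> \<phi> in \<open>auto simp: int_lattice_def\<close>)
  have k: "0 < k"
  proof (rule ccontr)
    assume "\<not> 0 < k"
    then have "carrier G \<subseteq> A" using \<pi>(1,3) by (auto simp: int_lattice_def fun_eq_iff)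
    then have "comm_group G" using D.A_comm by (intro D.group_comm_groupI) auto
    then show False using assms(2) by blast
  qed
  obtain d where "lattice_cocycle G k \<pi> (\<lambda>g n. C.shift g (C.rep n)) d"
    using C.shift_lattice_cocycle[OF k] by blast
  then interpret L: lattice_cocycle G k \<pi> "\<lambda>g n. C.shift g (C.rep n)" d .
  have emb: "embeds_into G (Diff_plus 1 \<alpha>)" if \<alpha>: "0 \<le> \<alpha>" "\<alpha> < 1 / real k" for \<alpha>
  proof -
    \<comment> \<open>The construction requires a positive exponent; passing to a larger one covers \<open>\<alpha> = 0\<close>.\<close>
    obtain \<beta> where \<beta>: "\<alpha> < \<beta>" "\<beta> < 1 / real k" using dense[OF \<alpha>(2)] by blast
    have "embeds_into G (Diff_plus 1 \<beta>)"
      using \<alpha> \<beta> k by (intro L.embeds_into_Diff) (auto simp: field_simps)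
    then show ?thesis using embeds_into_mono Diff_plus_Holder_mono \<beta>(1) less_imp_le by blast
  qed
  moreover have "ereal (1 + 1 / real k) \<le> Crit G"
    using emb k by (intro Crit_lower_bound) auto
  ultimately show ?thesis by blast
qed

end
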